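(* Let $\ell>0$, $0<\sigma<1$, $\Omega=(0,\pi)\times(-\ell,\ell)$. For $\alpha>0$, $\alpha\neq1$, let $$f_\alpha(x,y)=\frac{\alpha\,e^{\alpha y}\sin x}{4\sinh(\alpha\ell)},$$ let $u_\alpha$ be the unique solution of the partially hinged plate problem on $\Omega$ with load $f_\alpha$, and set $\mathcal G_\alpha(x)=u_\alpha(x,\ell)-u_\alpha(x,-\ell)$ and $\mathcal G_\alpha^\infty=\max_{x\in[0,\pi]}|u_\alpha(x,\ell)-u_\alpha(x,-\ell)|$. With $E(\ell,\alpha)$ and $E(\ell)$ the quantities defined in the context, one has $$\mathcal G_\alpha(x)=E(\ell,\alpha)\sin x\ \longrightarrow\ \overline{\mathcal G}(x):=E(\ell)\sin x\qquad\text{uniformly on }[0,\pi]\text{ as }\alpha\to+\infty.$$ In particular, $$\mathcal G_\alpha^\infty=E(\ell,\alpha)=E(\ell)-\frac1\alpha\,\frac{(1+\sigma)\cosh\ell\,\sinh\ell+(1-\sigma)\ell}{2(1-\sigma)\left[(3+\sigma)\cosh(\ell)\sinh(\ell)+(1-\sigma)\ell\right]}+o\!\left(\frac1\alpha\right)\qquad\text{as }\alpha\to+\infty.$$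
   Context: Plate problem with load $f$: $$\begin{cases}\Delta^2u=f & \text{in }\Omega\\ u(0,y)=u_{xx}(0,y)=u(\pi,y)=u_{xx}(\pi,y)=0 & y\in(-\ell,\ell)\\ u_{yy}(x,\pm\ell)+\sigma u_{xx}(x,\pm\ell)=u_{yyy}(x,\pm\ell)+(2-\sigma)u_{xxy}(x,\pm\ell)=0 & x\in(0,\pi).\end{cases}$$ Let $H^2_*=\{w\in H^2(\Omega): w=0 \text{ on }\{0,\pi\}\times(-\ell,\ell)\}$, a Hilbert space with scalar product $$(u,v)_{H^2_*}=\int_\Omega\left[\Delta u\,\Delta v+(1-\sigma)(2u_{xy}v_{xy}-u_{xx}v_{yy}-u_{yy}v_{xx})\right]dx\,dy.$$ For $f\in L^2(\Omega)$, the solution is the unique $u\in H^2_*$ with $(u,v)_{H^2_*}=\int_\Omega fv\,dx\,dy$ for all $v\in H^2_*$; it belongs to $H^4(\Omega)$ and is continuous on $\overline\Omega$. Definitions: $$E(\ell,\alpha)=\frac{\alpha}{2(1-\alpha^2)^2}+\frac{\alpha\,B\,\sinh\ell}{2\sinh(\alpha\ell)}+\frac{\alpha\,C\,\ell\cosh\ell}{2\sinh(\alpha\ell)},\qquad E(\ell)=\frac{\sinh^2(\ell)}{(1-\sigma)\left[(1-\sigma)\ell+(3+\sigma)\sinh(\ell)\cosh(\ell)\right]},$$ where $B=B(1,\ell,\alpha)$ and $C=C(1,\ell,\alpha)$ are the solution of the linear system $$\begin{cases}(1-\sigma)\sinh(\ell)\,B+[2\sinh(\ell)+(1-\sigma)\ell\cosh(\ell)]\,C=\frac{\sigma-\alpha^2}{(1-\alpha^2)^2}\sinh(\alpha\ell)\\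 (\sigma-1)\cosh(\ell)\,B+[(1+\sigma)\cosh(\ell)+(\sigma-1)\ell\sinh(\ell)]\,C=\alpha\frac{(2-\sigma)-\alpha^2}{(1-\alpha^2)^2}\cosh(\alpha\ell).\end{cases}$$ Explicitly, $$B=\frac{(1+\sigma)(\sigma-\alpha^2)\cosh(\ell)\sinh(\alpha\ell)+(1-\sigma)(\alpha^2-\sigma)\ell\sinh(\ell)\sinh(\alpha\ell)+2\alpha(\alpha^2+\sigma-2)\sinh(\ell)\cosh(\alpha\ell)+(1-\sigma)\alpha(\alpha^2+\sigma-2)\ell\cosh(\ell)\cosh(\alpha\ell)}{(1-\sigma)(\alpha^2-1)^2[(3+\sigma)\cosh(\ell)\sinh(\ell)+(1-\sigma)\ell]},$$ $$C=\frac{\alpha(2-\sigma-\alpha^2)\sinh(\ell)\cosh(\alpha\ell)+(\sigma-\alpha^2)\cosh(\ell)\sinh(\alpha\ell)}{(\alpha^2-1)^2[(3+\sigma)\cosh(\ell)\sinh(\ell)+(1-\sigma)\ell]}.$$ *)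

theory Defs
  imports "HOL-Analysis.Analysis" "HOL-Library.Landau_Symbols"
begin

section \<open>Sobolev spaces on open subsets of the plane\<close>

definition pdx :: "(real \<times> real \<Rightarrow> real) \<Rightarrow> real \<times> real \<Rightarrow> real" where
  "pdx \<phi> = (\<lambda>(x, y). deriv (\<lambda>t. \<phi> (t, y)) x)"

definition pdy :: "(real \<times> real \<Rightarrow> real) \<Rightarrow> real \<times> real \<Rightarrow> real" where
  "pdy \<phi> = (\<lambda>(x, y). deriv (\<lambda>t. \<phi> (x, t)) y)"

definition partial :: "nat \<Rightarrow> nat \<Rightarrow> (real \<times> real \<Rightarrow> real) \<Rightarrow> real \<times> real \<Rightarrow> real" where
  "partial i j \<phi> = (pdx ^^ i) ((pdy ^^ j) \<phi>)"

primrec Ck :: "nat \<Rightarrow> (real \<times> real \<Rightarrow> real) \<Rightarrow> bool" where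
  "Ck 0 \<phi> \<longleftrightarrow> continuous_on UNIV \<phi>"
| "Ck (Suc k) \<phi> \<longleftrightarrow> (\<forall>p. \<phi> differentiable (at p)) \<and> Ck k (pdx \<phi>) \<and> Ck k (pdy \<phi>)"

definition test_function :: "(real \<times> real) set \<Rightarrow> (real \<times> real \<Rightarrow> real) \<Rightarrow> bool" where
  "test_function \<Omega> \<phi> \<longleftrightarrow>
     (\<forall>k. Ck k \<phi>) \<and> compact (closure {p. \<phi> p \<noteq> 0}) \<and> closure {p. \<phi> p \<noteq> 0} \<subseteq> \<Omega>"

text \<open>Elements of the function spaces below are functions on the whole plane of which only the
  restriction to \<open>\<Omega>\<close>, up to null sets, matters; they represent the usual equivalence classes.\<close>

definition L2_space :: "(real \<times> real) set \<Rightarrow> (real \<times> real \<Rightarrow> real) set" where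
  "L2_space \<Omega> = {g. set_borel_measurable lborel \<Omega> g \<and> set_integrable lborel \<Omega> (\<lambda>p. (g p)\<^sup>2)}"

definition has_weak_partial ::
    "(real \<times> real) set \<Rightarrow> nat \<Rightarrow> nat \<Rightarrow> (real \<times> real \<Rightarrow> real) \<Rightarrow> (real \<times> real \<Rightarrow> real) \<Rightarrow> bool" where
  "has_weak_partial \<Omega> i j w g \<longleftrightarrow>
     (\<forall>\<phi>. test_function \<Omega> \<phi> \<longrightarrow>
        (LINT p:\<Omega>|lborel. w p * partial i j \<phi> p) =
          (-1) ^ (i + j) * (LINT p:\<Omega>|lborel. g p * \<phi> p))"

definition sobolev_H :: "nat \<Rightarrow> (real \<times> real) set \<Rightarrow> (real \<times> real \<Rightarrow> real) set" where
  "sobolev_H k \<Omega> = {w \<in> L2_space \<Omega>.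
     \<forall>i j. i + j \<le> k \<longrightarrow> (\<exists>g \<in> L2_space \<Omega>. has_weak_partial \<Omega> i j w g)}"

text \<open>On an open \<open>\<Omega>\<close> the weak derivative is determined up to a null set, so integrals over
  \<open>\<Omega>\<close> do not depend on the choice made here.\<close>

definition weak_partial ::
    "(real \<times> real) set \<Rightarrow> nat \<Rightarrow> nat \<Rightarrow> (real \<times> real \<Rightarrow> real) \<Rightarrow> real \<times> real \<Rightarrow> real" where
  "weak_partial \<Omega> i j w = (SOME g. g \<in> L2_space \<Omega> \<and> has_weak_partial \<Omega> i j w g)"


section \<open>The partially hinged plate\<close>

definition plate :: "real \<Rightarrow> (real \<times> real) set" where
  "plate l = {0<..<pi} \<times> {-l<..<l}"

text \<open>Since \<open>\<Omega>\<close> is a planar rectangle, every class in \<open>H\<^sup>2(\<Omega>)\<close> has a representative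
  continuous on the closure of \<open>\<Omega>\<close>; the condition on the hinged sides is imposed pointwise on
  that representative.\<close>

definition H2_star :: "real \<Rightarrow> (real \<times> real \<Rightarrow> real) set" where
  "H2_star l = {w \<in> sobolev_H 2 (plate l).
     \<exists>w'. continuous_on (closure (plate l)) w' \<and>
          (AE p in lborel. p \<in> plate l \<longrightarrow> w p = w' p) \<and>
          (\<forall>x \<in> {0, pi}. \<forall>y \<in> {-l<..<l}. w' (x, y) = 0)}"

definition plate_inner ::
    "real \<Rightarrow> real \<Rightarrow> (real \<times> real \<Rightarrow> real) \<Rightarrow> (real \<times> real \<Rightarrow> real) \<Rightarrow> real" where
  "plate_inner l \<sigma> u v =
     (let \<Omega> = plate l;
          uxx = weak_partial \<Omega> 2 0 u; uxy = weak_partial \<Omega> 1 1 u; uyy = weak_partial \<Omega> 0 2 u;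
          vxx = weak_partial \<Omega> 2 0 v; vxy = weak_partial \<Omega> 1 1 v; vyy = weak_partial \<Omega> 0 2 v
      in LINT p:\<Omega>|lborel.
           (uxx p + uyy p) * (vxx p + vyy p)
           + (1 - \<sigma>) * (2 * uxy p * vxy p - uxx p * vyy p - uyy p * vxx p))"

text \<open>The continuity requirement selects the representative of the solution whose values on the
  free edges are meaningful.\<close>

definition plate_solution ::
    "real \<Rightarrow> real \<Rightarrow> (real \<times> real \<Rightarrow> real) \<Rightarrow> (real \<times> real \<Rightarrow> real) \<Rightarrow> bool" where
  "plate_solution l \<sigma> f u \<longleftrightarrow>
     u \<in> H2_star l \<and> continuous_on (closure (plate l)) u \<and>
     (\<forall>v \<in> H2_star l. plate_inner l \<sigma> u v = (LINT p:plate l|lborel. f p * v p))"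

definition exp_load :: "real \<Rightarrow> real \<Rightarrow> real \<times> real \<Rightarrow> real" where
  "exp_load l \<alpha> = (\<lambda>(x, y). \<alpha> * exp (\<alpha> * y) * sin x / (4 * sinh (\<alpha> * l)))"

definition gap :: "real \<Rightarrow> (real \<times> real \<Rightarrow> real) \<Rightarrow> real \<Rightarrow> real" where
  "gap l u x = u (x, l) - u (x, -l)"

text \<open>\<^const>\<open>Max\<close> is only meaningful for finite sets, so the maximum is taken as a greatest
  element.\<close>

definition max_gap :: "real \<Rightarrow> (real \<times> real \<Rightarrow> real) \<Rightarrow> real" where
  "max_gap l u = (GREATEST m. m \<in> (\<lambda>x. \<bar>gap l u x\<bar>) ` {0..pi})"


section \<open>The constants\<close>

definition coeff_B :: "real \<Rightarrow> real \<Rightarrow> real \<Rightarrow> real" where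
  "coeff_B l \<sigma> \<alpha> =
     ((1 + \<sigma>) * (\<sigma> - \<alpha>\<^sup>2) * cosh l * sinh (\<alpha> * l)
      + (1 - \<sigma>) * (\<alpha>\<^sup>2 - \<sigma>) * l * sinh l * sinh (\<alpha> * l)
      + 2 * \<alpha> * (\<alpha>\<^sup>2 + \<sigma> - 2) * sinh l * cosh (\<alpha> * l)
      + (1 - \<sigma>) * \<alpha> * (\<alpha>\<^sup>2 + \<sigma> - 2) * l * cosh l * cosh (\<alpha> * l))
     / ((1 - \<sigma>) * (\<alpha>\<^sup>2 - 1)\<^sup>2 * ((3 + \<sigma>) * cosh l * sinh l + (1 - \<sigma>) * l))"

definition coeff_C :: "real \<Rightarrow> real \<Rightarrow> real \<Rightarrow> real" where
  "coeff_C l \<sigma> \<alpha> =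
     (\<alpha> * (2 - \<sigma> - \<alpha>\<^sup>2) * sinh l * cosh (\<alpha> * l) + (\<sigma> - \<alpha>\<^sup>2) * cosh l * sinh (\<alpha> * l))
     / ((\<alpha>\<^sup>2 - 1)\<^sup>2 * ((3 + \<sigma>) * cosh l * sinh l + (1 - \<sigma>) * l))"

definition E_gap :: "real \<Rightarrow> real \<Rightarrow> real \<Rightarrow> real" where
  "E_gap l \<sigma> \<alpha> =
     \<alpha> / (2 * (1 - \<alpha>\<^sup>2)\<^sup>2)
     + \<alpha> * coeff_B l \<sigma> \<alpha> * sinh l / (2 * sinh (\<alpha> * l))
     + \<alpha> * coeff_C l \<sigma> \<alpha> * l * cosh l / (2 * sinh (\<alpha> * l))"

definition E_limit :: "real \<Rightarrow> real \<Rightarrow> real" where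
  "E_limit l \<sigma> = (sinh l)\<^sup>2 / ((1 - \<sigma>) * ((1 - \<sigma>) * l + (3 + \<sigma>) * sinh l * cosh l))"

definition edge_system :: "real \<Rightarrow> real \<Rightarrow> real \<Rightarrow> real \<Rightarrow> real \<Rightarrow> bool" where
  "edge_system l \<sigma> \<alpha> B C \<longleftrightarrow>
     (1 - \<sigma>) * sinh l * B + (2 * sinh l + (1 - \<sigma>) * l * cosh l) * C
       = (\<sigma> - \<alpha>\<^sup>2) / (1 - \<alpha>\<^sup>2)\<^sup>2 * sinh (\<alpha> * l) \<and>
     (\<sigma> - 1) * cosh l * B + ((1 + \<sigma>) * cosh l + (\<sigma> - 1) * l * sinh l) * C
       = \<alpha> * (((2 - \<sigma>) - \<alpha>\<^sup>2) / (1 - \<alpha>\<^sup>2)\<^sup>2) * cosh (\<alpha> * l)"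

text \<open>The closed forms above are exactly the solution of the linear system expressing the free-edge
  boundary conditions.\<close>

lemma linear_2x2_iff:
  fixes a b c d :: real
  assumes "a * d - b * c \<noteq> 0"
  shows "a * B + b * C = p \<and> c * B + d * C = q \<longleftrightarrow>
         B = (p * d - b * q) / (a * d - b * c) \<and> C = (a * q - c * p) / (a * d - b * c)"
proof
  assume h: "a * B + b * C = p \<and> c * B + d * C = q"
  then have p: "p = a * B + b * C" and q: "q = c * B + d * C" by auto
  have "B * (a * d - b * c) = p * d - b * q" "C * (a * d - b * c) = a * q - c * p"
    unfolding p q by (simp_all add: algebra_simps)
  then show "B = (p * d - b * q) / (a * d - b * c) \<and> C = (a * q - c * p) / (a * d - b * c)"
    using assms by (simp add: eq_divide_eq)
next
  assume h: "B = (p * d - b * q) / (a * d - b * c) \<and> C = (a * q - c * p) / (a * d - b * c)"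
  have "a * B + b * C = (a * (p * d - b * q) + b * (a * q - c * p)) / (a * d - b * c)"
       "c * B + d * C = (c * (p * d - b * q) + d * (a * q - c * p)) / (a * d - b * c)"
    using h by (simp_all add: add_divide_distrib)
  moreover have "a * (p * d - b * q) + b * (a * q - c * p) = p * (a * d - b * c)"
       "c * (p * d - b * q) + d * (a * q - c * p) = q * (a * d - b * c)"
    by (simp_all add: algebra_simps)
  ultimately show "a * B + b * C = p \<and> c * B + d * C = q"
    using assms by simp
qed

lemma edge_system_iff:
  fixes l \<sigma> \<alpha> :: real
  assumes l: "l > 0" and \<sigma>: "0 < \<sigma>" "\<sigma> < 1" and \<alpha>: "\<alpha> > 0" "\<alpha> \<noteq> 1"
  shows "edge_system l \<sigma> \<alpha> B C \<longleftrightarrow> B = coeff_B l \<sigma> \<alpha> \<and> C = coeff_C l \<sigma> \<alpha>"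
proof -
  define S K where "S = sinh l" and "K = cosh l"
  define s k where "s = sinh (\<alpha> * l)" and "k = cosh (\<alpha> * l)"
  define D where "D = (3 + \<sigma>) * K * S + (1 - \<sigma>) * l"
  define N where "N = (\<alpha>\<^sup>2 - 1)\<^sup>2"
  have pos: "S > 0" "K > 0" using l by (auto simp: S_def K_def)
  have D: "D > 0" unfolding D_def using pos l \<sigma> by (intro add_pos_pos mult_pos_pos) auto
  have "\<alpha>\<^sup>2 \<noteq> 1" using \<alpha> by (auto simp: power2_eq_1_iff)
  then have N: "N \<noteq> 0" by (simp add: N_def)
  have N': "(1 - \<alpha>\<^sup>2)\<^sup>2 = N" unfolding N_def by (simp add: power2_commute)
  have KS: "K\<^sup>2 = S\<^sup>2 + 1" unfolding K_def S_def by (simp add: cosh_square_eq)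
  let ?a = "(1 - \<sigma>) * S" and ?b = "2 * S + (1 - \<sigma>) * l * K"
  let ?c = "(\<sigma> - 1) * K" and ?d = "(1 + \<sigma>) * K + (\<sigma> - 1) * l * S"
  let ?p = "(\<sigma> - \<alpha>\<^sup>2) / N * s" and ?q = "\<alpha> * (((2 - \<sigma>) - \<alpha>\<^sup>2) / N) * k"
  have det: "?a * ?d - ?b * ?c = (1 - \<sigma>) * D"
  proof -
    have "?a * ?d - ?b * ?c = (1 - \<sigma>) * ((3 + \<sigma>) * K * S + (1 - \<sigma>) * l * (K\<^sup>2 - S\<^sup>2))"
      by (simp add: algebra_simps power2_eq_square)
    then show ?thesis by (simp add: KS D_def)
  qed
  have "(1 - \<sigma>) * D \<noteq> 0" using D \<sigma> by simp
  then have "edge_system l \<sigma> \<alpha> B C \<longleftrightarrow>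
      B = (?p * ?d - ?b * ?q) / ((1 - \<sigma>) * D) \<and> C = (?a * ?q - ?c * ?p) / ((1 - \<sigma>) * D)"
    unfolding edge_system_def N' S_def[symmetric] K_def[symmetric] s_def[symmetric] k_def[symmetric]
      det[symmetric] by (intro linear_2x2_iff)
  moreover have "(?p * ?d - ?b * ?q) / ((1 - \<sigma>) * D) = coeff_B l \<sigma> \<alpha>"
  proof -
    have "?p * ?d - ?b * ?q =
        ((1 + \<sigma>) * (\<sigma> - \<alpha>\<^sup>2) * K * s + (1 - \<sigma>) * (\<alpha>\<^sup>2 - \<sigma>) * l * S * s
         + 2 * \<alpha> * (\<alpha>\<^sup>2 + \<sigma> - 2) * S * k + (1 - \<sigma>) * \<alpha> * (\<alpha>\<^sup>2 + \<sigma> - 2) * l * K * k) / N"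
      using N by (simp add: field_simps)
    then show ?thesis
      unfolding coeff_B_def N_def[symmetric] S_def[symmetric] K_def[symmetric] s_def[symmetric]
        k_def[symmetric] D_def[symmetric] by (simp add: mult_ac)
  qed
  moreover have "(?a * ?q - ?c * ?p) / ((1 - \<sigma>) * D) = coeff_C l \<sigma> \<alpha>"
  proof -
    have "?a * ?q - ?c * ?p =
        (1 - \<sigma>) * ((\<alpha> * (2 - \<sigma> - \<alpha>\<^sup>2) * S * k + (\<sigma> - \<alpha>\<^sup>2) * K * s) / N)"
      using N by (simp add: field_simps)
    then show ?thesis
      unfolding coeff_C_def N_def[symmetric] S_def[symmetric] K_def[symmetric] s_def[symmetric]
        k_def[symmetric] D_def[symmetric] using \<sigma> by (simp add: mult_ac)
  qed
  ultimately show ?thesis by simp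
qed

end

theory Submission
  imports Defs "HOL-Real_Asymp.Real_Asymp"
begin

text \<open>The load is \<open>f(y) sin x\<close>, so the solution is \<open>U = \<phi>(y) sin x\<close>, where \<open>\<phi>\<close> solves
  \<open>(d\<^sup>2 - 1)\<^sup>2 \<phi> = f\<close> with the free-edge conditions at \<open>\<plusminus>l\<close>; the odd part of \<open>\<phi>\<close> is governed by the
  system for \<open>B\<close> and \<open>C\<close> and yields \<open>E\<close>. To integrate by parts against a merely weakly
  differentiable \<open>v\<close>, the smooth factors are cut off near the edges; the boundary terms arise as
  limits of integrals over the shrinking layers, since \<open>v\<close> is continuous up to the boundary.
  Coercivity of the energy gives equal second derivatives \<open>u\<^sub>x\<^sub>x\<close> for two solutions, and with the
  hinged condition this forces them to agree. Finally \<open>E \<ge> 0\<close> follows by pairing \<open>\<phi>\<close> with the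
  nonnegative response to a load concentrated on the free edges.\<close>

section \<open>Smooth functions of one variable\<close>

text \<open>The obstacle is the lack of traces. A member \<open>v\<close> of the energy space has a
  continuous representative, but its first derivatives are only square integrable and have no
  boundary values. Every boundary term must therefore involve \<open>v\<close> alone. On the hinged
  sides \<open>v\<close> vanishes, and sin removes the normal derivative that the xx term would
  produce. On the free edges the energy density is regrouped by the second derivatives of
  \<open>v\<close>: the factor of v_yy is sin x times \<phi>'' - \<sigma> \<phi>, which the first
  edge condition makes zero there, and the second edge condition cancels the terms in
  \<open>v\<close> left over from v_xy and v_yy. A solution is exhibited explicitly, and
  \<open>u\<close> is identified with it by uniqueness. There the hinged condition acts through the
  products X(x) Y(y) with X'' = x^k and X(0) = X(pi) = 0: against them all moments of the difference
  of two solutions vanish. The sign of E enters because the maximum of |E sin x| is |E|.\<close>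

primrec Cn :: "nat \<Rightarrow> (real \<Rightarrow> real) \<Rightarrow> bool" where
  "Cn 0 f \<longleftrightarrow> continuous_on UNIV f"
| "Cn (Suc k) f \<longleftrightarrow> (\<forall>x. f differentiable (at x)) \<and> Cn k (deriv f)"

text \<open>\<open>Cn\<close> copies the recursion of \<open>Ck\<close> in one variable:
  \<open>pdx\<close> and \<open>pdy\<close> of a product X(x) Y(y) differentiate one factor each, so
  smoothness of the factors yields every \<open>Ck\<close> of the product.\<close>

definition smooth :: "(real \<Rightarrow> real) \<Rightarrow> bool" where
  "smooth f \<longleftrightarrow> (\<forall>k. Cn k f)"

lemma Cn_SucI:
  assumes "\<And>x. (f has_real_derivative f' x) (at x)" "Cn k f'"
  shows "Cn (Suc k) f"
proof -
  have "deriv f = f'" using assms(1) by (auto intro!: ext DERIV_imp_deriv)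
  then show ?thesis using assms by (auto intro: differentiableI simp: has_field_derivative_def)
qed

lemma Cn_Suc_DERIV: "Cn (Suc k) f \<Longrightarrow> (f has_real_derivative deriv f x) (at x)"
  by (simp add: DERIV_deriv_iff_real_differentiable)

lemma Cn_SucD: "Cn (Suc k) f \<Longrightarrow> Cn k f"
proof (induction k arbitrary: f)
  case 0
  then show ?case
    by (auto simp: continuous_on_eq_continuous_at intro: differentiable_imp_continuous_within)
next
  case (Suc k)
  then show ?case by (metis Cn.simps(2))
qed

lemma Cn_const: "Cn k (\<lambda>_. c)"
  by (induction k arbitrary: c) (auto intro!: Cn_SucI[where f'="\<lambda>_. 0"] simp del: Cn.simps(2))

lemma Cn_add: "Cn k f \<Longrightarrow> Cn k g \<Longrightarrow> Cn k (\<lambda>x. f x + g x)"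
proof (induction k arbitrary: f g)
  case 0
  then show ?case by (auto intro: continuous_intros)
next
  case (Suc k)
  have d: "(f has_real_derivative deriv f x) (at x)" "(g has_real_derivative deriv g x) (at x)" for x
    using Suc.prems Cn_Suc_DERIV by blast+
  have "Cn k (\<lambda>x. deriv f x + deriv g x)"
    using Suc by auto
  then show ?case
    by (rule Cn_SucI[rotated]) (auto intro!: derivative_eq_intros d)
qed

lemma Cn_mult: "Cn k f \<Longrightarrow> Cn k g \<Longrightarrow> Cn k (\<lambda>x. f x * g x)"
proof (induction k arbitrary: f g)
  case 0
  then show ?case by (auto intro: continuous_intros)
next
  case (Suc k)
  have d: "(f has_real_derivative deriv f x) (at x)" "(g has_real_derivative deriv g x) (at x)" for x
    using Suc.prems Cn_Suc_DERIV by blast+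
  have "Cn k f" "Cn k g" "Cn k (deriv f)" "Cn k (deriv g)"
    using Suc.prems Cn_SucD by (blast, blast, auto)
  then have "Cn k (\<lambda>x. deriv f x * g x + f x * deriv g x)"
    by (intro Cn_add Suc.IH)
  then show ?case
    by (rule Cn_SucI[rotated]) (auto intro!: derivative_eq_intros d)
qed

lemma Cn_inverse: "Cn k f \<Longrightarrow> (\<And>x. f x \<noteq> 0) \<Longrightarrow> Cn k (\<lambda>x. inverse (f x))"
proof (induction k arbitrary: f)
  case 0
  then show ?case by (auto intro: continuous_intros)
next
  case (Suc k)
  have d: "(f has_real_derivative deriv f x) (at x)" for x
    using Suc.prems Cn_Suc_DERIV by blast+
  have i: "Cn k (\<lambda>x. inverse (f x))" "Cn k (deriv f)" using Suc Cn_SucD by (blast, auto)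
  have "Cn k (\<lambda>x. (-1) * (inverse (f x) * (deriv f x * inverse (f x))))"
    by (intro Cn_mult Cn_const i)
  then show ?case
    by (rule Cn_SucI[rotated]) (use Suc.prems in \<open>auto intro!: derivative_eq_intros d\<close>)
qed

lemma Cn_affine: "Cn k f \<Longrightarrow> Cn k (\<lambda>x. f (a * x + b))"
proof (induction k arbitrary: f)
  case 0
  then show ?case by (auto intro!: continuous_on_compose2[of UNIV f] continuous_intros)
next
  case (Suc k)
  have d: "((\<lambda>x. f (a * x + b)) has_real_derivative a * deriv f (a * x + b)) (at x)" for x
    by (rule DERIV_cong[OF DERIV_chain2[OF Cn_Suc_DERIV[OF Suc.prems], of "\<lambda>x. a * x + b" a x UNIV]])
      (auto intro!: derivative_eq_intros)
  have "Cn k (\<lambda>x. a * deriv f (a * x + b))"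
    using Suc by (intro Cn_mult Cn_const) auto
  then show ?case
    by (rule Cn_SucI[rotated]) (rule d)
qed

lemma smooth_DERIV: "smooth f \<Longrightarrow> (f has_real_derivative deriv f x) (at x)"
  unfolding smooth_def using Cn_Suc_DERIV by blast

lemma smooth_deriv: "smooth f \<Longrightarrow> smooth (deriv f)"
  unfolding smooth_def by (metis Cn.simps(2))

lemma smooth_continuous_on: "smooth f \<Longrightarrow> continuous_on A f"
  unfolding smooth_def by (metis Cn.simps(1) continuous_on_subset subset_UNIV)

lemma smooth_const: "smooth (\<lambda>_. c)"
  and smooth_add: "smooth f \<Longrightarrow> smooth g \<Longrightarrow> smooth (\<lambda>x. f x + g x)"
  and smooth_mult: "smooth f \<Longrightarrow> smooth g \<Longrightarrow> smooth (\<lambda>x. f x * g x)"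
  and smooth_affine: "smooth f \<Longrightarrow> smooth (\<lambda>x. f (a * x + b))"
  by (simp_all add: smooth_def Cn_const Cn_add Cn_mult Cn_affine)

lemma smooth_minus: "smooth f \<Longrightarrow> smooth (\<lambda>x. - f x)"
  using smooth_mult[OF smooth_const[of "-1"]] by fastforce

lemma smooth_diff: "smooth f \<Longrightarrow> smooth g \<Longrightarrow> smooth (\<lambda>x. f x - g x)"
  using smooth_add[of f "\<lambda>x. - g x"] smooth_minus by fastforce

lemma smooth_divide:
  "smooth f \<Longrightarrow> smooth g \<Longrightarrow> (\<And>x. g x \<noteq> 0) \<Longrightarrow> smooth (\<lambda>x. f x / g x)"
  by (simp add: smooth_def Cn_mult Cn_inverse divide_inverse)

text \<open>Serves exp, sinh, cosh, sin and cos, each of which lies in a set of functions closed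
  under differentiation, so that no formula for the k-th derivative has to be carried along.\<close>

lemma smooth_coinduct:
  assumes "P f" "\<And>f. P f \<Longrightarrow> \<exists>f'. (\<forall>x. (f has_real_derivative f' x) (at x)) \<and> P f'"
  shows "smooth f"
proof -
  have "P f \<Longrightarrow> Cn k f" for k
  proof (induction k arbitrary: f)
    case 0
    then obtain f' where "\<And>x. (f has_real_derivative f' x) (at x)" using assms(2) by blast
    then show ?case by (auto simp: continuous_on_eq_continuous_at intro: DERIV_isCont)
  next
    case (Suc k)
    then obtain f' where "\<And>x. (f has_real_derivative f' x) (at x)" "P f'" using assms(2) by blast
    then show ?case using Suc.IH Cn_SucI by blast
  qed
  then show ?thesis using assms(1) by (simp add: smooth_def)
qed

lemma smooth_ident: "smooth (\<lambda>x. x)"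
  unfolding smooth_def
proof
  show "Cn k (\<lambda>x. x)" for k
    by (cases k) (auto intro!: Cn_SucI[where f'="\<lambda>_. 1"] Cn_const derivative_eq_intros simp del: Cn.simps(2))
qed

lemma smooth_power: "smooth f \<Longrightarrow> smooth (\<lambda>x. f x ^ n)"
  by (induction n) (auto intro: smooth_const smooth_mult)

lemma smooth_exp: "smooth (\<lambda>x. exp (a * x))"
proof (rule smooth_coinduct[where P="\<lambda>f. \<exists>c. f = (\<lambda>x. c * exp (a * x))"])
  fix f assume "\<exists>c. f = (\<lambda>x. c * exp (a * x))"
  then obtain c where "f = (\<lambda>x. c * exp (a * x))" by blast
  then show "\<exists>f'. (\<forall>x. (f has_real_derivative f' x) (at x)) \<and> (\<exists>c. f' = (\<lambda>x. c * exp (a * x)))"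
    by (intro exI[of _ "\<lambda>x. (c * a) * exp (a * x)"]) (auto intro!: derivative_eq_intros)
qed (auto intro: exI[of _ 1])

lemma smooth_sinh_cosh: "smooth (sinh :: real \<Rightarrow> real)" "smooth (cosh :: real \<Rightarrow> real)"
proof -
  have "\<exists>f'. (\<forall>x. (f has_real_derivative f' x) (at x)) \<and> f' \<in> {sinh, cosh}"
    if "f \<in> {sinh, cosh}" for f :: "real \<Rightarrow> real"
    using that by (auto intro!: derivative_eq_intros)
  then show "smooth (sinh :: real \<Rightarrow> real)" "smooth (cosh :: real \<Rightarrow> real)"
    using smooth_coinduct[of "\<lambda>f. f \<in> {sinh, cosh}"] by blast+
qed

lemma smooth_sin_cos: "smooth (sin :: real \<Rightarrow> real)" "smooth (cos :: real \<Rightarrow> real)"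
proof -
  let ?S = "{sin, cos, \<lambda>x. - sin x, \<lambda>x. - cos x} :: (real \<Rightarrow> real) set"
  have "\<exists>f'. (\<forall>x. (f has_real_derivative f' x) (at x)) \<and> f' \<in> ?S" if "f \<in> ?S" for f
  proof -
    have "(sin has_real_derivative cos x) (at x)" "(cos has_real_derivative - sin x) (at x)"
      "((\<lambda>x. - sin x) has_real_derivative - cos x) (at x)"
      "((\<lambda>x. - cos x) has_real_derivative sin x) (at x)" for x :: real
      by (auto intro!: derivative_eq_intros)
    then show ?thesis using that
      by (smt (verit) insert_iff singletonD)
  qed
  then show "smooth (sin :: real \<Rightarrow> real)" "smooth (cos :: real \<Rightarrow> real)"
    using smooth_coinduct[of "\<lambda>f. f \<in> ?S"] by blast+
qed

section \<open>A smooth transition function built from exp(-1/t)\<close>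

definition flat :: "nat \<Rightarrow> real \<Rightarrow> real" where
  "flat k t = (if t > 0 then (1 / t) ^ k * exp (- 1 / t) else 0)"

lemma flat_tendsto_0: "((\<lambda>t. flat k t) \<longlongrightarrow> 0) (at 0)"
proof -
  have "((\<lambda>t::real. inverse t ^ k / exp (inverse t)) \<longlongrightarrow> 0) (at_right 0)"
    using tendsto_power_div_exp_0[of k] unfolding filterlim_at_right_to_top by simp
  then have "((\<lambda>t. flat k t) \<longlongrightarrow> 0) (at_right 0)"
    by (rule Lim_transform_eventually)
      (auto simp: flat_def eventually_at_right_less exp_minus field_simps
        intro!: eventually_mono[OF eventually_at_right_less])
  moreover have "((\<lambda>t. flat k t) \<longlongrightarrow> 0) (at_left 0)"
    by (rule Lim_transform_eventually[OF tendsto_const])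
      (auto simp: flat_def eventually_at intro!: exI[of _ 1])
  ultimately show ?thesis by (simp add: filterlim_split_at)
qed

text \<open>The reason for the prefactor (1/t)^k: with it the family \<open>flat\<close> is closed
  under differentiation up to linear combinations, and smoothness follows by induction on the
  order.\<close>

lemma flat_DERIV:
  "(flat k has_real_derivative flat (k + 2) t - real k * flat (Suc k) t) (at t)"
proof -
  consider "t > 0" | "t < 0" | "t = 0" by linarith
  then show ?thesis
  proof cases
    case 1
    have "((\<lambda>t. (1 / t) ^ k * exp (- 1 / t)) has_real_derivative flat (k + 2) t - real k * flat (Suc k) t) (at t)"
    \<comment> \<open>The case k = 0 stands apart because the power rule produces the exponent k -
      1.\<close>
    proof (cases k)
      case 0
      then show ?thesis using 1
        by (auto intro!: derivative_eq_intros simp: flat_def field_simps power2_eq_square)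
    next
      case (Suc m)
      have "((\<lambda>t. (1 / t) ^ Suc m * exp (- 1 / t)) has_real_derivative
          (real (Suc m) * (1 / t) ^ m * (- (1 / t\<^sup>2))) * exp (- 1 / t)
          + (1 / t) ^ Suc m * (exp (- 1 / t) * (1 / t\<^sup>2))) (at t)"
        using 1 by (auto intro!: derivative_eq_intros simp: power2_eq_square simp del: power_Suc)
      also have "(real (Suc m) * (1 / t) ^ m * (- (1 / t\<^sup>2))) * exp (- 1 / t)
          + (1 / t) ^ Suc m * (exp (- 1 / t) * (1 / t\<^sup>2))
          = flat (k + 2) t - real k * flat (Suc k) t"
        using 1 by (simp add: flat_def Suc field_simps power2_eq_square)
      finally show ?thesis by (simp add: Suc)
    qed
    then show ?thesis
      by (rule DERIV_cong_ev[OF refl _ refl, THEN iffD1, rotated])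
        (use 1 in \<open>auto simp: flat_def intro!: eventually_mono[OF eventually_nhds_in_open[of "{0<..}"]]\<close>)
  next
    case 2
    have "((\<lambda>t. 0) has_real_derivative flat (k + 2) t - real k * flat (Suc k) t) (at t)"
      using 2 by (auto simp: flat_def)
    then show ?thesis
      by (rule DERIV_cong_ev[OF refl _ refl, THEN iffD1, rotated])
        (use 2 in \<open>auto simp: flat_def intro!: eventually_mono[OF eventually_nhds_in_open[of "{..<0}"]]\<close>)
  next
    case 3
    \<comment> \<open>At 0 the difference quotient of \<open>flat k\<close> is exactly
      \<open>flat (Suc k)\<close>, which tends to 0.\<close>
    have "((\<lambda>h. (flat k (0 + h) - flat k 0) / h) \<longlongrightarrow> 0) (at 0)"
      by (rule Lim_transform_eventually[OF flat_tendsto_0[of "Suc k"]])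
        (auto simp: flat_def)
    then show ?thesis using 3 by (simp add: DERIV_def flat_def)
  qed
qed

lemma smooth_flat: "smooth (flat k)"
proof -
  have "Cn n (flat k)" for n k
  proof (induction n arbitrary: k)
    case 0
    then show ?case
      by (auto simp: continuous_on_eq_continuous_at intro: DERIV_isCont flat_DERIV)
  next
    case (Suc n)
    have "Cn n (\<lambda>t. flat (k + 2) t + (- real k) * flat (Suc k) t)"
      by (intro Cn_add Cn_mult Cn_const Suc)
    then show ?case by (intro Cn_SucI[OF flat_DERIV]) simp
  qed
  then show ?thesis by (simp add: smooth_def)
qed

text \<open>The rise takes place on [1, 2], away from 0. After rescaling by n the cut-off vanishes
  on a whole neighbourhood of the endpoint, which is what compact support in the open interval
  demands.\<close>

definition step :: "real \<Rightarrow> real" where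
  "step t = flat 0 (t - 1) / (flat 0 (t - 1) + flat 0 (2 - t))"

lemma flat_nonneg: "flat k t \<ge> 0"
  by (simp add: flat_def)

lemma flat_sum_pos: "flat 0 (t - 1) + flat 0 (2 - t) > 0"
proof -
  have "flat 0 (t - 1) > 0 \<or> flat 0 (2 - t) > 0" by (auto simp: flat_def)
  then show ?thesis using flat_nonneg[of 0 "t - 1"] flat_nonneg[of 0 "2 - t"] by linarith
qed

lemma smooth_step: "smooth step"
proof -
  have "smooth (\<lambda>t. flat 0 (1 * t + (-1)))" "smooth (\<lambda>t. flat 0 ((-1) * t + 2))"
    by (intro smooth_affine smooth_flat)+
  then have "smooth (\<lambda>t. flat 0 (t - 1))" "smooth (\<lambda>t. flat 0 (2 - t))" by auto
  then show ?thesis unfolding step_def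
    using flat_sum_pos by (intro smooth_divide smooth_add) (auto simp: less_imp_neq less_imp_neq[symmetric])
qed

lemma step_eq_0: "t \<le> 1 \<Longrightarrow> step t = 0" and step_eq_1: "t \<ge> 2 \<Longrightarrow> step t = 1"
  using flat_sum_pos[of t] by (auto simp: step_def flat_def)

lemma step_bounds: "0 \<le> step t" "step t \<le> 1"
  using flat_sum_pos[of t] flat_nonneg[of 0 "t - 1"] flat_nonneg[of 0 "2 - t"]
  by (auto simp: step_def)

lemma deriv_eq_0_of_const_on_open:
  assumes "open S" "x \<in> S" "\<And>y. y \<in> S \<Longrightarrow> f y = c"
  shows "deriv f x = (0::real)"
proof -
  have "((\<lambda>_. c) has_real_derivative 0) (at x)" by simp
  then have "(f has_real_derivative 0) (at x)"
    by (rule has_field_derivative_transform_within_open[OF _ assms(1,2)]) (simp add: assms(3))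
  then show ?thesis by (rule DERIV_imp_deriv)
qed

text \<open>Needed for \<open>deriv step\<close> at the two points 1 and 2, which
  \<open>deriv_step_eq_0\<close> leaves out.\<close>

lemma closure_zero:
  fixes f :: "real \<Rightarrow> real"
  assumes "continuous_on UNIV f" "\<And>x. x \<in> S \<Longrightarrow> f x = 0" "x \<in> closure S"
  shows "f x = 0"
  using continuous_constant_on_closure[of S f 0 x] assms continuous_on_subset by blast

lemma deriv_step_eq_0: "t \<notin> {1..2} \<Longrightarrow> deriv step t = 0"
  using deriv_eq_0_of_const_on_open[of "{..<1}" t step 0] step_eq_0
    deriv_eq_0_of_const_on_open[of "{2<..}" t step 1] step_eq_1
  by force

lemma deriv2_step_eq_0: "t \<notin> {1..2} \<Longrightarrow> deriv (deriv step) t = 0"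
  by (intro deriv_eq_0_of_const_on_open[of "-{1..2}" _ "deriv step" 0] deriv_step_eq_0) auto

section \<open>Integration by parts up to the boundary\<close>

lemma continuous_on_compact_bound:
  fixes f :: "'a::topological_space \<Rightarrow> real"
  assumes "compact S" "continuous_on S f"
  obtains M where "0 \<le> M" "\<And>x. x \<in> S \<Longrightarrow> \<bar>f x\<bar> \<le> M"
proof -
  obtain M where "\<forall>x\<in>S. \<bar>f x\<bar> \<le> M"
    using compact_imp_bounded[OF compact_continuous_image[OF assms(2,1)]]
    by (auto simp: bounded_iff)
  then have "\<And>x. x \<in> S \<Longrightarrow> \<bar>f x\<bar> \<le> \<bar>M\<bar>" by fastforce
  then show ?thesis using that[of "\<bar>M\<bar>"] by simp
qed

lemma set_integrable_Ioo:
  fixes f :: "real \<Rightarrow> real"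
  assumes "continuous_on {a..b} f"
  shows "set_integrable lborel {a<..<b} f"
  by (rule set_integrable_subset[OF borel_integrable_atLeastAtMost'[OF assms]]) auto

lemma LINT_Ioo_eq_Icc:
  fixes f :: "real \<Rightarrow> real"
  shows "(LINT x:{a<..<b}|lborel. f x) = (LINT x:{a..b}|lborel. f x)"
  unfolding set_lebesgue_integral_def
  by (rule integral_discrete_difference[where X="{a, b}"]) (auto split: split_indicator)

lemma LINT_FTC:
  assumes "a \<le> b" "\<And>x. (F has_real_derivative f x) (at x)" "continuous_on {a..b} f"
  shows "(LINT x:{a<..<b}|lborel. f x) = F b - F a"
proof -
  have "integral\<^sup>L lborel (\<lambda>x. indicator {a..b} x *\<^sub>R f x) = F b - F a"
    by (rule integral_FTC_atLeastAtMost[OF assms(1) _ assms(3)])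
      (use assms(2) has_real_derivative_iff_has_vector_derivative has_vector_derivative_at_within in blast)
  then show ?thesis unfolding LINT_Ioo_eq_Icc unfolding set_lebesgue_integral_def .
qed

lemma set_integrable_mult_continuous:
  fixes f g :: "real \<Rightarrow> real"
  assumes "set_integrable lborel {a<..<b} f" "continuous_on {a..b} g"
  shows "set_integrable lborel {a<..<b} (\<lambda>x. f x * g x)"
proof -
  obtain M where M: "\<And>x. x \<in> {a..b} \<Longrightarrow> \<bar>g x\<bar> \<le> M"
    using continuous_on_compact_bound[OF compact_Icc assms(2)] by blast
  have m: "(\<lambda>x. indicator {a<..<b} x *\<^sub>R f x) \<in> borel_measurable lborel"
      "(\<lambda>x. indicator {a<..<b} x *\<^sub>R g x) \<in> borel_measurable lborel"
    using assms(1) set_integrable_Ioo[OF assms(2)] by (auto simp: set_integrable_def)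
  show ?thesis
  proof (rule set_integrable_bound)
    show "set_integrable lborel {a<..<b} (\<lambda>x. M * f x)" using assms(1) by simp
    have "(\<lambda>x. indicator {a<..<b} x *\<^sub>R (f x * g x)) =
        (\<lambda>x. (indicator {a<..<b} x *\<^sub>R f x) * (indicator {a<..<b} x *\<^sub>R g x))"
      by (auto split: split_indicator)
    then show "set_borel_measurable lborel {a<..<b} (\<lambda>x. f x * g x)"
      unfolding set_borel_measurable_def using borel_measurable_times[OF m] by simp
    show "AE x in lborel. x \<in> {a<..<b} \<longrightarrow> norm (f x * g x) \<le> norm (M * f x)"
    proof (rule AE_I2, rule impI)
      fix x assume "x \<in> {a<..<b}"
      then have "\<bar>g x\<bar> \<le> M" using M by auto
      then have "\<bar>g x\<bar> \<le> \<bar>M\<bar>" by simp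
      then show "norm (f x * g x) \<le> norm (M * f x)"
        using mult_right_mono[of "\<bar>g x\<bar>" "\<bar>M\<bar>" "\<bar>f x\<bar>"] by (simp add: abs_mult mult.commute)
    qed
  qed
qed

text \<open>In the boundary-layer lemmas \<open>p\<close> is an endpoint of the interval and \<open>e = \<plusminus>1\<close> the inward direction
  there.\<close>

lemma layer_limit:
  fixes W k :: "real \<Rightarrow> real"
  assumes ab: "a < b" and pe: "p = a \<and> e = 1 \<or> p = b \<and> e = -1"
    and W: "continuous_on {a..b} W" and k: "continuous_on UNIV k" "\<And>t. t \<notin> {1..2} \<Longrightarrow> k t = 0"
  shows "(\<lambda>n. LINT x:{a<..<b}|lborel. W x * (real (Suc n) * k (real (Suc n) * (e * (x - p)))))
    \<longlonglongrightarrow> W p * (LINT t:{1<..<2}|lborel. k t)"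
proof -
  \<comment> \<open>Extension by zero turns the integrals over (a, b) into integrals over the line,
    where the substitution x = p + e s / Suc n applies and moves all dependence on n into the
    argument of \<open>W0\<close>.\<close>
  define W0 where "W0 = (\<lambda>x. indicator {a<..<b} x *\<^sub>R W x)"
  have [measurable]: "W0 \<in> borel_measurable borel"
    using set_integrable_Ioo[OF W] by (auto simp: set_integrable_def W0_def)
  have [measurable]: "k \<in> borel_measurable borel"
    using k(1) by (rule borel_measurable_continuous_onI)
  have e: "e * e = 1" "\<bar>e\<bar> = 1" "e \<noteq> 0" using pe by auto
  have kk: "(\<lambda>t. indicator {1..2} t *\<^sub>R k t) = k"
    using k(2) by (auto split: split_indicator)
  have kint: "integrable lborel k"
    using borel_integrable_atLeastAtMost'[OF continuous_on_subset[OF k(1)], of 1 2]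
    unfolding set_integrable_def kk by simp
  have kI: "(LINT t:{1<..<2}|lborel. k t) = integral\<^sup>L lborel k"
    unfolding LINT_Ioo_eq_Icc unfolding set_lebesgue_integral_def kk ..
  obtain M0 where "\<And>x. x \<in> {a..b} \<Longrightarrow> \<bar>W x\<bar> \<le> M0"
    using continuous_on_compact_bound[OF compact_Icc W] by blast
  then have "\<bar>W x\<bar> \<le> \<bar>M0\<bar>" if "x \<in> {a<..<b}" for x
    using that by (meson abs_ge_self greaterThanLessThan_subseteq_atLeastAtMost_iff order_refl order_trans subsetD)
  then have M: "\<bar>W0 x\<bar> \<le> \<bar>M0\<bar>" for x
    unfolding W0_def by (simp split: split_indicator)
  have eq: "(LINT x:{a<..<b}|lborel. W x * (real (Suc n) * k (real (Suc n) * (e * (x - p)))))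
    = (LINT s|lborel. W0 (p + e / real (Suc n) * s) * k s)" for n
  proof -
    let ?N = "real (Suc n)"
    have "(LINT x:{a<..<b}|lborel. W x * (?N * k (?N * (e * (x - p)))))
      = (LINT x|lborel. W0 x * (?N * k (?N * (e * (x - p)))))"
      unfolding set_lebesgue_integral_def W0_def by (simp add: mult.assoc)
    also have "\<dots> = \<bar>e / ?N\<bar> *\<^sub>R (LINT s|lborel. W0 (p + e / ?N * s) *
        (?N * k (?N * (e * ((p + e / ?N * s) - p)))))"
      by (rule lborel_integral_real_affine) (use e in auto)
    also have "\<dots> = (1 / ?N) * (LINT s|lborel. ?N * (W0 (p + e / ?N * s) * k s))"
    proof -
      have "?N * (e * ((p + e / ?N * s) - p)) = s" for s
        using e by (simp add: field_simps) (metis distrib_left mult.assoc mult_1 mult.commute)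
      then show ?thesis using e by (simp add: mult_ac)
    qed
    also have "\<dots> = (LINT s|lborel. W0 (p + e / ?N * s) * k s)" by simp
    finally show ?thesis .
  qed
  have "(\<lambda>n. LINT s|lborel. W0 (p + e / real (Suc n) * s) * k s) \<longlonglongrightarrow> (LINT s|lborel. W p * k s)"
  proof (rule integral_dominated_convergence[where w="\<lambda>s. \<bar>M0\<bar> * \<bar>k s\<bar>"])
    show "integrable lborel (\<lambda>s. \<bar>M0\<bar> * \<bar>k s\<bar>)" using kint by simp
    show "AE s in lborel. norm (W0 (p + e / real (Suc n) * s) * k s) \<le> \<bar>M0\<bar> * \<bar>k s\<bar>" for n
      by (intro AE_I2) (simp add: abs_mult M mult_right_mono)
    show "AE s in lborel. (\<lambda>n. W0 (p + e / real (Suc n) * s) * k s) \<longlonglongrightarrow> W p * k s"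
    proof (rule AE_I2)
      fix s :: real
      show "(\<lambda>n. W0 (p + e / real (Suc n) * s) * k s) \<longlonglongrightarrow> W p * k s"
      \<comment> \<open>Off [1, 2] the factor \<open>k s\<close> is zero. On it s is positive, so p
        + e s / Suc n lies on the inner side of p and, for large n, inside (a, b), where
        \<open>W0\<close> is \<open>W\<close>.\<close>
      proof (cases "s \<in> {1..2}")
        case False
        then show ?thesis by (simp add: k(2))
      next
        case True
        have l: "(\<lambda>n. p + e / real (Suc n) * s) \<longlonglongrightarrow> p"
        proof -
          have "(\<lambda>n. p + (e * s) * (1 / real (Suc n))) \<longlonglongrightarrow> p + (e * s) * 0"
            by (intro tendsto_intros LIMSEQ_Suc[OF lim_const_over_n])
          then show ?thesis by simp
        qed
        have "\<forall>\<^sub>F n in sequentially. p + e / real (Suc n) * s \<in> {a<..<b}"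
        proof -
          from l have "\<forall>\<^sub>F n in sequentially. dist (p + e / real (Suc n) * s) p < b - a"
            using ab by (auto simp: tendsto_iff)
          then show ?thesis
          proof eventually_elim
            case (elim n)
            have "s / real (Suc n) > 0" "\<bar>s\<bar> = s" using True by simp_all
            then show ?case using pe elim by (auto simp: dist_real_def)
          qed
        qed
        then have ev: "\<forall>\<^sub>F n in sequentially. p + e / real (Suc n) * s \<in> {a..b} \<and>
            W0 (p + e / real (Suc n) * s) = W (p + e / real (Suc n) * s)"
          by eventually_elim (auto simp: W0_def)
        have "(\<lambda>n. W (p + e / real (Suc n) * s)) \<longlonglongrightarrow> W p"
          by (rule continuous_on_tendsto_compose[OF W l])
            (use pe ab ev in \<open>auto elim: eventually_mono\<close>)
        then have "(\<lambda>n. W0 (p + e / real (Suc n) * s)) \<longlonglongrightarrow> W p"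
          by (rule Lim_transform_eventually) (use ev in \<open>auto elim: eventually_mono\<close>)
        then show ?thesis by (intro tendsto_intros)
      qed
    qed
  qed auto
  then show ?thesis unfolding eq kI by simp
qed

lemma integral_deriv_step: "(LINT t:{1<..<2}|lborel. deriv step t) = 1"
  using LINT_FTC[of 1 2 step "deriv step"] smooth_step smooth_DERIV smooth_deriv smooth_continuous_on
    step_eq_0[of 1] step_eq_1[of 2] by fastforce

text \<open>A primitive is \<open>t * deriv step t - step t\<close>. The value -1 is what reduces
  the factor 2 of the mixed term in a second derivative of a product to 1 in
  \<open>one_sided_cutoff_limit2\<close>.\<close>

lemma integral_deriv2_step: "(LINT t:{1<..<2}|lborel. t * deriv (deriv step) t) = -1"
proof -
  have d: "(step has_real_derivative deriv step t) (at t)"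
     "(deriv step has_real_derivative deriv (deriv step) t) (at t)" for t
    using smooth_step smooth_deriv smooth_DERIV by blast+
  have "((\<lambda>t. t * deriv step t - step t) has_real_derivative t * deriv (deriv step) t) (at t)" for t
    by (auto intro!: derivative_eq_intros d)
  then have "(LINT t:{1<..<2}|lborel. t * deriv (deriv step) t)
      = (2 * deriv step 2 - step 2) - (1 * deriv step 1 - step 1)"
    by (intro LINT_FTC continuous_intros smooth_continuous_on smooth_deriv smooth_step) auto
  moreover have "deriv step t = 0" if "t = 1 \<or> t = 2" for t
  proof (rule closure_zero[of "deriv step" "-{1..2}"])
    have "closure (- {1..2::real}) = closure {..<1} \<union> closure {2<..}"
      unfolding closure_Un[symmetric] by (rule arg_cong[of _ _ closure]) auto
    then show "t \<in> closure (- {1..2})" using that by auto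
  qed (auto intro: smooth_continuous_on smooth_deriv smooth_step deriv_step_eq_0)
  ultimately show ?thesis by (simp add: step_eq_0 step_eq_1)
qed

lemma one_sided_cutoff_limit0:
  fixes G :: "real \<Rightarrow> real"
  assumes pe: "p = a \<and> e = 1 \<or> p = b \<and> e = -1"
    and G: "set_integrable lborel {a<..<b} G"
  shows "(\<lambda>n. LINT x:{a<..<b}|lborel. G x * step (real (Suc n) * (e * (x - p))))
    \<longlonglongrightarrow> (LINT x:{a<..<b}|lborel. G x)"
  unfolding set_lebesgue_integral_def
proof (rule integral_dominated_convergence[where w="\<lambda>x. \<bar>indicator {a<..<b} x *\<^sub>R G x\<bar>"])
  have [measurable]: "step \<in> borel_measurable borel"
    using smooth_continuous_on[OF smooth_step] by (rule borel_measurable_continuous_onI)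
  show [measurable]: "(\<lambda>x. indicator {a<..<b} x *\<^sub>R G x) \<in> borel_measurable lborel"
    using G by (auto simp: set_integrable_def)
  show "integrable lborel (\<lambda>x. \<bar>indicator {a<..<b} x *\<^sub>R G x\<bar>)"
    using G by (auto simp: set_integrable_def)
  show "(\<lambda>x. indicator {a<..<b} x *\<^sub>R (G x * step (real (Suc n) * (e * (x - p))))) \<in> borel_measurable lborel" for n
  proof -
    have "(\<lambda>x. (indicator {a<..<b} x *\<^sub>R G x) * step (real (Suc n) * (e * (x - p)))) \<in> borel_measurable lborel"
      by measurable
    then show ?thesis by (simp add: mult.assoc)
  qed
  show "AE x in lborel. norm (indicator {a<..<b} x *\<^sub>R (G x * step (real (Suc n) * (e * (x - p)))))
      \<le> \<bar>indicator {a<..<b} x *\<^sub>R G x\<bar>" for n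
    using step_bounds by (intro AE_I2) (auto simp: abs_mult mult_left_le split: split_indicator)
  show "AE x in lborel. (\<lambda>n. indicator {a<..<b} x *\<^sub>R (G x * step (real (Suc n) * (e * (x - p)))))
      \<longlonglongrightarrow> indicator {a<..<b} x *\<^sub>R G x"
  proof (rule AE_I2)
    fix x
    show "(\<lambda>n. indicator {a<..<b} x *\<^sub>R (G x * step (real (Suc n) * (e * (x - p)))))
      \<longlonglongrightarrow> indicator {a<..<b} x *\<^sub>R G x"
    proof (cases "x \<in> {a<..<b}")
      case True
      then have "e * (x - p) > 0" using pe by auto
      then have "filterlim (\<lambda>n. real (Suc n) * (e * (x - p))) at_top sequentially"
        by (intro filterlim_at_top_mult_tendsto_pos[OF tendsto_const]
            filterlim_compose[OF filterlim_real_sequentially filterlim_Suc])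
      then have "\<forall>\<^sub>F n in sequentially. real (Suc n) * (e * (x - p)) \<ge> 2"
        unfolding filterlim_at_top by blast
      then have "\<forall>\<^sub>F n in sequentially. indicator {a<..<b} x *\<^sub>R G x =
          indicator {a<..<b} x *\<^sub>R (G x * step (real (Suc n) * (e * (x - p))))"
        by eventually_elim (auto simp: step_eq_1)
      then show ?thesis by (rule Lim_transform_eventually[OF tendsto_const])
    qed auto
  qed
qed

text \<open>By the product rule the derivative falls either on \<open>c\<close>, where dominated
  convergence removes the cut-off, or on the cut-off, whose derivative is e times an approximate
  point mass at p.\<close>

lemma one_sided_cutoff_limit1:
  fixes V :: "real \<Rightarrow> real"
  assumes ab: "a < b" and pe: "p = a \<and> e = 1 \<or> p = b \<and> e = -1"
    and V: "continuous_on {a..b} V" and c: "smooth c"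
  shows "(\<lambda>n. LINT x:{a<..<b}|lborel. V x * deriv (\<lambda>x. c x * step (real (Suc n) * (e * (x - p)))) x)
    \<longlonglongrightarrow> (LINT x:{a<..<b}|lborel. V x * deriv c x) + e * V p * c p"
proof -
  have cont: "continuous_on S c" "continuous_on S (deriv c)" "continuous_on S step"
      "continuous_on S (deriv step)" for S
    by (intro smooth_continuous_on c smooth_deriv smooth_step)+
  have d: "(step has_real_derivative deriv step t) (at t)" for t
    using smooth_step smooth_DERIV by blast
  have dc: "(c has_real_derivative deriv c t) (at t)" for t
    using c smooth_DERIV by blast
  have eq: "(LINT x:{a<..<b}|lborel. V x * deriv (\<lambda>x. c x * step (real (Suc n) * (e * (x - p)))) x)
    = (LINT x:{a<..<b}|lborel. (V x * deriv c x) * step (real (Suc n) * (e * (x - p)))) +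
      (LINT x:{a<..<b}|lborel. (e * V x * c x) * (real (Suc n) * deriv step (real (Suc n) * (e * (x - p)))))"
    (is "_ = ?A n + ?B n") for n
  proof -
    have "deriv (\<lambda>x. c x * step (real (Suc n) * (e * (x - p)))) x =
        deriv c x * step (real (Suc n) * (e * (x - p)))
        + c x * (deriv step (real (Suc n) * (e * (x - p))) * (real (Suc n) * e))" for x
      by (rule DERIV_imp_deriv) (auto intro!: derivative_eq_intros d[THEN DERIV_chain2] dc)
    then have "V x * deriv (\<lambda>x. c x * step (real (Suc n) * (e * (x - p)))) x =
       (V x * deriv c x) * step (real (Suc n) * (e * (x - p))) +
       (e * V x * c x) * (real (Suc n) * deriv step (real (Suc n) * (e * (x - p))))" for x
      by (simp add: algebra_simps)
    then show ?thesis
      by (simp, intro set_integral_add set_integrable_Ioo continuous_intros V cont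
          continuous_on_compose2[OF cont(3)] continuous_on_compose2[OF cont(4)]) auto
  qed
  have "?A \<longlonglongrightarrow> (LINT x:{a<..<b}|lborel. V x * deriv c x)"
    by (intro one_sided_cutoff_limit0 pe set_integrable_Ioo continuous_intros V cont)
  moreover have "?B \<longlonglongrightarrow> (e * V p * c p) * (LINT t:{1<..<2}|lborel. deriv step t)"
    by (intro layer_limit ab pe continuous_intros V cont deriv_step_eq_0)
  ultimately show ?thesis
    unfolding eq integral_deriv_step by (auto intro: tendsto_add)
qed

text \<open>The second derivative of the cut-off is of size n^2 on a layer of width 1/n, so it would
  blow up without c(p) = 0. That zero supplies one factor x - p, which absorbs one power of n. The
  mixed term contributes 2 e V(p) c'(p) and the last term - e V(p) c'(p).\<close>

lemma one_sided_cutoff_limit2: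
  fixes V :: "real \<Rightarrow> real"
  assumes ab: "a < b" and pe: "p = a \<and> e = 1 \<or> p = b \<and> e = -1"
    and V: "continuous_on {a..b} V" and c: "smooth c" and c0: "c p = 0"
  shows "(\<lambda>n. LINT x:{a<..<b}|lborel. V x * deriv (deriv (\<lambda>x. c x * step (real (Suc n) * (e * (x - p))))) x)
    \<longlonglongrightarrow> (LINT x:{a<..<b}|lborel. V x * deriv (deriv c) x) + e * V p * deriv c p"
proof -
  have cont: "continuous_on S c" "continuous_on S (deriv c)" "continuous_on S (deriv (deriv c))"
     "continuous_on S step" "continuous_on S (deriv step)" "continuous_on S (deriv (deriv step))" for S
    by (intro smooth_continuous_on c smooth_deriv smooth_step)+
  have d: "(step has_real_derivative deriv step t) (at t)"
     "(deriv step has_real_derivative deriv (deriv step) t) (at t)" for t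
    using smooth_step smooth_deriv smooth_DERIV by blast+
  have dc: "(c has_real_derivative deriv c t) (at t)"
     "(deriv c has_real_derivative deriv (deriv c) t) (at t)" for t
    using c smooth_deriv smooth_DERIV by blast+
  have e: "e * e = 1" using pe by auto
  \<comment> \<open>Difference quotient of \<open>c\<close> at p, filled in by the derivative so
    that it is continuous: c(x) = q(x) (x - p). The last layer term then carries the profile t
    step''(t) instead of step''(t).\<close>
  define q where "q = (\<lambda>x. if x = p then deriv c p else c x / (x - p))"
  have q: "c x = q x * (x - p)" for x using c0 by (auto simp: q_def)
  have qcont: "continuous_on S q" for S
  proof -
    have "isCont q x" for x
    proof (cases "x = p")
      case True
      have "((\<lambda>x. (c x - c p) / (x - p)) \<longlongrightarrow> deriv c p) (at p)"
        using dc(1)[of p] by (simp add: has_field_derivative_iff)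
      then have "(q \<longlongrightarrow> deriv c p) (at p)"
        by (rule Lim_transform_eventually) (auto simp: q_def c0 eventually_at intro!: exI[of _ 1])
      then show ?thesis using True by (simp add: isCont_def q_def)
    next
      case False
      have "isCont (\<lambda>x. c x / (x - p)) x"
        using False DERIV_isCont[OF dc(1)[of x]] by (intro continuous_intros) auto
      moreover have "\<forall>\<^sub>F y in nhds x. q y = c y / (y - p)"
        by (rule eventually_mono[OF eventually_nhds_in_open[of "-{p}"]]) (use False in \<open>auto simp: q_def\<close>)
      ultimately show ?thesis by (simp add: isCont_cong)
    qed
    then show ?thesis by (auto simp: continuous_on_eq_continuous_at intro: continuous_at_imp_continuous_on)
  qed
  have eq: "(LINT x:{a<..<b}|lborel. V x * deriv (deriv (\<lambda>x. c x * step (real (Suc n) * (e * (x - p))))) x)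
    = (LINT x:{a<..<b}|lborel. (V x * deriv (deriv c) x) * step (real (Suc n) * (e * (x - p)))) +
      (LINT x:{a<..<b}|lborel. (2 * e * V x * deriv c x) * (real (Suc n) * deriv step (real (Suc n) * (e * (x - p))))) +
      (LINT x:{a<..<b}|lborel. (e * V x * q x) * (real (Suc n) *
         (\<lambda>t. t * deriv (deriv step) t) (real (Suc n) * (e * (x - p)))))"
    (is "_ = ?A n + ?B n + ?C n") for n
  proof -
    let ?s = "\<lambda>x. real (Suc n) * (e * (x - p))"
    have 1: "deriv (\<lambda>x. c x * step (?s x)) =
        (\<lambda>x. deriv c x * step (?s x) + c x * (deriv step (?s x) * (real (Suc n) * e)))"
      by (rule ext, rule DERIV_imp_deriv) (auto intro!: derivative_eq_intros d[THEN DERIV_chain2] dc)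
    have 2: "deriv (deriv (\<lambda>x. c x * step (?s x))) x =
        deriv (deriv c) x * step (?s x) + 2 * (deriv c x * (deriv step (?s x) * (real (Suc n) * e)))
        + c x * (deriv (deriv step) (?s x) * (real (Suc n) * e) * (real (Suc n) * e))" for x
      unfolding 1
      by (rule DERIV_imp_deriv) (auto intro!: derivative_eq_intros d[THEN DERIV_chain2] dc)
    have "V x * deriv (deriv (\<lambda>x. c x * step (?s x))) x =
       (V x * deriv (deriv c) x) * step (?s x) +
       (2 * e * V x * deriv c x) * (real (Suc n) * deriv step (?s x)) +
       (e * V x * q x) * (real (Suc n) * (?s x * deriv (deriv step) (?s x)))" for x
      unfolding 2 q[of x] by (simp only: ring_distribs mult_ac)
    moreover have "set_integrable lborel {a<..<b} (\<lambda>x. (V x * deriv (deriv c) x) * step (?s x))"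
      "set_integrable lborel {a<..<b} (\<lambda>x. (2 * e * V x * deriv c x) * (real (Suc n) * deriv step (?s x)))"
      "set_integrable lborel {a<..<b} (\<lambda>x. (e * V x * q x) * (real (Suc n) * (?s x * deriv (deriv step) (?s x))))"
      by (intro set_integrable_Ioo continuous_intros V cont qcont continuous_on_compose2[OF cont(4)[of UNIV]]
          continuous_on_compose2[OF cont(5)[of UNIV]] continuous_on_compose2[OF cont(6)[of UNIV]] subset_UNIV)+
    ultimately show ?thesis
      by (simp only: set_integral_add)
  qed
  have "?A \<longlonglongrightarrow> (LINT x:{a<..<b}|lborel. V x * deriv (deriv c) x)"
    by (intro one_sided_cutoff_limit0 pe set_integrable_Ioo continuous_intros V cont)
  moreover have "?B \<longlonglongrightarrow> (2 * e * V p * deriv c p) * (LINT t:{1<..<2}|lborel. deriv step t)"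
    by (intro layer_limit ab pe continuous_intros V cont deriv_step_eq_0)
  moreover have "?C \<longlonglongrightarrow> (e * V p * q p) * (LINT t:{1<..<2}|lborel. t * deriv (deriv step) t)"
    by (intro layer_limit ab pe continuous_intros V cont qcont) (simp add: deriv2_step_eq_0)
  ultimately have "(\<lambda>n. ?A n + ?B n + ?C n) \<longlonglongrightarrow> (LINT x:{a<..<b}|lborel. V x * deriv (deriv c) x)
     + (2 * e * V p * deriv c p) * 1 + (e * V p * q p) * (-1)"
    unfolding integral_deriv_step integral_deriv2_step by (intro tendsto_add)
  then show ?thesis unfolding eq by (simp add: q_def algebra_simps)
qed

section \<open>Two-sided cut-offs: from compactly supported to arbitrary smooth test
  functions\<close>

definition bump_on :: "real \<Rightarrow> real \<Rightarrow> (real \<Rightarrow> real) \<Rightarrow> bool" where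
  "bump_on a b \<psi> \<longleftrightarrow> smooth \<psi> \<and> (\<exists>a' b'. a < a' \<and> b' < b \<and> (\<forall>x. x \<notin> {a'..b'} \<longrightarrow> \<psi> x = 0))"

lemma bump_on_smooth: "bump_on a b \<psi> \<Longrightarrow> smooth \<psi>"
  by (simp add: bump_on_def)

text \<open>A sum minus 1 instead of a product of the two steps: it differentiates without cross
  terms, so the limits at the two endpoints can be computed separately and added. For small n it can
  be negative, but its modulus stays at most 1.\<close>

definition cutoff :: "real \<Rightarrow> real \<Rightarrow> nat \<Rightarrow> real \<Rightarrow> real" where
  "cutoff a b n x = step (real (Suc n) * (1 * (x - a))) + step (real (Suc n) * (-1 * (x - b))) - 1"

lemma smooth_step_affine: "smooth (\<lambda>x. step (m * (e * (x - p))))"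
proof -
  have "smooth (\<lambda>x. step ((m * e) * x + (- m * e * p)))"
    by (rule smooth_affine[OF smooth_step])
  then show ?thesis by (simp add: algebra_simps)
qed

lemma smooth_cutoff: "smooth (cutoff a b n)"
  unfolding cutoff_def by (intro smooth_diff smooth_add smooth_const smooth_step_affine)

lemma cutoff_abs_le: "\<bar>cutoff a b n x\<bar> \<le> 1"
  unfolding cutoff_def
  using step_bounds[of "real (Suc n) * (1 * (x - a))"] step_bounds[of "real (Suc n) * (-1 * (x - b))"]
  by linarith

lemma cutoff_eventually_1:
  assumes "x \<in> {a<..<b}"
  shows "\<forall>\<^sub>F n in sequentially. cutoff a b n x = 1"
proof -
  have *: "\<forall>\<^sub>F n in sequentially. real (Suc n) * d \<ge> 2" if "d > 0" for d
  proof -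
    have "filterlim (\<lambda>n. real (Suc n) * d) at_top sequentially"
      using that by (subst mult.commute, intro filterlim_tendsto_pos_mult_at_top[OF tendsto_const]
          filterlim_compose[OF filterlim_real_sequentially filterlim_Suc])
    then show ?thesis unfolding filterlim_at_top by blast
  qed
  have "x - a > 0" "b - x > 0" using assms by auto
  from *[OF this(1)] *[OF this(2)] show ?thesis
    by eventually_elim (simp add: cutoff_def step_eq_1)
qed

lemma bump_on_cutoff:
  assumes "a < b" "smooth c"
  shows "\<forall>\<^sub>F n in sequentially. bump_on a b (\<lambda>x. c x * cutoff a b n x)"
proof -
  have "filterlim (\<lambda>n. (b - a) * real (Suc n)) at_top sequentially"
    using assms by (intro filterlim_tendsto_pos_mult_at_top[OF tendsto_const]
        filterlim_compose[OF filterlim_real_sequentially filterlim_Suc]) auto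
  then have "\<forall>\<^sub>F n in sequentially. (b - a) * real (Suc n) \<ge> 3"
    unfolding filterlim_at_top by blast
  then show ?thesis
  proof eventually_elim
    case (elim n)
    define N where "N = real (Suc n)"
    \<comment> \<open>The bound 3 is 1 + 2: where one step has argument at most 1 and is 0, the
      other has argument at least 2 and is 1, so the sum minus 1 is 0.\<close>
    have N: "N > 0" "N * (b - a) \<ge> 3" using elim by (auto simp: N_def mult.commute)
    have "cutoff a b n x = 0" if x: "x \<notin> {a + 1 / N..b - 1 / N}" for x
    proof -
      consider "x < a + 1 / N" | "x > b - 1 / N" using x by force
      then show ?thesis
      proof cases
        case 1
        have "N * (x - a) \<le> 1" using 1 N(1) by (simp add: field_simps)
        moreover have "N * (b - x) \<ge> 2"
        proof -
          have "N * (b - x) = N * (b - a) - N * (x - a)" by (simp add: algebra_simps)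
          with N(2) \<open>N * (x - a) \<le> 1\<close> show ?thesis by linarith
        qed
        ultimately show ?thesis by (simp add: cutoff_def N_def step_eq_0 step_eq_1)
      next
        case 2
        have "N * (b - x) \<le> 1" using 2 N(1) by (simp add: field_simps)
        moreover have "N * (x - a) \<ge> 2"
        proof -
          have "N * (x - a) = N * (b - a) - N * (b - x)" by (simp add: algebra_simps)
          with N(2) \<open>N * (b - x) \<le> 1\<close> show ?thesis by linarith
        qed
        ultimately show ?thesis by (simp add: cutoff_def N_def step_eq_0 step_eq_1)
      qed
    qed
    moreover have "a < a + 1 / N" "b - 1 / N < b" using N by auto
    ultimately show ?case unfolding bump_on_def
      using smooth_mult[OF assms(2) smooth_cutoff[of a b n]] by (metis mult_zero_right)
  qed
qed

lemma deriv_cutoff_split: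
  fixes a b :: real
  assumes c: "smooth c"
  defines "l \<equiv> \<lambda>n x. c x * step (real (Suc n) * (1 * (x - a)))"
    and "r \<equiv> \<lambda>n x. c x * step (real (Suc n) * (-1 * (x - b)))"
  shows "deriv (\<lambda>x. c x * cutoff a b n x) x = deriv (l n) x + deriv (r n) x - deriv c x"
    "deriv (deriv (\<lambda>x. c x * cutoff a b n x)) x
      = deriv (deriv (l n)) x + deriv (deriv (r n)) x - deriv (deriv c) x"
    "smooth (l n)" "smooth (r n)"
proof -
  show s: "smooth (l n)" "smooth (r n)" unfolding l_def r_def
    by (intro smooth_mult c smooth_step_affine)+
  have e: "(\<lambda>x. c x * cutoff a b n x) = (\<lambda>x. l n x + r n x - c x)"
    by (auto simp: cutoff_def l_def r_def algebra_simps)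
  have 1: "deriv (\<lambda>x. l n x + r n x - c x) = (\<lambda>x. deriv (l n) x + deriv (r n) x - deriv c x)"
    by (rule ext, rule DERIV_imp_deriv) (intro derivative_intros smooth_DERIV s c)
  have 2: "deriv (\<lambda>x. deriv (l n) x + deriv (r n) x - deriv c x) x
      = deriv (deriv (l n)) x + deriv (deriv (r n)) x - deriv (deriv c) x"
    by (rule DERIV_imp_deriv) (intro derivative_intros smooth_DERIV smooth_deriv s c)
  show "deriv (\<lambda>x. c x * cutoff a b n x) x = deriv (l n) x + deriv (r n) x - deriv c x"
    unfolding e 1 ..
  show "deriv (deriv (\<lambda>x. c x * cutoff a b n x)) x
      = deriv (deriv (l n)) x + deriv (deriv (r n)) x - deriv (deriv c) x"
    unfolding e 1 2 ..
qed

lemma cutoff_limit0: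
  fixes G c :: "real \<Rightarrow> real"
  assumes "set_integrable lborel {a<..<b} G" "continuous_on {a..b} c"
  shows "(\<lambda>n. LINT x:{a<..<b}|lborel. G x * (c x * cutoff a b n x)) \<longlonglongrightarrow> (LINT x:{a<..<b}|lborel. G x * c x)"
  unfolding set_lebesgue_integral_def
proof (rule integral_dominated_convergence[where w="\<lambda>x. \<bar>indicator {a<..<b} x *\<^sub>R (G x * c x)\<bar>"])
  have G: "set_integrable lborel {a<..<b} (\<lambda>x. G x * c x)"
    by (rule set_integrable_mult_continuous[OF assms])
  then show "integrable lborel (\<lambda>x. \<bar>indicator {a<..<b} x *\<^sub>R (G x * c x)\<bar>)"
    by (auto simp: set_integrable_def)
  show "(\<lambda>x. indicator {a<..<b} x *\<^sub>R (G x * c x)) \<in> borel_measurable lborel"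
    using G by (auto simp: set_integrable_def)
  show "(\<lambda>x. indicator {a<..<b} x *\<^sub>R (G x * (c x * cutoff a b n x))) \<in> borel_measurable lborel" for n
    using set_integrable_mult_continuous[OF G smooth_continuous_on[OF smooth_cutoff[of a b n]]]
    by (auto simp: set_integrable_def mult.assoc)
  show "AE x in lborel. norm (indicator {a<..<b} x *\<^sub>R (G x * (c x * cutoff a b n x)))
      \<le> \<bar>indicator {a<..<b} x *\<^sub>R (G x * c x)\<bar>" for n
    using cutoff_abs_le[of a b n]
    by (intro AE_I2) (auto simp: abs_mult mult_left_le mult.assoc[symmetric] split: split_indicator)
  show "AE x in lborel. (\<lambda>n. indicator {a<..<b} x *\<^sub>R (G x * (c x * cutoff a b n x)))
      \<longlonglongrightarrow> indicator {a<..<b} x *\<^sub>R (G x * c x)"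
  proof (rule AE_I2)
    fix x
    show "(\<lambda>n. indicator {a<..<b} x *\<^sub>R (G x * (c x * cutoff a b n x)))
      \<longlonglongrightarrow> indicator {a<..<b} x *\<^sub>R (G x * c x)"
    proof (cases "x \<in> {a<..<b}")
      case True
      have "\<forall>\<^sub>F n in sequentially. indicator {a<..<b} x *\<^sub>R (G x * c x) =
          indicator {a<..<b} x *\<^sub>R (G x * (c x * cutoff a b n x))"
        using cutoff_eventually_1[OF True] by eventually_elim simp
      then show ?thesis by (rule Lim_transform_eventually[OF tendsto_const])
    qed auto
  qed
qed

text \<open>No derivative falls on the test function, so removing the cut-off leaves no boundary
  term, and integrability of both sides is enough.\<close>

lemma bump_extend0:
  fixes V G c :: "real \<Rightarrow> real"
  assumes ab: "a < b"
    and V: "set_integrable lborel {a<..<b} V" and G: "set_integrable lborel {a<..<b} G"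
    and eq: "\<And>\<psi>. bump_on a b \<psi> \<Longrightarrow>
      (LINT x:{a<..<b}|lborel. V x * \<psi> x) = (LINT x:{a<..<b}|lborel. G x * \<psi> x)"
    and c: "smooth c"
  shows "(LINT x:{a<..<b}|lborel. V x * c x) = (LINT x:{a<..<b}|lborel. G x * c x)"
proof (rule LIMSEQ_unique[OF cutoff_limit0])
  show "(\<lambda>n. LINT x:{a<..<b}|lborel. V x * (c x * cutoff a b n x)) \<longlonglongrightarrow> (LINT x:{a<..<b}|lborel. G x * c x)"
    by (rule Lim_transform_eventually[OF cutoff_limit0[OF G smooth_continuous_on[OF c]]])
      (use bump_on_cutoff[OF ab c] eq in \<open>auto elim!: eventually_mono\<close>)
qed (use V c in \<open>auto intro: smooth_continuous_on\<close>)

text \<open>Here \<open>c\<close> need not vanish at the ends. Each end contributes the limit of its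
  layer integral, with inward sign +1 at a and -1 at b; this uses the values of \<open>V\<close>
  there, hence its continuity on the closed interval.\<close>

lemma bump_extend1:
  fixes V G c :: "real \<Rightarrow> real"
  assumes ab: "a < b"
    and V: "continuous_on {a..b} V" and G: "set_integrable lborel {a<..<b} G"
    and eq: "\<And>\<psi>. bump_on a b \<psi> \<Longrightarrow>
      (LINT x:{a<..<b}|lborel. V x * deriv \<psi> x) = (LINT x:{a<..<b}|lborel. G x * \<psi> x)"
    and c: "smooth c"
  shows "(LINT x:{a<..<b}|lborel. V x * deriv c x) + V a * c a - V b * c b
    = (LINT x:{a<..<b}|lborel. G x * c x)"
proof -
  define L R where "L = (\<lambda>n x. c x * step (real (Suc n) * (1 * (x - a))))"
    and "R = (\<lambda>n x. c x * step (real (Suc n) * (-1 * (x - b))))"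
  have s: "smooth (L n)" "smooth (R n)" for n
    unfolding L_def R_def using deriv_cutoff_split(3,4)[OF c] by blast+
  have split: "(LINT x:{a<..<b}|lborel. V x * deriv (\<lambda>x. c x * cutoff a b n x) x)
    = (LINT x:{a<..<b}|lborel. V x * deriv (L n) x) + (LINT x:{a<..<b}|lborel. V x * deriv (R n) x)
      - (LINT x:{a<..<b}|lborel. V x * deriv c x)" for n
  proof -
    have "V x * deriv (\<lambda>x. c x * cutoff a b n x) x
      = V x * deriv (L n) x + V x * deriv (R n) x - V x * deriv c x" for x
      unfolding deriv_cutoff_split(1)[OF c] L_def R_def by (simp add: algebra_simps)
    moreover have "set_integrable lborel {a<..<b} (\<lambda>x. V x * deriv f x)" if "smooth f" for f
      using that by (intro set_integrable_Ioo continuous_intros V smooth_continuous_on smooth_deriv)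
    ultimately show ?thesis using s c by (simp add: set_integral_add set_integral_diff)
  qed
  have "(\<lambda>n. LINT x:{a<..<b}|lborel. V x * deriv (\<lambda>x. c x * cutoff a b n x) x) \<longlonglongrightarrow>
    ((LINT x:{a<..<b}|lborel. V x * deriv c x) + 1 * V a * c a)
    + ((LINT x:{a<..<b}|lborel. V x * deriv c x) + (-1) * V b * c b)
    - (LINT x:{a<..<b}|lborel. V x * deriv c x)"
    unfolding split unfolding L_def R_def
    by (intro tendsto_intros one_sided_cutoff_limit1 ab V c) auto
  moreover have "(\<lambda>n. LINT x:{a<..<b}|lborel. V x * deriv (\<lambda>x. c x * cutoff a b n x) x) \<longlonglongrightarrow>
    (LINT x:{a<..<b}|lborel. G x * c x)"
    by (rule Lim_transform_eventually[OF cutoff_limit0[OF G smooth_continuous_on[OF c]]])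
      (use bump_on_cutoff[OF ab c] eq in \<open>auto elim!: eventually_mono\<close>)
  ultimately show ?thesis using LIMSEQ_unique by fastforce
qed

text \<open>The conditions c(a) = c(b) = 0 remove the boundary terms that would contain the
  derivative of \<open>V\<close>, a quantity without boundary values. Only \<open>V\<close> times
  the derivative of \<open>c\<close> survives.\<close>

lemma bump_extend2:
  fixes V G c :: "real \<Rightarrow> real"
  assumes ab: "a < b"
    and V: "continuous_on {a..b} V" and G: "set_integrable lborel {a<..<b} G"
    and eq: "\<And>\<psi>. bump_on a b \<psi> \<Longrightarrow>
      (LINT x:{a<..<b}|lborel. V x * deriv (deriv \<psi>) x) = (LINT x:{a<..<b}|lborel. G x * \<psi> x)"
    and c: "smooth c" "c a = 0" "c b = 0"
  shows "(LINT x:{a<..<b}|lborel. V x * deriv (deriv c) x) + V a * deriv c a - V b * deriv c b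
    = (LINT x:{a<..<b}|lborel. G x * c x)"
proof -
  define L R where "L = (\<lambda>n x. c x * step (real (Suc n) * (1 * (x - a))))"
    and "R = (\<lambda>n x. c x * step (real (Suc n) * (-1 * (x - b))))"
  have s: "smooth (L n)" "smooth (R n)" for n
    unfolding L_def R_def using deriv_cutoff_split(3,4)[OF c(1)] by blast+
  have split: "(LINT x:{a<..<b}|lborel. V x * deriv (deriv (\<lambda>x. c x * cutoff a b n x)) x)
    = (LINT x:{a<..<b}|lborel. V x * deriv (deriv (L n)) x) + (LINT x:{a<..<b}|lborel. V x * deriv (deriv (R n)) x)
      - (LINT x:{a<..<b}|lborel. V x * deriv (deriv c) x)" for n
  proof -
    have "V x * deriv (deriv (\<lambda>x. c x * cutoff a b n x)) x
      = V x * deriv (deriv (L n)) x + V x * deriv (deriv (R n)) x - V x * deriv (deriv c) x" for x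
      unfolding deriv_cutoff_split(2)[OF c(1)] L_def R_def by (simp add: algebra_simps)
    moreover have "set_integrable lborel {a<..<b} (\<lambda>x. V x * deriv (deriv f) x)" if "smooth f" for f
      using that by (intro set_integrable_Ioo continuous_intros V smooth_continuous_on smooth_deriv)
    ultimately show ?thesis using s c by (simp add: set_integral_add set_integral_diff)
  qed
  have "(\<lambda>n. LINT x:{a<..<b}|lborel. V x * deriv (deriv (\<lambda>x. c x * cutoff a b n x)) x) \<longlonglongrightarrow>
    ((LINT x:{a<..<b}|lborel. V x * deriv (deriv c) x) + 1 * V a * deriv c a)
    + ((LINT x:{a<..<b}|lborel. V x * deriv (deriv c) x) + (-1) * V b * deriv c b)
    - (LINT x:{a<..<b}|lborel. V x * deriv (deriv c) x)"
    unfolding split unfolding L_def R_def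
    by (intro tendsto_intros one_sided_cutoff_limit2 ab V c) auto
  moreover have "(\<lambda>n. LINT x:{a<..<b}|lborel. V x * deriv (deriv (\<lambda>x. c x * cutoff a b n x)) x) \<longlonglongrightarrow>
    (LINT x:{a<..<b}|lborel. G x * c x)"
    by (rule Lim_transform_eventually[OF cutoff_limit0[OF G smooth_continuous_on[OF c(1)]]])
      (use bump_on_cutoff[OF ab c(1)] eq in \<open>auto elim!: eventually_mono\<close>)
  ultimately show ?thesis using LIMSEQ_unique by fastforce
qed

section \<open>Continuous functions that vanish almost everywhere or have vanishing moments\<close>

lemma continuous_AE_0_imp_0:
  fixes F :: "'a::euclidean_space \<Rightarrow> real"
  assumes S: "open S" and F: "continuous_on (closure S) F"
    and AE: "AE p in lborel. p \<in> S \<longrightarrow> F p = 0" and p: "p \<in> closure S"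
  shows "F p = 0"
proof -
  have "F q = 0" if q: "q \<in> S" for q
  proof (rule ccontr)
    assume "F q \<noteq> 0"
    have o: "open (S \<inter> F -` (-{0}))"
      by (intro continuous_open_preimage S continuous_on_subset[OF F closure_subset]) auto
    have "q \<in> S \<inter> F -` (-{0})" using \<open>F q \<noteq> 0\<close> q by simp
    with o obtain d where d: "d > 0" "ball q d \<subseteq> S \<inter> F -` (-{0})"
      by (rule openE) blast
    have "AE y in lborel. y \<notin> ball q d"
      using AE by eventually_elim (use d in auto)
    then have "ball q d \<in> null_sets lborel"
      by (subst (asm) AE_iff_null_sets[symmetric]) auto
    then have "negligible (ball q d)"
      by (simp add: negligible_iff_null_sets null_sets_completionI)
    then show False using d(1) open_not_negligible[of "ball q d"] by auto
  qed
  then show ?thesis using continuous_constant_on_closure[OF F _ p] by blast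
qed

text \<open>If g is a polynomial uniformly close to V, then V is orthogonal to g and the integral of
  V^2 equals that of V (V - g), which is small. Hence V^2 integrates to 0, and continuity does the
  rest.\<close>

lemma zero_of_moments_zero:
  fixes V :: "real \<Rightarrow> real"
  assumes ab: "a < b" and V: "continuous_on {a..b} V"
    and mom: "\<And>k. (LINT x:{a<..<b}|lborel. V x * x ^ k) = 0" and x: "x \<in> {a..b}"
  shows "V x = 0"
proof -
  have i: "set_integrable lborel {a<..<b} f" if "continuous_on {a..b} f" for f :: "real \<Rightarrow> real"
    using that by (rule set_integrable_Ioo)
  define I where "I = (LINT x:{a<..<b}|lborel. \<bar>V x\<bar>)"
  have I: "I \<ge> 0" unfolding I_def set_lebesgue_integral_def by (intro integral_nonneg_AE) auto
  have "(LINT x:{a<..<b}|lborel. V x * V x) \<le> 0 + e" if e: "e > 0" for e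
  proof -
    \<comment> \<open>The accuracy e / (I + 1) makes the final bound e I / (I + 1), which is at most
      e even when the integral I of |V| is 0.\<close>
    obtain g where g: "real_polynomial_function g" "\<And>x. x \<in> {a..b} \<Longrightarrow> \<bar>V x - g x\<bar> < e / (I + 1)"
      using Stone_Weierstrass_real_polynomial_function[OF compact_Icc V, of "e / (I + 1)"] e I by auto
    then obtain c n where gc: "g = (\<lambda>x. \<Sum>i\<le>n. c i * x ^ i)"
      unfolding real_polynomial_function_iff_sum by blast
    have gcont: "continuous_on {a..b} g" unfolding gc by (intro continuous_intros)
    have "(LINT x:{a<..<b}|lborel. V x * g x) = (LINT x:{a<..<b}|lborel. \<Sum>i\<le>n. c i * (V x * x ^ i))"
      unfolding gc by (simp add: sum_distrib_left mult_ac)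
    also have "\<dots> = (\<Sum>i\<le>n. LINT x:{a<..<b}|lborel. c i * (V x * x ^ i))"
      unfolding set_lebesgue_integral_def scaleR_sum_right
      by (intro Bochner_Integration.integral_sum, fold set_integrable_def)
        (intro i continuous_intros V)
    also have "\<dots> = 0" using mom by simp
    finally have g0: "(LINT x:{a<..<b}|lborel. V x * g x) = 0" .
    have "(LINT x:{a<..<b}|lborel. V x * V x) = (LINT x:{a<..<b}|lborel. V x * V x - V x * g x)"
      by (subst set_integral_diff) (auto intro!: i continuous_intros V gcont simp: g0)
    also have "\<dots> \<le> (LINT x:{a<..<b}|lborel. (e / (I + 1)) * \<bar>V x\<bar>)"
    proof (intro set_integral_mono i continuous_intros V gcont)
      fix x assume "x \<in> {a<..<b}"
      then have "\<bar>V x - g x\<bar> \<le> e / (I + 1)" using g(2)[of x] by auto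
      then have "\<bar>V x - g x\<bar> * \<bar>V x\<bar> \<le> e / (I + 1) * \<bar>V x\<bar>" by (rule mult_right_mono) simp
      moreover have "V x * V x - V x * g x \<le> \<bar>V x - g x\<bar> * \<bar>V x\<bar>"
        by (simp add: abs_mult[symmetric] right_diff_distrib[symmetric] mult.commute)
      ultimately show "V x * V x - V x * g x \<le> e / (I + 1) * \<bar>V x\<bar>" by linarith
    qed
    also have "\<dots> = e / (I + 1) * I" by (simp add: I_def)
    also have "\<dots> \<le> e" using e I by (simp add: field_simps)
    finally show ?thesis by simp
  qed
  then have le: "(LINT x:{a<..<b}|lborel. V x * V x) \<le> 0" by (rule field_le_epsilon)
  have Vi: "integrable lborel (\<lambda>x. indicator {a<..<b} x *\<^sub>R (V x * V x))"
    using i[of "\<lambda>x. V x * V x"] V by (auto simp: set_integrable_def intro: continuous_intros)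
  have "AE x in lborel. indicator {a<..<b} x *\<^sub>R (V x * V x) = 0"
    by (subst integral_nonneg_eq_0_iff_AE[OF Vi, symmetric])
      (use le in \<open>auto simp: set_lebesgue_integral_def intro!: antisym integral_nonneg_AE\<close>)
  then have AE0: "AE x in lborel. x \<in> {a<..<b} \<longrightarrow> V x = 0"
    by eventually_elim (auto split: split_indicator)
  show ?thesis
    by (rule continuous_AE_0_imp_0[OF open_greaterThanLessThan _ AE0]) (use V x ab in auto)
qed

section \<open>Test functions and weak derivatives on rectangles\<close>

definition tensor :: "(real \<Rightarrow> real) \<Rightarrow> (real \<Rightarrow> real) \<Rightarrow> real \<times> real \<Rightarrow> real" where
  "tensor \<psi> \<eta> = (\<lambda>(x, y). \<psi> x * \<eta> y)"

lemma tensor_apply [simp]: "tensor \<psi> \<eta> (x, y) = \<psi> x * \<eta> y"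
  by (simp add: tensor_def)

lemma pdx_tensor: "smooth \<psi> \<Longrightarrow> pdx (tensor \<psi> \<eta>) = tensor (deriv \<psi>) \<eta>"
  unfolding pdx_def tensor_def
  by (intro ext) (auto intro!: DERIV_imp_deriv DERIV_cmult_right smooth_DERIV)

lemma pdy_tensor: "smooth \<eta> \<Longrightarrow> pdy (tensor \<psi> \<eta>) = tensor \<psi> (deriv \<eta>)"
  unfolding pdy_def tensor_def
  by (intro ext) (auto intro!: DERIV_imp_deriv DERIV_cmult smooth_DERIV)

lemma continuous_on_tensor:
  "continuous_on UNIV \<psi> \<Longrightarrow> continuous_on UNIV \<eta> \<Longrightarrow> continuous_on S (tensor \<psi> \<eta>)"
  unfolding tensor_def case_prod_unfold
  using continuous_on_compose2[of UNIV \<psi> S fst] continuous_on_compose2[of UNIV \<eta> S snd]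
  by (simp add: continuous_on_mult continuous_on_fst continuous_on_snd)

lemma tensor_differentiable:
  assumes "smooth \<psi>" "smooth \<eta>"
  shows "tensor \<psi> \<eta> differentiable (at p)"
proof -
  have "(\<lambda>p. \<psi> (fst p)) differentiable (at p)" "(\<lambda>p. \<eta> (snd p)) differentiable (at p)"
    using smooth_DERIV[OF assms(1)] smooth_DERIV[OF assms(2)]
    by (blast intro: differentiable_compose[of _ fst] differentiable_compose[of _ snd]
        bounded_linear_imp_differentiable bounded_linear_fst bounded_linear_snd
        real_differentiable_def[THEN iffD2])+
  then show ?thesis unfolding tensor_def case_prod_unfold by (rule differentiable_mult)
qed

lemma Ck_tensor: "smooth \<psi> \<Longrightarrow> smooth \<eta> \<Longrightarrow> Ck k (tensor \<psi> \<eta>)"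
proof (induction k arbitrary: \<psi> \<eta>)
  case 0
  then show ?case by (auto intro: continuous_on_tensor smooth_continuous_on)
next
  case (Suc k)
  then show ?case
    by (simp add: tensor_differentiable pdx_tensor pdy_tensor smooth_deriv)
qed

lemma test_function_tensor:
  assumes "bump_on a b \<psi>" "bump_on c d \<eta>"
  shows "test_function ({a<..<b} \<times> {c<..<d}) (tensor \<psi> \<eta>)"
proof -
  obtain a' b' where ab: "a < a'" "b' < b" "\<And>x. x \<notin> {a'..b'} \<Longrightarrow> \<psi> x = 0"
    using assms(1) unfolding bump_on_def by blast
  obtain c' d' where cd: "c < c'" "d' < d" "\<And>x. x \<notin> {c'..d'} \<Longrightarrow> \<eta> x = 0"
    using assms(2) unfolding bump_on_def by blast
  have comp: "compact ({a'..b'} \<times> {c'..d'})" by (intro compact_Times compact_Icc)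
  have "{p. tensor \<psi> \<eta> p \<noteq> 0} \<subseteq> {a'..b'} \<times> {c'..d'}"
    using ab(3) cd(3) by (force simp: tensor_def)
  then have cl: "closure {p. tensor \<psi> \<eta> p \<noteq> 0} \<subseteq> {a'..b'} \<times> {c'..d'}"
    using comp by (intro closure_minimal compact_imp_closed)
  then have "compact (closure {p. tensor \<psi> \<eta> p \<noteq> 0})"
    using comp by (metis closed_closure compact_Int_closed inf.absorb_iff2)
  moreover have "{a'..b'} \<times> {c'..d'} \<subseteq> {a<..<b} \<times> {c<..<d}" using ab cd by auto
  ultimately show ?thesis
    using cl assms Ck_tensor bump_on_smooth unfolding test_function_def by blast
qed

lemma partial_tensor:
  assumes "smooth \<psi>" "smooth \<eta>"
  shows "partial 2 0 (tensor \<psi> \<eta>) = tensor (deriv (deriv \<psi>)) \<eta>"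
    "partial 1 1 (tensor \<psi> \<eta>) = tensor (deriv \<psi>) (deriv \<eta>)"
    "partial 0 2 (tensor \<psi> \<eta>) = tensor \<psi> (deriv (deriv \<eta>))"
  using assms by (simp_all add: partial_def numeral_2_eq_2 pdx_tensor pdy_tensor smooth_deriv)

lemma Ck_Suc_DERIV:
  assumes "Ck (Suc k) \<phi>"
  shows "((\<lambda>t. \<phi> (t, y)) has_real_derivative pdx \<phi> (x, y)) (at x)"
    "((\<lambda>t. \<phi> (x, t)) has_real_derivative pdy \<phi> (x, y)) (at y)"
proof -
  have "\<phi> differentiable (at (x, y))" using assms by simp
  moreover have "(\<lambda>t. (t, y)) differentiable (at x)" "(\<lambda>t. (x, t)) differentiable (at y)"
    by (auto intro!: derivative_eq_intros differentiableI)
  ultimately have "(\<lambda>t. \<phi> (t, y)) differentiable (at x)" "(\<lambda>t. \<phi> (x, t)) differentiable (at y)"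
    using differentiable_chain_at[of "\<lambda>t. (t, y)" x \<phi>] differentiable_chain_at[of "\<lambda>t. (x, t)" y \<phi>]
    by (auto simp: o_def)
  then show "((\<lambda>t. \<phi> (t, y)) has_real_derivative pdx \<phi> (x, y)) (at x)"
    "((\<lambda>t. \<phi> (x, t)) has_real_derivative pdy \<phi> (x, y)) (at y)"
    by (simp_all add: pdx_def pdy_def DERIV_deriv_iff_real_differentiable)
qed

lemma test_function_DERIV:
  assumes "test_function \<Omega> \<phi>"
  shows "((\<lambda>t. \<phi> (t, y)) has_real_derivative pdx \<phi> (x, y)) (at x)"
    "((\<lambda>t. \<phi> (x, t)) has_real_derivative pdy \<phi> (x, y)) (at y)"
proof -
  have "Ck (Suc 0) \<phi>" using assms unfolding test_function_def by blast
  from Ck_Suc_DERIV[OF this]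
  show "((\<lambda>t. \<phi> (t, y)) has_real_derivative pdx \<phi> (x, y)) (at x)"
    "((\<lambda>t. \<phi> (x, t)) has_real_derivative pdy \<phi> (x, y)) (at y)" .
qed

lemma test_function_Ck: "test_function \<Omega> \<phi> \<Longrightarrow> Ck k \<phi>"
  by (simp add: test_function_def)

lemma test_function_continuous_on:
  assumes "test_function \<Omega> \<phi>" shows "continuous_on S \<phi>"
  using test_function_Ck[OF assms, of 0] continuous_on_subset[OF _ subset_UNIV] by simp

lemma test_function_eq_0:
  assumes "test_function \<Omega> \<phi>" "p \<notin> \<Omega>" shows "\<phi> p = 0"
proof -
  have "closure {p. \<phi> p \<noteq> 0} \<subseteq> \<Omega>" using assms(1) by (simp add: test_function_def)
  then have "p \<notin> closure {p. \<phi> p \<noteq> 0}" using assms(2) by auto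
  then have "p \<notin> {p. \<phi> p \<noteq> 0}" by (rule contra_subsetD[OF closure_subset])
  then show ?thesis by simp
qed

text \<open>The complement of the support is open, so along each coordinate line through a point off
  the support the function is locally zero. Weak derivatives of higher order are then handled one
  order at a time.\<close>

lemma test_function_pd:
  assumes "test_function \<Omega> \<phi>"
  shows "test_function \<Omega> (pdx \<phi>)" "test_function \<Omega> (pdy \<phi>)"
proof -
  define S where "S = closure {p. \<phi> p \<noteq> 0}"
  have zero: "\<phi> p = 0" if "p \<notin> S" for p
    using contra_subsetD[OF closure_subset that[unfolded S_def]] by simp
  have S: "closed S" "compact S" "S \<subseteq> \<Omega>"
    using assms by (simp_all add: test_function_def S_def)
  have "pdx \<phi> p = 0 \<and> pdy \<phi> p = 0" if "p \<notin> S" for p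
  proof -
    obtain x y where p: "p = (x, y)" by fastforce
    have o: "open ((\<lambda>t. (t, y)) -` (- S))" "open ((\<lambda>t. (x, t)) -` (- S))"
      by (simp_all only: open_vimage[OF open_Compl[OF S(1)]] continuous_on_Pair
          continuous_on_id continuous_on_const)
    have "deriv (\<lambda>t. \<phi> (t, y)) x = 0"
      by (rule deriv_eq_0_of_const_on_open[OF o(1)]) (use that p in \<open>simp_all add: zero\<close>)
    moreover have "deriv (\<lambda>t. \<phi> (x, t)) y = 0"
      by (rule deriv_eq_0_of_const_on_open[OF o(2)]) (use that p in \<open>simp_all add: zero\<close>)
    ultimately show ?thesis by (simp add: p pdx_def pdy_def)
  qed
  then have "{p. pdx \<phi> p \<noteq> 0} \<subseteq> S" "{p. pdy \<phi> p \<noteq> 0} \<subseteq> S" by auto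
  then have cl: "closure {p. pdx \<phi> p \<noteq> 0} \<subseteq> S" "closure {p. pdy \<phi> p \<noteq> 0} \<subseteq> S"
    using S(1) by (simp_all add: closure_minimal)
  have "compact (closure T)" if "closure T \<subseteq> S" for T
    using compact_Int_closed[OF S(2) closed_closure[of T]] that by (metis Int_absorb1)
  with cl have "compact (closure {p. pdx \<phi> p \<noteq> 0})" "compact (closure {p. pdy \<phi> p \<noteq> 0})"
    by blast+
  moreover have "Ck k (pdx \<phi>)" "Ck k (pdy \<phi>)" for k
    using test_function_Ck[OF assms, of "Suc k"] by simp_all
  ultimately show "test_function \<Omega> (pdx \<phi>)" "test_function \<Omega> (pdy \<phi>)"
    using subset_trans[OF _ S(3)] cl unfolding test_function_def by simp_all
qed

lemma set_Fubini:
  fixes f :: "real \<times> real \<Rightarrow> real"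
  assumes "set_integrable lborel (A \<times> B) f"
  shows "(LINT p:A \<times> B|lborel. f p) = (LINT x:A|lborel. LINT y:B|lborel. f (x, y))"
    "set_integrable lborel A (\<lambda>x. LINT y:B|lborel. f (x, y))"
    "(LINT p:A \<times> B|lborel. f p) = (LINT y:B|lborel. LINT x:A|lborel. f (x, y))"
    "set_integrable lborel B (\<lambda>y. LINT x:A|lborel. f (x, y))"
proof -
  let ?f = "\<lambda>p. indicator (A \<times> B) p *\<^sub>R f p"
  have i: "integrable (lborel \<Otimes>\<^sub>M lborel) ?f"
    using assms by (simp add: set_integrable_def lborel_prod)
  then have i': "integrable (lborel \<Otimes>\<^sub>M lborel) (\<lambda>(x, y). ?f (x, y))"
    by (simp add: case_prod_unfold)
  have e: "(LINT y|lborel. ?f (x, y)) = indicator A x *\<^sub>R (LINT y:B|lborel. f (x, y))"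
    "(LINT x|lborel. ?f (x, y)) = indicator B y *\<^sub>R (LINT x:A|lborel. f (x, y))" for x y
    by (auto simp: set_lebesgue_integral_def indicator_times split: split_indicator)
  show "(LINT p:A \<times> B|lborel. f p) = (LINT x:A|lborel. LINT y:B|lborel. f (x, y))"
    using lborel_pair.integral_fst'[OF i] unfolding e
    by (simp add: set_lebesgue_integral_def lborel_prod)
  show "set_integrable lborel A (\<lambda>x. LINT y:B|lborel. f (x, y))"
    using lborel_pair.integrable_fst'[OF i] unfolding e set_integrable_def .
  show "(LINT p:A \<times> B|lborel. f p) = (LINT y:B|lborel. LINT x:A|lborel. f (x, y))"
    using lborel_pair.integral_snd[OF i'] unfolding e
    by (simp add: set_lebesgue_integral_def lborel_prod case_prod_unfold)
  show "set_integrable lborel B (\<lambda>y. LINT x:A|lborel. f (x, y))"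
    using lborel_pair.integrable_snd[OF i'] unfolding e set_integrable_def .
qed

lemma continuous_on_LINT_snd:
  fixes F :: "real \<times> real \<Rightarrow> real"
  assumes "continuous_on ({a..b} \<times> {c..d}) F"
  shows "continuous_on {a..b} (\<lambda>x. LINT y:{c<..<d}|lborel. F (x, y))"
proof -
  have "continuous_on {a..b} (\<lambda>x. integral (cbox c d) (\<lambda>y. F (x, y)))"
    using assms by (intro integral_continuous_on_param) (simp add: case_prod_unfold)
  moreover have "(LINT y:{c<..<d}|lborel. F (x, y)) = integral (cbox c d) (\<lambda>y. F (x, y))"
    if "x \<in> {a..b}" for x
  proof -
    have "continuous_on {c..d} (\<lambda>y. F (x, y))"
      by (rule continuous_on_compose2[OF assms]) (use that in \<open>auto intro!: continuous_intros\<close>)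
    then show ?thesis unfolding LINT_Ioo_eq_Icc
      by (subst set_borel_integral_eq_integral) (auto intro: borel_integrable_atLeastAtMost')
  qed
  ultimately show ?thesis
    by (subst continuous_on_cong[OF refl, where g="\<lambda>x. integral (cbox c d) (\<lambda>y. F (x, y))"]) auto
qed

lemma continuous_on_LINT_fst:
  fixes F :: "real \<times> real \<Rightarrow> real"
  assumes "continuous_on ({a..b} \<times> {c..d}) F"
  shows "continuous_on {c..d} (\<lambda>y. LINT x:{a<..<b}|lborel. F (x, y))"
proof -
  have "continuous_on ({c..d} \<times> {a..b}) (\<lambda>p. F (prod.swap p))"
    by (rule continuous_on_compose2[OF assms]) (auto intro!: continuous_intros simp: prod.swap_def)
  from continuous_on_LINT_snd[OF this] show ?thesis by simp
qed

lemma rectangle_borel [measurable]: "{a<..<b::real} \<times> {c<..<d::real} \<in> sets borel"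
  by (intro borel_open open_Times) auto

text \<open>Dominated by f^2 + g^2. Measurability is only known on \<Omega>, hence the detour
  through the two functions cut off by the indicator.\<close>

lemma L2_space_mult:
  assumes "f \<in> L2_space \<Omega>" "g \<in> L2_space \<Omega>"
  shows "set_integrable lborel \<Omega> (\<lambda>p. f p * g p)"
proof (rule set_integrable_bound)
  show "set_integrable lborel \<Omega> (\<lambda>p. (f p)\<^sup>2 + (g p)\<^sup>2)"
    using assms by (intro set_integral_add) (auto simp: L2_space_def)
  have "(\<lambda>p. (indicator \<Omega> p *\<^sub>R f p) * (indicator \<Omega> p *\<^sub>R g p)) \<in> borel_measurable lborel"
    using assms by (intro borel_measurable_times) (auto simp: L2_space_def set_borel_measurable_def)
  then show "set_borel_measurable lborel \<Omega> (\<lambda>p. f p * g p)"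
    unfolding set_borel_measurable_def
    by (rule subst[where P="\<lambda>h. h \<in> borel_measurable lborel", rotated]) (auto split: split_indicator)
  have "norm (x * y) \<le> norm (x\<^sup>2 + y\<^sup>2)" for x y :: real
  proof -
    have "2 * \<bar>x * y\<bar> \<le> x\<^sup>2 + y\<^sup>2"
      using sum_squares_bound[of "\<bar>x\<bar>" "\<bar>y\<bar>"] by (simp add: abs_mult)
    then show ?thesis by simp
  qed
  then show "AE p in lborel. p \<in> \<Omega> \<longrightarrow> norm (f p * g p) \<le> norm ((f p)\<^sup>2 + (g p)\<^sup>2)" by simp
qed

lemma rectangle_integrable:
  fixes F :: "real \<times> real \<Rightarrow> real"
  assumes "continuous_on ({a..b} \<times> {c..d}) F"
  shows "set_integrable lborel ({a<..<b} \<times> {c<..<d}) F"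
proof (rule set_integrable_subset)
  show "set_integrable lborel ({a..b} \<times> {c..d}) F"
    unfolding set_integrable_def by (intro borel_integrable_compact compact_Times compact_Icc assms)
qed auto

lemma L2_space_continuous:
  assumes "continuous_on ({a..b} \<times> {c..d}) F"
  shows "F \<in> L2_space ({a<..<b} \<times> {c<..<d})"
proof -
  have "set_integrable lborel ({a<..<b} \<times> {c<..<d}) (\<lambda>p. (F p)\<^sup>2)"
    by (intro rectangle_integrable continuous_intros assms)
  moreover have "set_borel_measurable lborel ({a<..<b} \<times> {c<..<d}) F"
    using rectangle_integrable[OF assms] by (auto simp: set_integrable_def set_borel_measurable_def)
  ultimately show ?thesis by (simp add: L2_space_def)
qed

lemma L2_space_diff:
  assumes "f \<in> L2_space \<Omega>" "g \<in> L2_space \<Omega>"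
  shows "(\<lambda>p. f p - g p) \<in> L2_space \<Omega>"
proof -
  have "set_integrable lborel \<Omega> (\<lambda>p. ((f p)\<^sup>2 + (g p)\<^sup>2) - 2 * (f p * g p))"
    using assms L2_space_mult[OF assms] by (intro set_integral_diff set_integral_add) (auto simp: L2_space_def)
  then have "set_integrable lborel \<Omega> (\<lambda>p. (f p - g p)\<^sup>2)"
    by (simp add: power2_diff algebra_simps)
  moreover have "(\<lambda>p. (indicator \<Omega> p *\<^sub>R f p) - (indicator \<Omega> p *\<^sub>R g p)) \<in> borel_measurable lborel"
    using assms by (intro borel_measurable_diff) (auto simp: L2_space_def set_borel_measurable_def)
  ultimately show ?thesis
    by (simp add: L2_space_def set_borel_measurable_def algebra_simps)
qed

text \<open>Fubini and the fundamental theorem of calculus for \<open>U * \<phi>\<close> on each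
  coordinate line. A test function is zero off the open rectangle, in particular at the end points
  of each segment.\<close>

lemma has_weak_partial_step:
  fixes U U' :: "real \<times> real \<Rightarrow> real"
  assumes ab: "a < b" and cd: "c < d"
    and cont: "continuous_on UNIV U" "continuous_on UNIV U'"
    and \<phi>: "test_function ({a<..<b} \<times> {c<..<d}) \<phi>"
  shows "(\<And>x y. ((\<lambda>t. U (t, y)) has_real_derivative U' (x, y)) (at x)) \<Longrightarrow>
      (LINT p:{a<..<b} \<times> {c<..<d}|lborel. U p * pdx \<phi> p) = - (LINT p:{a<..<b} \<times> {c<..<d}|lborel. U' p * \<phi> p)"
    "(\<And>x y. ((\<lambda>t. U (x, t)) has_real_derivative U' (x, y)) (at y)) \<Longrightarrow>
      (LINT p:{a<..<b} \<times> {c<..<d}|lborel. U p * pdy \<phi> p) = - (LINT p:{a<..<b} \<times> {c<..<d}|lborel. U' p * \<phi> p)"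
proof -
  let ?Q = "{a<..<b} \<times> {c<..<d}"
  have c: "continuous_on S U" "continuous_on S U'" for S
    using cont continuous_on_subset by blast+
  note c\<phi> = test_function_continuous_on[OF \<phi>] test_function_continuous_on[OF test_function_pd(1)[OF \<phi>]]
    test_function_continuous_on[OF test_function_pd(2)[OF \<phi>]]
  note i = rectangle_integrable
  note D = test_function_DERIV[OF \<phi>]
  have slice: "continuous_on S (\<lambda>t. F (t, y))" "continuous_on S (\<lambda>t. F (x, t))"
    if "continuous_on UNIV F" for S and F :: "real \<times> real \<Rightarrow> real" and x y
    by (auto intro!: continuous_on_compose2[OF that] continuous_intros)
  show "(LINT p:?Q|lborel. U p * pdx \<phi> p) = - (LINT p:?Q|lborel. U' p * \<phi> p)"
    if DU: "\<And>x y. ((\<lambda>t. U (t, y)) has_real_derivative U' (x, y)) (at x)"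
  proof -
    have "(LINT p:?Q|lborel. U p * pdx \<phi> p) + (LINT p:?Q|lborel. U' p * \<phi> p)
        = (LINT p:?Q|lborel. U p * pdx \<phi> p + U' p * \<phi> p)"
      by (intro set_integral_add(2)[symmetric] i continuous_intros c c\<phi>)
    also have "\<dots> = (LINT y:{c<..<d}|lborel. LINT x:{a<..<b}|lborel. U (x, y) * pdx \<phi> (x, y) + U' (x, y) * \<phi> (x, y))"
      by (intro set_Fubini(3) i continuous_intros c c\<phi>)
    also have "\<dots> = (LINT y:{c<..<d}|lborel. U (b, y) * \<phi> (b, y) - U (a, y) * \<phi> (a, y))"
    proof -
      have "(LINT x:{a<..<b}|lborel. U (x, y) * pdx \<phi> (x, y) + U' (x, y) * \<phi> (x, y))
         = U (b, y) * \<phi> (b, y) - U (a, y) * \<phi> (a, y)" for y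
        using LINT_FTC[OF less_imp_le[OF ab] DERIV_mult'[OF DU D(1)]]
        by (simp add: slice cont c\<phi> continuous_on_add continuous_on_mult)
      then show ?thesis by simp
    qed
    also have "\<dots> = 0" by (simp add: test_function_eq_0[OF \<phi>])
    finally show ?thesis by simp
  qed
  show "(LINT p:?Q|lborel. U p * pdy \<phi> p) = - (LINT p:?Q|lborel. U' p * \<phi> p)"
    if DU: "\<And>x y. ((\<lambda>t. U (x, t)) has_real_derivative U' (x, y)) (at y)"
  proof -
    have "(LINT p:?Q|lborel. U p * pdy \<phi> p) + (LINT p:?Q|lborel. U' p * \<phi> p)
        = (LINT p:?Q|lborel. U p * pdy \<phi> p + U' p * \<phi> p)"
      by (intro set_integral_add(2)[symmetric] i continuous_intros c c\<phi>)
    also have "\<dots> = (LINT x:{a<..<b}|lborel. LINT y:{c<..<d}|lborel. U (x, y) * pdy \<phi> (x, y) + U' (x, y) * \<phi> (x, y))"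
      by (intro set_Fubini(1) i continuous_intros c c\<phi>)
    also have "\<dots> = (LINT x:{a<..<b}|lborel. U (x, d) * \<phi> (x, d) - U (x, c) * \<phi> (x, c))"
    proof -
      have "(LINT y:{c<..<d}|lborel. U (x, y) * pdy \<phi> (x, y) + U' (x, y) * \<phi> (x, y))
         = U (x, d) * \<phi> (x, d) - U (x, c) * \<phi> (x, c)" for x
        using LINT_FTC[OF less_imp_le[OF cd] DERIV_mult'[OF DU D(2)]]
        by (simp add: slice cont c\<phi> continuous_on_add continuous_on_mult)
      then show ?thesis by simp
    qed
    also have "\<dots> = 0" by (simp add: test_function_eq_0[OF \<phi>])
    finally show ?thesis by simp
  qed
qed

section \<open>Integrable functions orthogonal to all products of bumps\<close>

lemma bump_on_mono: "bump_on a' b' \<psi> \<Longrightarrow> a \<le> a' \<Longrightarrow> b' \<le> b \<Longrightarrow> bump_on a b \<psi>"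
  unfolding bump_on_def by (meson le_less_trans less_le_trans)

lemma bump_on_eq_0:
  assumes "bump_on a b \<psi>" "x \<notin> {a<..<b}" shows "\<psi> x = 0"
proof -
  obtain a' b' where "a < a'" "b' < b" "\<And>x. x \<notin> {a'..b'} \<Longrightarrow> \<psi> x = 0"
    using assms(1) unfolding bump_on_def by blast
  then show ?thesis using assms(2) by force
qed

lemma cutoff_tendsto_indicator:
  assumes "a < b"
  shows "\<forall>\<^sub>F n in sequentially. cutoff a b n x = indicator {a<..<b} x"
proof (cases "x \<in> {a<..<b}")
  case True
  show ?thesis using cutoff_eventually_1[OF True] by eventually_elim (use True in simp)
next
  case False
  show ?thesis using bump_on_cutoff[OF assms smooth_const[of 1]]
    by eventually_elim (use bump_on_eq_0[OF _ False] False in auto)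
qed

text \<open>Products of two cut-offs converge pointwise to the indicator of the smaller box and stay
  bounded by 1, so dominated convergence passes orthogonality on to the indicator.\<close>

lemma orthogonal_to_bumps_imp_box_integral_0:
  assumes ab: "a < b" "a0 \<le> a" "b \<le> b0" and cd: "c < d" "c0 \<le> c" "d \<le> d0"
    and g: "set_integrable lborel ({a0<..<b0} \<times> {c0<..<d0}) g"
    and orth: "\<And>\<psi> \<eta>. bump_on a0 b0 \<psi> \<Longrightarrow> bump_on c0 d0 \<eta> \<Longrightarrow>
      (LINT p:{a0<..<b0} \<times> {c0<..<d0}|lborel. g p * tensor \<psi> \<eta> p) = 0"
  shows "(LINT p:{a<..<b} \<times> {c<..<d}|lborel. g p) = 0"
proof -
  let ?Q = "{a0<..<b0} \<times> {c0<..<d0}" and ?B = "{a<..<b} \<times> {c<..<d}"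
  define h where "h = (\<lambda>p. indicator ?Q p *\<^sub>R g p)"
  have h: "integrable lborel h" using g by (simp add: h_def set_integrable_def)
  then have hm [measurable]: "h \<in> borel_measurable borel" by auto
  define t where "t n = tensor (cutoff a b n) (cutoff c d n)" for n
  have tm [measurable]: "t n \<in> borel_measurable borel" for n
    unfolding t_def by (intro borel_measurable_continuous_onI continuous_on_tensor smooth_continuous_on smooth_cutoff)
  have "(\<lambda>n. LINT p|lborel. h p * t n p) \<longlonglongrightarrow> (LINT p|lborel. h p * indicator ?B p)"
  proof (rule integral_dominated_convergence[where w="\<lambda>p. \<bar>h p\<bar>"])
    show "integrable lborel (\<lambda>p. \<bar>h p\<bar>)" using h by simp
    show "AE p in lborel. norm (h p * t n p) \<le> \<bar>h p\<bar>" for n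
    proof (rule AE_I2)
      fix p
      have "\<bar>t n p\<bar> \<le> 1"
        unfolding t_def tensor_def case_prod_unfold abs_mult
        by (intro mult_le_one cutoff_abs_le) auto
      then show "norm (h p * t n p) \<le> \<bar>h p\<bar>" by (simp add: abs_mult mult_left_le)
    qed
    show "AE p in lborel. (\<lambda>n. h p * t n p) \<longlonglongrightarrow> h p * indicator ?B p"
    proof (rule AE_I2)
      fix p
      have "\<forall>\<^sub>F n in sequentially. h p * indicator ?B p = h p * t n p"
        using cutoff_tendsto_indicator[OF ab(1), of "fst p"] cutoff_tendsto_indicator[OF cd(1), of "snd p"]
        by eventually_elim (auto simp: t_def tensor_def case_prod_unfold indicator_times)
      then show "(\<lambda>n. h p * t n p) \<longlonglongrightarrow> h p * indicator ?B p"
        by (rule Lim_transform_eventually[OF tendsto_const])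
    qed
  qed measurable
  moreover have "\<forall>\<^sub>F n in sequentially. 0 = (LINT p|lborel. h p * t n p)"
    using bump_on_cutoff[OF ab(1) smooth_const[of 1]] bump_on_cutoff[OF cd(1) smooth_const[of 1]]
  proof eventually_elim
    case (elim n)
    then have "bump_on a0 b0 (cutoff a b n)" "bump_on c0 d0 (cutoff c d n)"
      using ab cd bump_on_mono by auto
    from orth[OF this] show ?case
      by (simp add: h_def t_def set_lebesgue_integral_def mult.assoc)
  qed
  then have "(\<lambda>n. LINT p|lborel. h p * t n p) \<longlonglongrightarrow> 0"
    by (rule Lim_transform_eventually[OF tendsto_const])
  ultimately have "(LINT p|lborel. h p * indicator ?B p) = 0"
    using LIMSEQ_unique by blast
  moreover have "h p * indicator ?B p = indicator ?B p *\<^sub>R g p" for p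
    using ab cd by (auto simp: h_def split: split_indicator)
  ultimately show ?thesis by (simp add: set_lebesgue_integral_def)
qed

lemma box_real_prod: "box (a, c) (b, d) = {a<..<b::real} \<times> {c<..<d::real}"
  by (simp add: box_prod)

text \<open>The open boxes are stable under intersection and generate the Borel sets. Once the
  integral over every box is 0, it is 0 over every Borel set, and the function is 0 almost
  everywhere.\<close>

lemma orthogonal_to_bumps_imp_AE_0:
  assumes g: "set_integrable lborel ({a<..<b} \<times> {c<..<d}) g"
    and orth: "\<And>\<psi> \<eta>. bump_on a b \<psi> \<Longrightarrow> bump_on c d \<eta> \<Longrightarrow>
      (LINT p:{a<..<b} \<times> {c<..<d}|lborel. g p * tensor \<psi> \<eta> p) = 0"
  shows "AE p in lborel. p \<in> {a<..<b} \<times> {c<..<d} \<longrightarrow> g p = 0"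
proof -
  let ?Q = "{a<..<b} \<times> {c<..<d}"
  define h where "h = (\<lambda>p. indicator ?Q p *\<^sub>R g p)"
  have h: "integrable lborel h" using g by (simp add: h_def set_integrable_def)
  have hi: "set_integrable lborel A h" if "A \<in> sets lborel" for A
    using integrable_mult_indicator[OF that h] by (simp add: set_integrable_def)
  have box: "(LINT p:box u v|lborel. h p) = 0" for u v :: "real \<times> real"
  proof -
    define a1 b1 c1 d1 where "a1 = max a (fst u)" and "b1 = min b (fst v)"
      and "c1 = max c (snd u)" and "d1 = min d (snd v)"
    have "box u v = {fst u<..<fst v} \<times> {snd u<..<snd v}"
      by (cases u; cases v) (simp add: box_real_prod)
    then have "box u v \<inter> ?Q = {a1<..<b1} \<times> {c1<..<d1}"
      by (auto simp: a1_def b1_def c1_def d1_def)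
    then have "indicator (box u v) p *\<^sub>R h p = indicator ({a1<..<b1} \<times> {c1<..<d1}) p *\<^sub>R g p" for p
      unfolding h_def by (metis indicator_inter_arith scaleR_scaleR)
    then have "(LINT p:box u v|lborel. h p) = (LINT p:{a1<..<b1} \<times> {c1<..<d1}|lborel. g p)"
      by (simp add: set_lebesgue_integral_def)
    also have "\<dots> = 0"
    proof (cases "a1 < b1 \<and> c1 < d1")
      case True
      then show ?thesis
        by (intro orthogonal_to_bumps_imp_box_integral_0[OF _ _ _ _ _ _ g orth])
          (auto simp: a1_def b1_def c1_def d1_def)
    next
      case False
      then have e: "{a1<..<b1} \<times> {c1<..<d1} = {}" by auto
      show ?thesis unfolding e by (simp add: set_lebesgue_integral_def)
    qed
    finally show ?thesis .
  qed
  have "(LINT p:A|lborel. h p) = 0" if "A \<in> sets lborel" for A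
  proof -
    let ?E = "range (\<lambda>(u, v). box u v :: (real \<times> real) set)"
    have sets: "sets lborel = sigma_sets UNIV ?E"
      by (simp add: borel_eq_box)
    have "Int_stable ?E"
      by (auto simp: Int_stable_def box_Int_box)
    moreover have "?E \<subseteq> Pow UNIV" by simp
    moreover have "A \<in> sigma_sets UNIV ?E" using that sets by blast
    ultimately show ?thesis
    proof (induct rule: sigma_sets_induct_disjoint)
      case (basic A)
      then show ?case using box by auto
    next
      case empty
      then show ?case by (simp add: set_lebesgue_integral_def)
    next
      case (compl A)
      then have A: "A \<in> sets lborel" using sets by blast
      \<comment> \<open>Complements need the integral over the whole plane. As \<open>h\<close> is
        zero off the rectangle, it is again the integral over a box.\<close>
      have "(LINT p:UNIV|lborel. h p) = (LINT p:box (a, c) (b, d)|lborel. h p)"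
        by (auto simp: set_lebesgue_integral_def h_def box_real_prod
            intro!: Bochner_Integration.integral_cong split: split_indicator)
      then have "(LINT p:UNIV|lborel. h p) = 0" using box by simp
      moreover have "(LINT p:A \<union> (UNIV - A)|lborel. h p)
          = (LINT p:A|lborel. h p) + (LINT p:UNIV - A|lborel. h p)"
        using A by (intro set_integral_Un hi) auto
      ultimately show ?case using compl by simp
    next
      case (union A)
      then have A: "A i \<in> sets lborel" for i using sets by blast
      have "(LINT p:(\<Union>i. A i)|lborel. h p) = (\<Sum>i. LINT p:A i|lborel. h p)"
        using union(1) A by (intro lebesgue_integral_countable_add hi) (auto simp: disjoint_family_on_def)
      then show ?case using union by simp
    qed
  qed
  then have "AE p in lborel. h p = 0" using sigma_finite_measure.density_zero[OF sigma_finite_lborel h] by blast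
  then show ?thesis by eventually_elim (auto simp: h_def)
qed

lemma LINT_tensor:
  assumes f: "f \<in> L2_space ({a<..<b} \<times> {c<..<d})"
    and \<psi>: "continuous_on UNIV \<psi>" and \<eta>: "continuous_on UNIV \<eta>"
  shows "set_integrable lborel ({a<..<b} \<times> {c<..<d}) (\<lambda>p. f p * tensor \<psi> \<eta> p)"
    "(LINT p:{a<..<b} \<times> {c<..<d}|lborel. f p * tensor \<psi> \<eta> p)
      = (LINT x:{a<..<b}|lborel. (LINT y:{c<..<d}|lborel. f (x, y) * \<eta> y) * \<psi> x)"
    "(LINT p:{a<..<b} \<times> {c<..<d}|lborel. f p * tensor \<psi> \<eta> p)
      = (LINT y:{c<..<d}|lborel. (LINT x:{a<..<b}|lborel. f (x, y) * \<psi> x) * \<eta> y)"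
    "set_integrable lborel {a<..<b} (\<lambda>x. LINT y:{c<..<d}|lborel. f (x, y) * \<eta> y)"
    "set_integrable lborel {c<..<d} (\<lambda>y. LINT x:{a<..<b}|lborel. f (x, y) * \<psi> x)"
proof -
  have i: "set_integrable lborel ({a<..<b} \<times> {c<..<d}) (\<lambda>p. f p * tensor \<psi> \<eta> p)"
    if "continuous_on UNIV \<psi>" "continuous_on UNIV \<eta>" for \<psi> \<eta>
    by (intro L2_space_mult f L2_space_continuous continuous_on_tensor that)
  show "set_integrable lborel ({a<..<b} \<times> {c<..<d}) (\<lambda>p. f p * tensor \<psi> \<eta> p)"
    using i \<psi> \<eta> .
  show "(LINT p:{a<..<b} \<times> {c<..<d}|lborel. f p * tensor \<psi> \<eta> p)
      = (LINT x:{a<..<b}|lborel. (LINT y:{c<..<d}|lborel. f (x, y) * \<eta> y) * \<psi> x)"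
  proof -
    have "f (x, y) * tensor \<psi> \<eta> (x, y) = (f (x, y) * \<eta> y) * \<psi> x" for x y by simp
    then show ?thesis unfolding set_Fubini(1)[OF i[OF \<psi> \<eta>]] by (simp only: set_integral_mult_left)
  qed
  show "(LINT p:{a<..<b} \<times> {c<..<d}|lborel. f p * tensor \<psi> \<eta> p)
      = (LINT y:{c<..<d}|lborel. (LINT x:{a<..<b}|lborel. f (x, y) * \<psi> x) * \<eta> y)"
  proof -
    have "f (x, y) * tensor \<psi> \<eta> (x, y) = (f (x, y) * \<psi> x) * \<eta> y" for x y by simp
    then show ?thesis unfolding set_Fubini(3)[OF i[OF \<psi> \<eta>]] by (simp only: set_integral_mult_left)
  qed
  show "set_integrable lborel {a<..<b} (\<lambda>x. LINT y:{c<..<d}|lborel. f (x, y) * \<eta> y)"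
    using set_Fubini(2)[OF i[of "\<lambda>_. 1" \<eta>]] \<eta> by simp
  show "set_integrable lborel {c<..<d} (\<lambda>y. LINT x:{a<..<b}|lborel. f (x, y) * \<psi> x)"
    using set_Fubini(4)[OF i[of \<psi> "\<lambda>_. 1"]] \<psi> by simp
qed

text \<open>Integrating out one variable keeps continuity up to the boundary in the other, as
  \<open>bump_extend1\<close> and \<open>bump_extend2\<close> require of their
  \<open>V\<close>.\<close>

lemma continuous_on_LINT_mult:
  fixes w :: "real \<times> real \<Rightarrow> real"
  assumes w: "continuous_on ({a..b} \<times> {c..d}) w" and \<psi>: "continuous_on UNIV \<psi>"
  shows "continuous_on {a..b} (\<lambda>x. LINT y:{c<..<d}|lborel. w (x, y) * \<psi> y)"
    "continuous_on {c..d} (\<lambda>y. LINT x:{a<..<b}|lborel. w (x, y) * \<psi> x)"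
proof -
  have "continuous_on ({a..b} \<times> {c..d}) (\<lambda>p. w p * tensor (\<lambda>_. 1) \<psi> p)"
    "continuous_on ({a..b} \<times> {c..d}) (\<lambda>p. w p * tensor \<psi> (\<lambda>_. 1) p)"
    by (intro continuous_intros w continuous_on_tensor \<psi>)+
  from continuous_on_LINT_snd[OF this(1)] continuous_on_LINT_fst[OF this(2)]
  show "continuous_on {a..b} (\<lambda>x. LINT y:{c<..<d}|lborel. w (x, y) * \<psi> y)"
    "continuous_on {c..d} (\<lambda>y. LINT x:{a<..<b}|lborel. w (x, y) * \<psi> x)" by simp_all
qed

section \<open>Green formulas for weak second derivatives of a function vanishing on two opposite
  sides\<close>

context
  fixes a b c d :: real and w g :: "real \<times> real \<Rightarrow> real"
  assumes ab: "a < b" and cd: "c < d"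
    and w: "continuous_on ({a..b} \<times> {c..d}) w"
    and w0: "\<And>y. y \<in> {c<..<d} \<Longrightarrow> w (a, y) = 0" "\<And>y. y \<in> {c<..<d} \<Longrightarrow> w (b, y) = 0"
    and g: "g \<in> L2_space ({a<..<b} \<times> {c<..<d})"
begin

private lemma wL2: "w \<in> L2_space ({a<..<b} \<times> {c<..<d})"
  by (rule L2_space_continuous[OF w])

private lemma side0: "(LINT y:{c<..<d}|lborel. w (a, y) * \<eta> y) = 0"
    "(LINT y:{c<..<d}|lborel. w (b, y) * \<eta> y) = 0"
  by (subst set_lebesgue_integral_cong[where g="\<lambda>_. 0"]; simp add: w0)+

text \<open>The factors are freed from compact support one variable at a time. With a bump in y, the
  y-integrals are functions of x to which \<open>bump_extend2\<close> applies; its boundary terms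
  vanish since \<open>w\<close> is 0 on the sides x = a and x = b. In y no derivative is taken, so
  \<open>bump_extend0\<close> admits any \<open>Y\<close>.\<close>

lemma weak_green_xx:
  assumes weak: "\<And>\<psi> \<eta>. bump_on a b \<psi> \<Longrightarrow> bump_on c d \<eta> \<Longrightarrow>
      (LINT p:{a<..<b} \<times> {c<..<d}|lborel. w p * tensor (deriv (deriv \<psi>)) \<eta> p)
      = (LINT p:{a<..<b} \<times> {c<..<d}|lborel. g p * tensor \<psi> \<eta> p)"
    and X: "smooth X" "X a = 0" "X b = 0" and Y: "smooth Y"
  shows "(LINT p:{a<..<b} \<times> {c<..<d}|lborel. g p * tensor X Y p)
    = (LINT p:{a<..<b} \<times> {c<..<d}|lborel. w p * tensor (deriv (deriv X)) Y p)"
proof -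
  note sc = smooth_continuous_on
  have x: "(LINT p:{a<..<b} \<times> {c<..<d}|lborel. w p * tensor (deriv (deriv X)) \<eta> p)
      = (LINT p:{a<..<b} \<times> {c<..<d}|lborel. g p * tensor X \<eta> p)" if \<eta>: "bump_on c d \<eta>" for \<eta>
  proof -
    have s\<eta>: "smooth \<eta>" using bump_on_smooth[OF \<eta>] .
    have "(LINT x:{a<..<b}|lborel. (LINT y:{c<..<d}|lborel. w (x, y) * \<eta> y) * deriv (deriv X) x)
      + (LINT y:{c<..<d}|lborel. w (a, y) * \<eta> y) * deriv X a - (LINT y:{c<..<d}|lborel. w (b, y) * \<eta> y) * deriv X b
      = (LINT x:{a<..<b}|lborel. (LINT y:{c<..<d}|lborel. g (x, y) * \<eta> y) * X x)"
    proof (rule bump_extend2[OF ab _ _ _ X])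
      show "continuous_on {a..b} (\<lambda>x. LINT y:{c<..<d}|lborel. w (x, y) * \<eta> y)"
        by (rule continuous_on_LINT_mult(1)[OF w sc[OF s\<eta>]])
      show "set_integrable lborel {a<..<b} (\<lambda>x. LINT y:{c<..<d}|lborel. g (x, y) * \<eta> y)"
        by (rule LINT_tensor(4)[OF g sc[OF smooth_const] sc[OF s\<eta>]])
      show "(LINT x:{a<..<b}|lborel. (LINT y:{c<..<d}|lborel. w (x, y) * \<eta> y) * deriv (deriv \<psi>) x)
          = (LINT x:{a<..<b}|lborel. (LINT y:{c<..<d}|lborel. g (x, y) * \<eta> y) * \<psi> x)"
        if \<psi>: "bump_on a b \<psi>" for \<psi>
        using weak[OF \<psi> \<eta>] bump_on_smooth[OF \<psi>] s\<eta>
        by (simp add: LINT_tensor(2)[OF wL2] LINT_tensor(2)[OF g] sc smooth_deriv)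
    qed
    then show ?thesis using s\<eta> X
      by (simp add: LINT_tensor(2)[OF wL2] LINT_tensor(2)[OF g] sc smooth_deriv side0)
  qed
  have "(LINT y:{c<..<d}|lborel. (LINT x:{a<..<b}|lborel. w (x, y) * deriv (deriv X) x) * Y y)
      = (LINT y:{c<..<d}|lborel. (LINT x:{a<..<b}|lborel. g (x, y) * X x) * Y y)"
  proof (rule bump_extend0[OF cd _ _ _ Y])
    show "set_integrable lborel {c<..<d} (\<lambda>y. LINT x:{a<..<b}|lborel. w (x, y) * deriv (deriv X) x)"
      "set_integrable lborel {c<..<d} (\<lambda>y. LINT x:{a<..<b}|lborel. g (x, y) * X x)"
      using X by (auto intro!: LINT_tensor(5)[OF _ _ sc[OF smooth_const]] wL2 g sc smooth_deriv)
    show "(LINT y:{c<..<d}|lborel. (LINT x:{a<..<b}|lborel. w (x, y) * deriv (deriv X) x) * \<eta> y)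
      = (LINT y:{c<..<d}|lborel. (LINT x:{a<..<b}|lborel. g (x, y) * X x) * \<eta> y)" if \<eta>: "bump_on c d \<eta>" for \<eta>
      using x[OF \<eta>] bump_on_smooth[OF \<eta>] X
      by (simp add: LINT_tensor(3)[OF wL2] LINT_tensor(3)[OF g] sc smooth_deriv)
  qed
  then show ?thesis using X Y
    by (simp add: LINT_tensor(3)[OF wL2] LINT_tensor(3)[OF g] sc smooth_deriv)
qed

text \<open>\<open>X\<close> may be nonzero at a and b, as cos is: the boundary terms in x contain
  \<open>w\<close> on the two sides where it vanishes. In y nothing vanishes, and the two edge
  integrals remain.\<close>

lemma weak_green_xy:
  assumes weak: "\<And>\<psi> \<eta>. bump_on a b \<psi> \<Longrightarrow> bump_on c d \<eta> \<Longrightarrow>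
      (LINT p:{a<..<b} \<times> {c<..<d}|lborel. w p * tensor (deriv \<psi>) (deriv \<eta>) p)
      = (LINT p:{a<..<b} \<times> {c<..<d}|lborel. g p * tensor \<psi> \<eta> p)"
    and X: "smooth X" and Y: "smooth Y"
  shows "(LINT p:{a<..<b} \<times> {c<..<d}|lborel. g p * tensor X Y p)
    = (LINT p:{a<..<b} \<times> {c<..<d}|lborel. w p * tensor (deriv X) (deriv Y) p)
      + (LINT x:{a<..<b}|lborel. w (x, c) * deriv X x) * Y c
      - (LINT x:{a<..<b}|lborel. w (x, d) * deriv X x) * Y d"
proof -
  note sc = smooth_continuous_on
  have x: "(LINT p:{a<..<b} \<times> {c<..<d}|lborel. w p * tensor (deriv X) (deriv \<eta>) p)
      = (LINT p:{a<..<b} \<times> {c<..<d}|lborel. g p * tensor X \<eta> p)" if \<eta>: "bump_on c d \<eta>" for \<eta>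
  proof -
    have s\<eta>: "smooth \<eta>" using bump_on_smooth[OF \<eta>] .
    have "(LINT x:{a<..<b}|lborel. (LINT y:{c<..<d}|lborel. w (x, y) * deriv \<eta> y) * deriv X x)
      + (LINT y:{c<..<d}|lborel. w (a, y) * deriv \<eta> y) * X a - (LINT y:{c<..<d}|lborel. w (b, y) * deriv \<eta> y) * X b
      = (LINT x:{a<..<b}|lborel. (LINT y:{c<..<d}|lborel. g (x, y) * \<eta> y) * X x)"
    proof (rule bump_extend1[OF ab _ _ _ X])
      show "continuous_on {a..b} (\<lambda>x. LINT y:{c<..<d}|lborel. w (x, y) * deriv \<eta> y)"
        by (rule continuous_on_LINT_mult(1)[OF w sc[OF smooth_deriv[OF s\<eta>]]])
      show "set_integrable lborel {a<..<b} (\<lambda>x. LINT y:{c<..<d}|lborel. g (x, y) * \<eta> y)"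
        by (rule LINT_tensor(4)[OF g sc[OF smooth_const] sc[OF s\<eta>]])
      show "(LINT x:{a<..<b}|lborel. (LINT y:{c<..<d}|lborel. w (x, y) * deriv \<eta> y) * deriv \<psi> x)
          = (LINT x:{a<..<b}|lborel. (LINT y:{c<..<d}|lborel. g (x, y) * \<eta> y) * \<psi> x)"
        if \<psi>: "bump_on a b \<psi>" for \<psi>
        using weak[OF \<psi> \<eta>] bump_on_smooth[OF \<psi>] s\<eta>
        by (simp add: LINT_tensor(2)[OF wL2] LINT_tensor(2)[OF g] sc smooth_deriv)
    qed
    then show ?thesis using s\<eta> X
      by (simp add: LINT_tensor(2)[OF wL2] LINT_tensor(2)[OF g] sc smooth_deriv side0)
  qed
  have "(LINT y:{c<..<d}|lborel. (LINT x:{a<..<b}|lborel. w (x, y) * deriv X x) * deriv Y y)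
      + (LINT x:{a<..<b}|lborel. w (x, c) * deriv X x) * Y c
      - (LINT x:{a<..<b}|lborel. w (x, d) * deriv X x) * Y d
      = (LINT y:{c<..<d}|lborel. (LINT x:{a<..<b}|lborel. g (x, y) * X x) * Y y)"
  proof (rule bump_extend1[OF cd _ _ _ Y])
    show "continuous_on {c..d} (\<lambda>y. LINT x:{a<..<b}|lborel. w (x, y) * deriv X x)"
      by (rule continuous_on_LINT_mult(2)[OF w sc[OF smooth_deriv[OF X]]])
    show "set_integrable lborel {c<..<d} (\<lambda>y. LINT x:{a<..<b}|lborel. g (x, y) * X x)"
      using X by (auto intro!: LINT_tensor(5)[OF _ _ sc[OF smooth_const]] wL2 g sc smooth_deriv)
    show "(LINT y:{c<..<d}|lborel. (LINT x:{a<..<b}|lborel. w (x, y) * deriv X x) * deriv \<eta> y)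
      = (LINT y:{c<..<d}|lborel. (LINT x:{a<..<b}|lborel. g (x, y) * X x) * \<eta> y)" if \<eta>: "bump_on c d \<eta>" for \<eta>
      using x[OF \<eta>] bump_on_smooth[OF \<eta>] X
      by (simp add: LINT_tensor(3)[OF wL2] LINT_tensor(3)[OF g] sc smooth_deriv)
  qed
  then show ?thesis using X Y
    by (simp add: LINT_tensor(3)[OF wL2] LINT_tensor(3)[OF g] sc smooth_deriv)
qed

text \<open>The zeros of \<open>Y\<close> at c and d keep the normal derivative of \<open>w\<close>
  out of the edge terms. In x no derivative is taken, so \<open>X\<close> is arbitrary.\<close>

lemma weak_green_yy:
  assumes weak: "\<And>\<psi> \<eta>. bump_on a b \<psi> \<Longrightarrow> bump_on c d \<eta> \<Longrightarrow>
      (LINT p:{a<..<b} \<times> {c<..<d}|lborel. w p * tensor \<psi> (deriv (deriv \<eta>)) p)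
      = (LINT p:{a<..<b} \<times> {c<..<d}|lborel. g p * tensor \<psi> \<eta> p)"
    and X: "smooth X" and Y: "smooth Y" "Y c = 0" "Y d = 0"
  shows "(LINT p:{a<..<b} \<times> {c<..<d}|lborel. g p * tensor X Y p)
    = (LINT p:{a<..<b} \<times> {c<..<d}|lborel. w p * tensor X (deriv (deriv Y)) p)
      + (LINT x:{a<..<b}|lborel. w (x, c) * X x) * deriv Y c
      - (LINT x:{a<..<b}|lborel. w (x, d) * X x) * deriv Y d"
proof -
  note sc = smooth_continuous_on
  have x: "(LINT p:{a<..<b} \<times> {c<..<d}|lborel. w p * tensor X (deriv (deriv \<eta>)) p)
      = (LINT p:{a<..<b} \<times> {c<..<d}|lborel. g p * tensor X \<eta> p)" if \<eta>: "bump_on c d \<eta>" for \<eta>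
  proof -
    have s\<eta>: "smooth \<eta>" using bump_on_smooth[OF \<eta>] .
    have "(LINT x:{a<..<b}|lborel. (LINT y:{c<..<d}|lborel. w (x, y) * deriv (deriv \<eta>) y) * X x)
      = (LINT x:{a<..<b}|lborel. (LINT y:{c<..<d}|lborel. g (x, y) * \<eta> y) * X x)"
    proof (rule bump_extend0[OF ab _ _ _ X])
      show "set_integrable lborel {a<..<b} (\<lambda>x. LINT y:{c<..<d}|lborel. w (x, y) * deriv (deriv \<eta>) y)"
        "set_integrable lborel {a<..<b} (\<lambda>x. LINT y:{c<..<d}|lborel. g (x, y) * \<eta> y)"
        using s\<eta> by (auto intro!: LINT_tensor(4)[OF _ sc[OF smooth_const]] wL2 g sc smooth_deriv)
      show "(LINT x:{a<..<b}|lborel. (LINT y:{c<..<d}|lborel. w (x, y) * deriv (deriv \<eta>) y) * \<psi> x)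
          = (LINT x:{a<..<b}|lborel. (LINT y:{c<..<d}|lborel. g (x, y) * \<eta> y) * \<psi> x)"
        if \<psi>: "bump_on a b \<psi>" for \<psi>
        using weak[OF \<psi> \<eta>] bump_on_smooth[OF \<psi>] s\<eta>
        by (simp add: LINT_tensor(2)[OF wL2] LINT_tensor(2)[OF g] sc smooth_deriv)
    qed
    then show ?thesis using s\<eta> X
      by (simp add: LINT_tensor(2)[OF wL2] LINT_tensor(2)[OF g] sc smooth_deriv)
  qed
  have "(LINT y:{c<..<d}|lborel. (LINT x:{a<..<b}|lborel. w (x, y) * X x) * deriv (deriv Y) y)
      + (LINT x:{a<..<b}|lborel. w (x, c) * X x) * deriv Y c
      - (LINT x:{a<..<b}|lborel. w (x, d) * X x) * deriv Y d
      = (LINT y:{c<..<d}|lborel. (LINT x:{a<..<b}|lborel. g (x, y) * X x) * Y y)"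
  proof (rule bump_extend2[OF cd _ _ _ Y])
    show "continuous_on {c..d} (\<lambda>y. LINT x:{a<..<b}|lborel. w (x, y) * X x)"
      by (rule continuous_on_LINT_mult(2)[OF w sc[OF X]])
    show "set_integrable lborel {c<..<d} (\<lambda>y. LINT x:{a<..<b}|lborel. g (x, y) * X x)"
      using X by (auto intro!: LINT_tensor(5)[OF _ _ sc[OF smooth_const]] wL2 g sc smooth_deriv)
    show "(LINT y:{c<..<d}|lborel. (LINT x:{a<..<b}|lborel. w (x, y) * X x) * deriv (deriv \<eta>) y)
      = (LINT y:{c<..<d}|lborel. (LINT x:{a<..<b}|lborel. g (x, y) * X x) * \<eta> y)" if \<eta>: "bump_on c d \<eta>" for \<eta>
      using x[OF \<eta>] bump_on_smooth[OF \<eta>] X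
      by (simp add: LINT_tensor(3)[OF wL2] LINT_tensor(3)[OF g] sc smooth_deriv)
  qed
  then show ?thesis using X Y
    by (simp add: LINT_tensor(3)[OF wL2] LINT_tensor(3)[OF g] sc smooth_deriv)
qed

end

section \<open>The plate equation\<close>

lemma set_LINT_cong_AE:
  fixes f g :: "'a \<Rightarrow> real"
  assumes "set_integrable M \<Omega> f" "set_integrable M \<Omega> g" "AE p in M. p \<in> \<Omega> \<longrightarrow> f p = g p"
  shows "(LINT p:\<Omega>|M. f p) = (LINT p:\<Omega>|M. g p)"
  unfolding set_lebesgue_integral_def
proof (rule integral_cong_AE)
  show "AE p in M. indicator \<Omega> p *\<^sub>R f p = indicator \<Omega> p *\<^sub>R g p"
    using assms(3) by eventually_elim (auto split: split_indicator)
qed (use assms(1,2) in \<open>auto simp: set_integrable_def\<close>)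

lemma deriv_sin_cos: "deriv sin = (cos :: real \<Rightarrow> real)" "deriv cos = (\<lambda>x::real. - sin x)"
  by (auto intro!: ext DERIV_imp_deriv derivative_eq_intros)

lemma smooth_funpow_deriv: "smooth f \<Longrightarrow> smooth ((deriv ^^ i) f)"
  by (induction i) (auto intro: smooth_deriv)

section \<open>Weak derivatives of separated functions and their uniqueness\<close>

lemma LINT_tensor_pdx:
  assumes ab: "a < b" and cd: "c < d" and Y: "smooth Y"
  shows "smooth X \<Longrightarrow> test_function ({a<..<b} \<times> {c<..<d}) \<phi> \<Longrightarrow>
    (LINT p:{a<..<b} \<times> {c<..<d}|lborel. tensor X Y p * (pdx ^^ i) \<phi> p)
    = (-1) ^ i * (LINT p:{a<..<b} \<times> {c<..<d}|lborel. tensor ((deriv ^^ i) X) Y p * \<phi> p)"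
proof (induction i arbitrary: X)
  case (Suc i)
  have t: "test_function ({a<..<b} \<times> {c<..<d}) ((pdx ^^ i) \<phi>)"
    using Suc.prems(2) by (induction i) (auto intro: test_function_pd)
  have "(LINT p:{a<..<b} \<times> {c<..<d}|lborel. tensor X Y p * pdx ((pdx ^^ i) \<phi>) p)
    = - (LINT p:{a<..<b} \<times> {c<..<d}|lborel. tensor (deriv X) Y p * (pdx ^^ i) \<phi> p)"
    using Suc.prems Y
    by (intro has_weak_partial_step(1)[OF ab cd _ _ t] continuous_on_tensor smooth_continuous_on)
      (auto intro: smooth_deriv smooth_DERIV DERIV_cmult_right)
  then show ?case using Suc by (simp add: smooth_deriv funpow_swap1)
qed simp

lemma LINT_tensor_pdy:
  assumes ab: "a < b" and cd: "c < d" and X: "smooth X"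
  shows "smooth Y \<Longrightarrow> test_function ({a<..<b} \<times> {c<..<d}) \<phi> \<Longrightarrow>
    (LINT p:{a<..<b} \<times> {c<..<d}|lborel. tensor X Y p * (pdy ^^ i) \<phi> p)
    = (-1) ^ i * (LINT p:{a<..<b} \<times> {c<..<d}|lborel. tensor X ((deriv ^^ i) Y) p * \<phi> p)"
proof (induction i arbitrary: Y)
  case (Suc i)
  have t: "test_function ({a<..<b} \<times> {c<..<d}) ((pdy ^^ i) \<phi>)"
    using Suc.prems(2) by (induction i) (auto intro: test_function_pd)
  have "(LINT p:{a<..<b} \<times> {c<..<d}|lborel. tensor X Y p * pdy ((pdy ^^ i) \<phi>) p)
    = - (LINT p:{a<..<b} \<times> {c<..<d}|lborel. tensor X (deriv Y) p * (pdy ^^ i) \<phi> p)"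
    using Suc.prems X
    by (intro has_weak_partial_step(2)[OF ab cd _ _ t] continuous_on_tensor smooth_continuous_on)
      (auto intro: smooth_deriv smooth_DERIV DERIV_cmult)
  then show ?case using Suc by (simp add: smooth_deriv funpow_swap1)
qed simp

text \<open>In \<open>partial\<close> the x-derivatives are outermost. They are moved over first,
  against the test function \<open>(pdy ^^ j) \<phi>\<close>, and the y-derivatives follow.\<close>

lemma has_weak_partial_tensor:
  assumes ab: "a < b" and cd: "c < d" and XY: "smooth X" "smooth Y"
  shows "has_weak_partial ({a<..<b} \<times> {c<..<d}) i j (tensor X Y) (tensor ((deriv ^^ i) X) ((deriv ^^ j) Y))"
  unfolding has_weak_partial_def
proof (intro allI impI)
  fix \<phi> assume \<phi>: "test_function ({a<..<b} \<times> {c<..<d}) \<phi>"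
  have "test_function ({a<..<b} \<times> {c<..<d}) ((pdy ^^ j) \<phi>)"
    using \<phi> by (induction j) (auto intro: test_function_pd)
  from LINT_tensor_pdx[OF ab cd XY(2,1) this] LINT_tensor_pdy[OF ab cd smooth_funpow_deriv[OF XY(1)] XY(2) \<phi>]
  show "(LINT p:{a<..<b} \<times> {c<..<d}|lborel. tensor X Y p * partial i j \<phi> p) =
      (-1) ^ (i + j) * (LINT p:{a<..<b} \<times> {c<..<d}|lborel. tensor ((deriv ^^ i) X) ((deriv ^^ j) Y) p * \<phi> p)"
    by (simp add: partial_def power_add)
qed

lemma tensor_L2: "smooth X \<Longrightarrow> smooth Y \<Longrightarrow> tensor X Y \<in> L2_space ({a<..<b} \<times> {c<..<d})"
  by (intro L2_space_continuous continuous_on_tensor smooth_continuous_on)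

lemma tensor_sobolev:
  assumes "a < b" "c < d" "smooth X" "smooth Y"
  shows "tensor X Y \<in> sobolev_H k ({a<..<b} \<times> {c<..<d})"
  unfolding sobolev_H_def
proof (intro CollectI conjI allI impI bexI)
  show "has_weak_partial ({a<..<b} \<times> {c<..<d}) i j (tensor X Y) (tensor ((deriv ^^ i) X) ((deriv ^^ j) Y))" for i j
    by (rule has_weak_partial_tensor[OF assms])
qed (intro tensor_L2 smooth_funpow_deriv assms)+

lemma weak_partial_sobolev:
  assumes "u \<in> sobolev_H k \<Omega>" "i + j \<le> k"
  shows "weak_partial \<Omega> i j u \<in> L2_space \<Omega>" "has_weak_partial \<Omega> i j u (weak_partial \<Omega> i j u)"
proof -
  have "\<exists>g. g \<in> L2_space \<Omega> \<and> has_weak_partial \<Omega> i j u g"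
    using assms unfolding sobolev_H_def by blast
  from someI_ex[OF this]
  show "weak_partial \<Omega> i j u \<in> L2_space \<Omega>" "has_weak_partial \<Omega> i j u (weak_partial \<Omega> i j u)"
    by (simp_all add: weak_partial_def)
qed

text \<open>\<open>weak_partial\<close> is an unspecified choice, so a concrete derivative can
  replace it only almost everywhere and only through uniqueness. Products of bumps already separate
  the candidates.\<close>

lemma has_weak_partial_unique:
  assumes g: "g \<in> L2_space ({a<..<b} \<times> {c<..<d})" "h \<in> L2_space ({a<..<b} \<times> {c<..<d})"
    and w: "has_weak_partial ({a<..<b} \<times> {c<..<d}) i j u g" "has_weak_partial ({a<..<b} \<times> {c<..<d}) i j u h"
  shows "AE p in lborel. p \<in> {a<..<b} \<times> {c<..<d} \<longrightarrow> g p = h p"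
proof -
  let ?Q = "{a<..<b} \<times> {c<..<d}"
  have gh: "(\<lambda>p. g p - h p) \<in> L2_space ?Q" using L2_space_diff[OF g] .
  have one: "(\<lambda>_. 1) \<in> L2_space ?Q"
    by (intro L2_space_continuous continuous_intros)
  have i: "set_integrable lborel ?Q (\<lambda>p. g p - h p)"
    using L2_space_mult[OF gh one] by simp
  have orth: "(LINT p:?Q|lborel. (g p - h p) * tensor \<psi> \<eta> p) = 0"
    if "bump_on a b \<psi>" "bump_on c d \<eta>" for \<psi> \<eta>
  proof -
    have s: "smooth \<psi>" "smooth \<eta>" using that bump_on_smooth by auto
    have "(-1) ^ (i + j) * (LINT p:?Q|lborel. g p * tensor \<psi> \<eta> p)
        = (-1) ^ (i + j) * (LINT p:?Q|lborel. h p * tensor \<psi> \<eta> p)"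
      using w(1)[unfolded has_weak_partial_def, rule_format, OF test_function_tensor[OF that]]
        w(2)[unfolded has_weak_partial_def, rule_format, OF test_function_tensor[OF that]]
      by (rule trans[OF sym])
    then have "(LINT p:?Q|lborel. g p * tensor \<psi> \<eta> p) = (LINT p:?Q|lborel. h p * tensor \<psi> \<eta> p)"
      by simp
    moreover have "set_integrable lborel ?Q (\<lambda>p. g p * tensor \<psi> \<eta> p)" "set_integrable lborel ?Q (\<lambda>p. h p * tensor \<psi> \<eta> p)"
      by (intro L2_space_mult g tensor_L2 s)+
    ultimately show ?thesis by (simp add: left_diff_distrib set_integral_diff)
  qed
  have "AE p in lborel. p \<in> ?Q \<longrightarrow> g p - h p = 0"
    by (rule orthogonal_to_bumps_imp_AE_0[OF i orth])
  then show ?thesis by eventually_elim auto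
qed

lemma weak_partial_tensor_AE:
  assumes "a < b" "c < d" "smooth X" "smooth Y"
  shows "AE p in lborel. p \<in> {a<..<b} \<times> {c<..<d} \<longrightarrow>
    weak_partial ({a<..<b} \<times> {c<..<d}) i j (tensor X Y) p = tensor ((deriv ^^ i) X) ((deriv ^^ j) Y) p"
proof (rule has_weak_partial_unique)
  have s: "tensor X Y \<in> sobolev_H (i + j) ({a<..<b} \<times> {c<..<d})" by (rule tensor_sobolev[OF assms])
  show "weak_partial ({a<..<b} \<times> {c<..<d}) i j (tensor X Y) \<in> L2_space ({a<..<b} \<times> {c<..<d})"
    "has_weak_partial ({a<..<b} \<times> {c<..<d}) i j (tensor X Y) (weak_partial ({a<..<b} \<times> {c<..<d}) i j (tensor X Y))"
    using weak_partial_sobolev[OF s order_refl] by blast+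
qed (intro has_weak_partial_tensor tensor_L2 smooth_funpow_deriv assms)+

lemma closure_plate: "l > 0 \<Longrightarrow> closure (plate l) = {0..pi} \<times> {-l..l}"
  by (simp add: plate_def closure_Times)

text \<open>The energy density at a point, isolated so that symmetry, polarisation and coercivity
  become algebra in real numbers.\<close>

definition plate_form :: "real \<Rightarrow> real \<Rightarrow> real \<Rightarrow> real \<Rightarrow> real \<Rightarrow> real \<Rightarrow> real \<Rightarrow> real" where
  "plate_form \<sigma> uxx uxy uyy vxx vxy vyy =
    (uxx + uyy) * (vxx + vyy) + (1 - \<sigma>) * (2 * uxy * vxy - uxx * vyy - uyy * vxx)"

lemma plate_form_integrable:
  assumes "uxx \<in> L2_space \<Omega>" "uxy \<in> L2_space \<Omega>" "uyy \<in> L2_space \<Omega>"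
    "vxx \<in> L2_space \<Omega>" "vxy \<in> L2_space \<Omega>" "vyy \<in> L2_space \<Omega>"
  shows "set_integrable lborel \<Omega> (\<lambda>p. plate_form \<sigma> (uxx p) (uxy p) (uyy p) (vxx p) (vxy p) (vyy p))"
proof -
  have "set_integrable lborel \<Omega> (\<lambda>p. (uxx p * vxx p + uyy p * vyy p)
     + (\<sigma> * (uxx p * vyy p) + \<sigma> * (uyy p * vxx p)) + (2 * (1 - \<sigma>)) * (uxy p * vxy p))"
    by (intro set_integral_add(1) set_integrable_mult_right L2_space_mult assms)
  then show ?thesis
    by (rule subst[where P="set_integrable lborel \<Omega>", rotated]) (auto simp: plate_form_def algebra_simps)
qed

lemma plate_inner_eq:
  "plate_inner l \<sigma> u v = (LINT p:plate l|lborel. plate_form \<sigma>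
     (weak_partial (plate l) 2 0 u p) (weak_partial (plate l) 1 1 u p) (weak_partial (plate l) 0 2 u p)
     (weak_partial (plate l) 2 0 v p) (weak_partial (plate l) 1 1 v p) (weak_partial (plate l) 0 2 v p))"
  by (simp add: plate_inner_def Let_def plate_form_def)

lemma plate_inner_commute: "plate_inner l \<sigma> u v = plate_inner l \<sigma> v u"
  by (simp add: plate_inner_eq plate_form_def algebra_simps)

text \<open>Transfers the weak derivatives of \<open>v\<close> to the representative that is
  continuous up to the boundary; the two agree almost everywhere, so the integrals against test
  functions are the same. Boundary values are then available together with the weak
  relations.\<close>

lemma H2_starE:
  assumes l: "l > 0" and v: "v \<in> H2_star l"
  obtains w where "continuous_on ({0..pi} \<times> {-l..l}) w" "AE p in lborel. p \<in> plate l \<longrightarrow> v p = w p"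
    "\<And>y. y \<in> {-l<..<l} \<Longrightarrow> w (0, y) = 0" "\<And>y. y \<in> {-l<..<l} \<Longrightarrow> w (pi, y) = 0"
    "\<And>i j \<psi> \<eta>. i + j \<le> 2 \<Longrightarrow> bump_on 0 pi \<psi> \<Longrightarrow> bump_on (-l) l \<eta> \<Longrightarrow>
      (LINT p:plate l|lborel. w p * partial i j (tensor \<psi> \<eta>) p)
      = (-1) ^ (i + j) * (LINT p:plate l|lborel. weak_partial (plate l) i j v p * tensor \<psi> \<eta> p)"
proof -
  obtain w where w: "continuous_on ({0..pi} \<times> {-l..l}) w" "AE p in lborel. p \<in> plate l \<longrightarrow> v p = w p"
    "\<And>y. y \<in> {-l<..<l} \<Longrightarrow> w (0, y) = 0" "\<And>y. y \<in> {-l<..<l} \<Longrightarrow> w (pi, y) = 0"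
    using v unfolding H2_star_def closure_plate[OF l] by auto
  have vs: "v \<in> sobolev_H 2 (plate l)" using v by (simp add: H2_star_def)
  then have vL2: "v \<in> L2_space (plate l)" by (simp add: sobolev_H_def)
  have "(LINT p:plate l|lborel. w p * partial i j (tensor \<psi> \<eta>) p)
      = (-1) ^ (i + j) * (LINT p:plate l|lborel. weak_partial (plate l) i j v p * tensor \<psi> \<eta> p)"
    if ij: "i + j \<le> 2" and b: "bump_on 0 pi \<psi>" "bump_on (-l) l \<eta>" for i j \<psi> \<eta>
  proof -
    have t: "test_function (plate l) (tensor \<psi> \<eta>)"
      unfolding plate_def by (rule test_function_tensor[OF b])
    have "test_function (plate l) ((pdx ^^ i) ((pdy ^^ j) (tensor \<psi> \<eta>)))"
    proof -
      have "test_function (plate l) ((pdy ^^ j) (tensor \<psi> \<eta>))"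
        using t by (induction j) (auto intro: test_function_pd)
      then show ?thesis by (induction i) (auto intro: test_function_pd)
    qed
    then have pc: "partial i j (tensor \<psi> \<eta>) \<in> L2_space (plate l)"
      unfolding partial_def plate_def
      by (intro L2_space_continuous test_function_continuous_on[where \<Omega>="plate l"]) (simp add: plate_def)
    have "(LINT p:plate l|lborel. w p * partial i j (tensor \<psi> \<eta>) p)
        = (LINT p:plate l|lborel. v p * partial i j (tensor \<psi> \<eta>) p)"
    proof (rule set_LINT_cong_AE)
      have "w \<in> L2_space (plate l)" unfolding plate_def by (rule L2_space_continuous[OF w(1)])
      with vL2 show "set_integrable lborel (plate l) (\<lambda>p. w p * partial i j (tensor \<psi> \<eta>) p)"
        "set_integrable lborel (plate l) (\<lambda>p. v p * partial i j (tensor \<psi> \<eta>) p)"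
        by (simp_all add: L2_space_mult pc)
      show "AE p in lborel. p \<in> plate l \<longrightarrow> w p * partial i j (tensor \<psi> \<eta>) p = v p * partial i j (tensor \<psi> \<eta>) p"
        using w(2) by eventually_elim auto
    qed
    also have "\<dots> = (-1) ^ (i + j) * (LINT p:plate l|lborel. weak_partial (plate l) i j v p * tensor \<psi> \<eta> p)"
      by (rule weak_partial_sobolev(2)[OF vs ij, unfolded has_weak_partial_def, rule_format, OF t])
    finally show ?thesis .
  qed
  with w show ?thesis by (rule that)
qed

text \<open>For U = \<phi>(y) sin x the separated energy integral is moved entirely onto \<phi> by
  the three Green formulas. The two edge conditions are exactly what makes the boundary terms
  disappear, and the interior terms add up to the left side of the differential equation.\<close>

lemma plate_inner_separated:
  assumes l: "l > 0" and v: "v \<in> H2_star l" and \<phi>: "smooth \<phi>"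
    and ode: "\<And>y. (deriv ^^ 4) \<phi> y - 2 * (deriv ^^ 2) \<phi> y + \<phi> y = f y"
    and bc2: "\<And>y. y \<in> {-l, l} \<Longrightarrow> (deriv ^^ 2) \<phi> y = \<sigma> * \<phi> y"
    and bc3: "\<And>y. y \<in> {-l, l} \<Longrightarrow> (deriv ^^ 3) \<phi> y = (2 - \<sigma>) * deriv \<phi> y"
  shows "plate_inner l \<sigma> (tensor sin \<phi>) v = (LINT p:plate l|lborel. tensor sin f p * v p)"
proof -
  define \<phi>1 \<phi>2 \<phi>3 \<phi>4 where ds: "\<phi>1 = deriv \<phi>" "\<phi>2 = deriv \<phi>1" "\<phi>3 = deriv \<phi>2" "\<phi>4 = deriv \<phi>3"
  have s: "smooth \<phi>" "smooth \<phi>1" "smooth \<phi>2" "smooth \<phi>3" "smooth \<phi>4"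
    using \<phi> by (simp_all add: ds smooth_deriv)
  have D: "(\<phi> has_real_derivative \<phi>1 y) (at y)" "(\<phi>1 has_real_derivative \<phi>2 y) (at y)"
    "(\<phi>2 has_real_derivative \<phi>3 y) (at y)" "(\<phi>3 has_real_derivative \<phi>4 y) (at y)" for y
    using s smooth_DERIV unfolding ds by blast+
  have iter: "(deriv ^^ 2) \<phi> = \<phi>2" "(deriv ^^ 3) \<phi> = \<phi>3" "(deriv ^^ 4) \<phi> = \<phi>4"
    by (simp_all add: ds eval_nat_numeral)
  obtain w where w: "continuous_on ({0..pi} \<times> {-l..l}) w" and vw: "AE p in lborel. p \<in> plate l \<longrightarrow> v p = w p"
    and w0: "\<And>y. y \<in> {-l<..<l} \<Longrightarrow> w (0, y) = 0" "\<And>y. y \<in> {-l<..<l} \<Longrightarrow> w (pi, y) = 0"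
    and weak: "\<And>i j \<psi> \<eta>. i + j \<le> 2 \<Longrightarrow> bump_on 0 pi \<psi> \<Longrightarrow> bump_on (-l) l \<eta> \<Longrightarrow>
      (LINT p:plate l|lborel. w p * partial i j (tensor \<psi> \<eta>) p)
      = (-1) ^ (i + j) * (LINT p:plate l|lborel. weak_partial (plate l) i j v p * tensor \<psi> \<eta> p)"
    by (rule H2_starE[OF l v]) (rule that)
  have vs: "v \<in> sobolev_H 2 (plate l)" using v by (simp add: H2_star_def)
  have wL2: "w \<in> L2_space (plate l)" unfolding plate_def by (rule L2_space_continuous[OF w])
  have vL2: "v \<in> L2_space (plate l)" using vs by (simp add: sobolev_H_def)
  define vxx vxy vyy where v_def: "vxx = weak_partial (plate l) 2 0 v"
    "vxy = weak_partial (plate l) 1 1 v" "vyy = weak_partial (plate l) 0 2 v"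
  have vL: "vxx \<in> L2_space (plate l)" "vxy \<in> L2_space (plate l)" "vyy \<in> L2_space (plate l)"
    unfolding v_def by (rule weak_partial_sobolev(1)[OF vs]; simp)+
  have tL: "tensor X Y \<in> L2_space (plate l)" if "smooth X" "smooth Y" for X Y
    unfolding plate_def using that by (rule tensor_L2)
  \<comment> \<open>Coefficients of v_xx, v_xy and v_yy once U_xx = - \<phi> sin, U_xy = \<phi>' cos
    and U_yy = \<phi>'' sin are inserted: U_xx + \<sigma> U_yy, 2 (1 - \<sigma>) U_xy and U_yy +
    \<sigma> U_xx, without the factor in x.\<close>
  define A B C where ABC: "A = (\<lambda>y. \<sigma> * \<phi>2 y - \<phi> y)" "B = (\<lambda>y. 2 * (1 - \<sigma>) * \<phi>1 y)"
    "C = (\<lambda>y. \<phi>2 y - \<sigma> * \<phi> y)"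
  have sABC: "smooth A" "smooth B" "smooth C"
    unfolding ABC by (intro smooth_diff smooth_mult smooth_const s)+
  have dB: "deriv B = (\<lambda>y. 2 * (1 - \<sigma>) * \<phi>2 y)"
    unfolding ABC by (rule ext, rule DERIV_imp_deriv) (auto intro!: derivative_eq_intros D)
  have dC: "deriv C = (\<lambda>y. \<phi>3 y - \<sigma> * \<phi>1 y)"
    unfolding ABC by (rule ext, rule DERIV_imp_deriv) (auto intro!: derivative_eq_intros D)
  have ddC: "deriv (deriv C) = (\<lambda>y. \<phi>4 y - \<sigma> * \<phi>2 y)"
    unfolding dC by (rule ext, rule DERIV_imp_deriv) (auto intro!: derivative_eq_intros D)
  have pl: "0 < pi" "-l < l" using l by auto
  note ss = smooth_sin_cos
  \<comment> \<open>The trace of \<open>w\<close> on a horizontal line, paired with sin. Every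
    surviving boundary term is a multiple of it at an edge.\<close>
  let ?V = "\<lambda>y. LINT x:{0<..<pi}|lborel. w (x, y) * sin x"
  have xx: "(LINT p:plate l|lborel. vxx p * tensor sin A p) = (LINT p:plate l|lborel. w p * tensor (deriv (deriv sin)) A p)"
    unfolding plate_def
  proof (rule weak_green_xx[OF pl w w0 vL(1)[unfolded plate_def] _ ss(1) _ _ sABC(1)])
    show "(LINT p:{0<..<pi} \<times> {-l<..<l}|lborel. w p * tensor (deriv (deriv \<psi>)) \<eta> p)
      = (LINT p:{0<..<pi} \<times> {-l<..<l}|lborel. vxx p * tensor \<psi> \<eta> p)"
      if b: "bump_on 0 pi \<psi>" "bump_on (-l) l \<eta>" for \<psi> \<eta>
      using weak[OF _ b, of 2 0] by (simp add: partial_tensor bump_on_smooth[OF b(1)] bump_on_smooth[OF b(2)] v_def plate_def)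
  qed simp_all
  have xy: "(LINT p:plate l|lborel. vxy p * tensor cos B p)
    = (LINT p:plate l|lborel. w p * tensor (deriv cos) (deriv B) p) - ?V (-l) * B (-l) + ?V l * B l"
  proof -
    have "(LINT p:plate l|lborel. vxy p * tensor cos B p)
    = (LINT p:plate l|lborel. w p * tensor (deriv cos) (deriv B) p)
      + (LINT x:{0<..<pi}|lborel. w (x, -l) * deriv cos x) * B (-l)
      - (LINT x:{0<..<pi}|lborel. w (x, l) * deriv cos x) * B l"
      unfolding plate_def
    proof (rule weak_green_xy[OF pl w w0 vL(2)[unfolded plate_def] _ ss(2) sABC(2)])
      show "(LINT p:{0<..<pi} \<times> {-l<..<l}|lborel. w p * tensor (deriv \<psi>) (deriv \<eta>) p)
        = (LINT p:{0<..<pi} \<times> {-l<..<l}|lborel. vxy p * tensor \<psi> \<eta> p)"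
        if b: "bump_on 0 pi \<psi>" "bump_on (-l) l \<eta>" for \<psi> \<eta>
        using weak[OF _ b, of 1 1] partial_tensor(2)[OF bump_on_smooth[OF b(1)] bump_on_smooth[OF b(2)]]
        by (simp add: v_def plate_def)
    qed
    moreover have "(LINT x:{0<..<pi}|lborel. w (x, y) * deriv cos x) = - ?V y" for y
      using set_integral_mult_right[of lborel "{0<..<pi}" "-1" "\<lambda>x. w (x, y) * sin x"]
      by (simp add: deriv_sin_cos)
    ultimately show ?thesis by simp
  qed
  have yy: "(LINT p:plate l|lborel. vyy p * tensor sin C p)
    = (LINT p:plate l|lborel. w p * tensor sin (deriv (deriv C)) p) + ?V (-l) * deriv C (-l) - ?V l * deriv C l"
    unfolding plate_def
  proof (rule weak_green_yy[OF pl w w0 vL(3)[unfolded plate_def] _ ss(1) sABC(3)])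
    show "(LINT p:{0<..<pi} \<times> {-l<..<l}|lborel. w p * tensor \<psi> (deriv (deriv \<eta>)) p)
      = (LINT p:{0<..<pi} \<times> {-l<..<l}|lborel. vyy p * tensor \<psi> \<eta> p)"
      if b: "bump_on 0 pi \<psi>" "bump_on (-l) l \<eta>" for \<psi> \<eta>
      using weak[OF _ b, of 0 2] by (simp add: partial_tensor bump_on_smooth[OF b(1)] bump_on_smooth[OF b(2)] v_def plate_def)
    show "C (-l) = 0" "C l = 0" using bc2 unfolding iter ABC by auto
  qed
  \<comment> \<open>The second edge condition in the form needed: the edge terms from v_xy carry
    \<open>B\<close>, those from v_yy carry the derivative of \<open>C\<close> with the opposite
    sign, so they cancel.\<close>
  have bd: "B y = deriv C y" if "y \<in> {-l, l}" for y
  proof -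
    have "\<phi>3 y = (2 - \<sigma>) * \<phi>1 y"
      using bc3[OF that] unfolding iter ds(1)[symmetric] .
    then show ?thesis unfolding dC unfolding ABC(2) by (simp add: algebra_simps)
  qed
  have U: "AE p in lborel. p \<in> plate l \<longrightarrow> weak_partial (plate l) 2 0 (tensor sin \<phi>) p = tensor (deriv (deriv sin)) \<phi> p"
    "AE p in lborel. p \<in> plate l \<longrightarrow> weak_partial (plate l) 1 1 (tensor sin \<phi>) p = tensor (deriv sin) \<phi>1 p"
    "AE p in lborel. p \<in> plate l \<longrightarrow> weak_partial (plate l) 0 2 (tensor sin \<phi>) p = tensor sin \<phi>2 p"
    using weak_partial_tensor_AE[OF pl ss(1) s(1), of 2 0] weak_partial_tensor_AE[OF pl ss(1) s(1), of 1 1]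
      weak_partial_tensor_AE[OF pl ss(1) s(1), of 0 2]
    by (simp_all add: plate_def eval_nat_numeral ds)
  have Us: "tensor sin \<phi> \<in> sobolev_H 2 (plate l)"
    unfolding plate_def by (rule tensor_sobolev[OF pl ss(1) s(1)])
  have "plate_inner l \<sigma> (tensor sin \<phi>) v
    = (LINT p:plate l|lborel. vxx p * tensor sin A p + vxy p * tensor cos B p + vyy p * tensor sin C p)"
    unfolding plate_inner_eq v_def[symmetric]
  proof (rule set_LINT_cong_AE)
    show "set_integrable lborel (plate l) (\<lambda>p. vxx p * tensor sin A p + vxy p * tensor cos B p + vyy p * tensor sin C p)"
      by (intro set_integral_add(1) L2_space_mult vL tL ss sABC)
    show "set_integrable lborel (plate l) (\<lambda>p. plate_form \<sigma>
     (weak_partial (plate l) 2 0 (tensor sin \<phi>) p) (weak_partial (plate l) 1 1 (tensor sin \<phi>) p)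
     (weak_partial (plate l) 0 2 (tensor sin \<phi>) p) (vxx p) (vxy p) (vyy p))"
      by (intro plate_form_integrable vL weak_partial_sobolev(1)[OF Us]) simp_all
    show "AE p in lborel. p \<in> plate l \<longrightarrow> plate_form \<sigma>
     (weak_partial (plate l) 2 0 (tensor sin \<phi>) p) (weak_partial (plate l) 1 1 (tensor sin \<phi>) p)
     (weak_partial (plate l) 0 2 (tensor sin \<phi>) p) (vxx p) (vxy p) (vyy p)
     = vxx p * tensor sin A p + vxy p * tensor cos B p + vyy p * tensor sin C p"
      using U
      by eventually_elim (auto simp: plate_form_def tensor_def case_prod_unfold deriv_sin_cos ABC algebra_simps)
  qed
  also have "\<dots> = (LINT p:plate l|lborel. vxx p * tensor sin A p) + (LINT p:plate l|lborel. vxy p * tensor cos B p)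
      + (LINT p:plate l|lborel. vyy p * tensor sin C p)"
    by (simp add: set_integral_add L2_space_mult vL tL ss sABC)
  also have "\<dots> = (LINT p:plate l|lborel. w p * tensor (deriv (deriv sin)) A p)
      + (LINT p:plate l|lborel. w p * tensor (deriv cos) (deriv B) p)
      + (LINT p:plate l|lborel. w p * tensor sin (deriv (deriv C)) p)"
    unfolding xx xy yy using bd[of l] bd[of "-l"] by simp
  also have "\<dots> = (LINT p:plate l|lborel. w p * tensor (deriv (deriv sin)) A p
      + w p * tensor (deriv cos) (deriv B) p + w p * tensor sin (deriv (deriv C)) p)"
    by (simp add: set_integral_add L2_space_mult wL2 tL ss sABC smooth_deriv)
  also have "\<dots> = (LINT p:plate l|lborel. tensor sin f p * w p)"
  proof -
    \<comment> \<open>All three terms carry sin x; the factors - A, - B' and C'' sum to \<phi>'''' -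
      2 \<phi>'' + \<phi>, and \<sigma> drops out.\<close>
    have "w p * tensor (deriv (deriv sin)) A p + w p * tensor (deriv cos) (deriv B) p
        + w p * tensor sin (deriv (deriv C)) p = tensor sin f p * w p" for p
      unfolding tensor_def case_prod_unfold deriv_sin_cos dB ddC ode[symmetric] iter
      unfolding ABC by (simp add: algebra_simps)
    then show ?thesis by simp
  qed
  also have "\<dots> = (LINT p:plate l|lborel. tensor sin f p * v p)"
  proof (rule set_LINT_cong_AE)
    have "smooth (\<lambda>y. \<phi>4 y - 2 * \<phi>2 y + \<phi> y)"
      by (intro smooth_add smooth_diff smooth_mult smooth_const s)
    then have "smooth f" using ode unfolding iter by simp
    then show "set_integrable lborel (plate l) (\<lambda>p. tensor sin f p * w p)"
      "set_integrable lborel (plate l) (\<lambda>p. tensor sin f p * v p)"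
      by (intro L2_space_mult tL ss wL2 vL2; assumption)+
    show "AE p in lborel. p \<in> plate l \<longrightarrow> tensor sin f p * w p = tensor sin f p * v p"
      using vw by eventually_elim auto
  qed
  finally show ?thesis .
qed

section \<open>Uniqueness of the plate solution\<close>

lemma zero_of_tensor_moments_zero:
  fixes w :: "real \<times> real \<Rightarrow> real"
  assumes ab: "a < b" and cd: "c < d" and w: "continuous_on ({a..b} \<times> {c..d}) w"
    and mom: "\<And>k m. (LINT p:{a<..<b} \<times> {c<..<d}|lborel. w p * tensor (\<lambda>x. x ^ k) (\<lambda>y. y ^ m) p) = 0"
    and p: "x \<in> {a..b}" "y \<in> {c..d}"
  shows "w (x, y) = 0"
proof (rule zero_of_moments_zero[OF ab _ _ p(1)])
  show "continuous_on {a..b} (\<lambda>x. w (x, y))"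
    by (rule continuous_on_compose2[OF w]) (use p(2) in \<open>auto intro!: continuous_intros\<close>)
  fix k
  have c: "continuous_on UNIV (\<lambda>x::real. x ^ k)" for k by (intro continuous_intros)
  show "(LINT x:{a<..<b}|lborel. w (x, y) * x ^ k) = 0"
  proof (rule zero_of_moments_zero[OF cd _ _ p(2)])
    show "continuous_on {c..d} (\<lambda>y. LINT x:{a<..<b}|lborel. w (x, y) * x ^ k)"
      by (rule continuous_on_LINT_mult(2)[OF w c])
    show "(LINT y:{c<..<d}|lborel. (LINT x:{a<..<b}|lborel. w (x, y) * x ^ k) * y ^ m) = 0" for m
      using mom[of k m] LINT_tensor(3)[OF L2_space_continuous[OF w] c c] by simp
  qed
qed

lemma plate_form_diff:
  "plate_form \<sigma> (a - a') (b - b') (c - c') (a - a') (b - b') (c - c')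
    = plate_form \<sigma> a b c a b c - 2 * plate_form \<sigma> a b c a' b' c' + plate_form \<sigma> a' b' c' a' b' c'"
  by (simp add: plate_form_def algebra_simps)

text \<open>The quadratic form is (1 - \<sigma>) a^2 + (1 - \<sigma>) c^2 + \<sigma> (a + c)^2 + 2
  (1 - \<sigma>) b^2, a sum of nonnegative terms for 0 < \<sigma> < 1. Only a^2 is kept, because
  uniqueness works with the xx derivative alone.\<close>

lemma plate_form_ge:
  assumes "0 < \<sigma>" "\<sigma> < 1"
  shows "plate_form \<sigma> a b c a b c \<ge> (1 - \<sigma>) * a\<^sup>2"
proof -
  have "plate_form \<sigma> a b c a b c = (1 - \<sigma>) * a\<^sup>2 + (1 - \<sigma>) * c\<^sup>2 + \<sigma> * (a + c)\<^sup>2 + 2 * (1 - \<sigma>) * b\<^sup>2"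
    by (simp add: plate_form_def power2_eq_square algebra_simps)
  moreover have "0 \<le> (1 - \<sigma>) * c\<^sup>2" "0 \<le> \<sigma> * (a + c)\<^sup>2" "0 \<le> 2 * (1 - \<sigma>) * b\<^sup>2"
    using assms by simp_all
  ultimately show ?thesis by linarith
qed

text \<open>Testing both equations with a solution gives energy 0 for the difference, hence equal xx
  derivatives almost everywhere. The difference of the continuous representatives then has weak xx
  derivative 0 and vanishes on the hinged sides, so Green's formula makes all its moments
  zero.\<close>

lemma plate_solution_unique:
  assumes l: "l > 0" and \<sigma>: "0 < \<sigma>" "\<sigma> < 1"
    and u: "plate_solution l \<sigma> f u" and U: "plate_solution l \<sigma> f U"
    and p: "p \<in> closure (plate l)"
  shows "u p = U p"
proof -
  let ?W = "weak_partial (plate l)"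
  have H: "u \<in> H2_star l" "U \<in> H2_star l" using u U by (simp_all add: plate_solution_def)
  have S: "u \<in> sobolev_H 2 (plate l)" "U \<in> sobolev_H 2 (plate l)" using H by (simp_all add: H2_star_def)
  have L2: "?W i j u \<in> L2_space (plate l)" "?W i j U \<in> L2_space (plate l)" if "i + j \<le> 2" for i j
    using weak_partial_sobolev(1)[OF S(1) that] weak_partial_sobolev(1)[OF S(2) that] by auto
  note L = L2[of 2 0, simplified] L2[of 1 1, simplified] L2[of 0 2, simplified]
  \<comment> \<open>Built from differences of the chosen weak derivatives rather than from the weak
    derivatives of u - U, since the choice behind \<open>weak_partial\<close> need not be
    linear.\<close>
  define q where "q p = plate_form \<sigma> (?W 2 0 u p - ?W 2 0 U p) (?W 1 1 u p - ?W 1 1 U p) (?W 0 2 u p - ?W 0 2 U p)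
     (?W 2 0 u p - ?W 2 0 U p) (?W 1 1 u p - ?W 1 1 U p) (?W 0 2 u p - ?W 0 2 U p)" for p
  have qi: "set_integrable lborel (plate l) q"
    unfolding q_def by (intro plate_form_integrable L2_space_diff L2) simp_all
  have "(LINT p:plate l|lborel. q p) = plate_inner l \<sigma> u u - 2 * plate_inner l \<sigma> u U + plate_inner l \<sigma> U U"
    unfolding q_def plate_form_diff plate_inner_eq
    by (subst set_integral_add set_integral_diff,
        (intro set_integral_diff(1) set_integrable_mult_right plate_form_integrable L2; simp)+)+
      simp
  also have "\<dots> = 0"
  proof -
    have "plate_inner l \<sigma> u u = plate_inner l \<sigma> U u" "plate_inner l \<sigma> u U = plate_inner l \<sigma> U U"
      using u U H by (simp_all add: plate_solution_def)
    then show ?thesis using plate_inner_commute[of l \<sigma> u U] by simp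
  qed
  finally have "integral\<^sup>L lborel (\<lambda>p. indicator (plate l) p *\<^sub>R q p) = 0"
    by (simp add: set_lebesgue_integral_def)
  moreover have qge: "(1 - \<sigma>) * (?W 2 0 u p - ?W 2 0 U p)\<^sup>2 \<le> q p" for p
    unfolding q_def by (rule plate_form_ge[OF \<sigma>])
  then have "0 \<le> q p" for p
    using \<sigma> by (intro order_trans[OF _ qge]) simp
  ultimately have "AE p in lborel. indicator (plate l) p *\<^sub>R q p = 0"
    using integral_nonneg_eq_0_iff_AE[OF qi[unfolded set_integrable_def]] by simp
  then have xx: "AE p in lborel. p \<in> plate l \<longrightarrow> ?W 2 0 u p = ?W 2 0 U p"
  proof eventually_elim
    case (elim p)
    then show ?case using qge[of p] \<sigma> by (auto simp: mult_le_0_iff split: split_indicator)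
  qed
  \<comment> \<open>The hinged condition is imposed on some continuous representative. As a solution
    is itself continuous on the closure, it coincides with that representative at every point,
    including those on the free edges.\<close>
  have rep: "\<exists>w. continuous_on ({0..pi} \<times> {-l..l}) w \<and> (\<forall>p\<in>closure (plate l). v p = w p) \<and>
      (\<forall>y\<in>{-l<..<l}. w (0, y) = 0 \<and> w (pi, y) = 0) \<and>
      (\<forall>\<psi> \<eta>. bump_on 0 pi \<psi> \<longrightarrow> bump_on (-l) l \<eta> \<longrightarrow>
        (LINT p:plate l|lborel. w p * tensor (deriv (deriv \<psi>)) \<eta> p)
        = (LINT p:plate l|lborel. ?W 2 0 v p * tensor \<psi> \<eta> p))"
    if v: "v \<in> H2_star l" "continuous_on (closure (plate l)) v" for v
  proof -
    obtain w where w: "continuous_on ({0..pi} \<times> {-l..l}) w"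
      "AE p in lborel. p \<in> plate l \<longrightarrow> v p = w p"
      "\<And>y. y \<in> {-l<..<l} \<Longrightarrow> w (0, y) = 0" "\<And>y. y \<in> {-l<..<l} \<Longrightarrow> w (pi, y) = 0"
      "\<And>i j \<psi> \<eta>. i + j \<le> 2 \<Longrightarrow> bump_on 0 pi \<psi> \<Longrightarrow> bump_on (-l) l \<eta> \<Longrightarrow>
      (LINT p:plate l|lborel. w p * partial i j (tensor \<psi> \<eta>) p)
      = (-1) ^ (i + j) * (LINT p:plate l|lborel. weak_partial (plate l) i j v p * tensor \<psi> \<eta> p)"
      by (rule H2_starE[OF l v(1)]) (rule that)
    have "v p = w p" if p: "p \<in> closure (plate l)" for p
    proof -
      have "v p - w p = 0"
      proof (rule continuous_AE_0_imp_0[OF _ _ _ p])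
        show "open (plate l)" unfolding plate_def by (intro open_Times) auto
        show "continuous_on (closure (plate l)) (\<lambda>p. v p - w p)"
          using v(2) w(1) by (intro continuous_intros) (simp_all add: closure_plate[OF l])
        show "AE p in lborel. p \<in> plate l \<longrightarrow> v p - w p = 0" using w(2) by eventually_elim simp
      qed
      then show ?thesis by simp
    qed
    moreover have "(LINT p:plate l|lborel. w p * tensor (deriv (deriv \<psi>)) \<eta> p)
        = (LINT p:plate l|lborel. ?W 2 0 v p * tensor \<psi> \<eta> p)" if "bump_on 0 pi \<psi>" "bump_on (-l) l \<eta>" for \<psi> \<eta>
      using w(5)[of 2 0, OF _ that] by (simp add: partial_tensor bump_on_smooth[OF that(1)] bump_on_smooth[OF that(2)])
    ultimately show ?thesis using w(1,3,4) by (intro exI[of _ w]) simp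
  qed
  obtain w where w: "continuous_on ({0..pi} \<times> {-l..l}) w" "\<And>p. p \<in> closure (plate l) \<Longrightarrow> u p = w p"
    "\<And>y. y \<in> {-l<..<l} \<Longrightarrow> w (0, y) = 0" "\<And>y. y \<in> {-l<..<l} \<Longrightarrow> w (pi, y) = 0"
    "\<And>\<psi> \<eta>. bump_on 0 pi \<psi> \<Longrightarrow> bump_on (-l) l \<eta> \<Longrightarrow>
        (LINT p:plate l|lborel. w p * tensor (deriv (deriv \<psi>)) \<eta> p)
        = (LINT p:plate l|lborel. ?W 2 0 u p * tensor \<psi> \<eta> p)"
    using rep[of u] u by (auto simp: plate_solution_def)
  obtain w' where w': "continuous_on ({0..pi} \<times> {-l..l}) w'" "\<And>p. p \<in> closure (plate l) \<Longrightarrow> U p = w' p"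
    "\<And>y. y \<in> {-l<..<l} \<Longrightarrow> w' (0, y) = 0" "\<And>y. y \<in> {-l<..<l} \<Longrightarrow> w' (pi, y) = 0"
    "\<And>\<psi> \<eta>. bump_on 0 pi \<psi> \<Longrightarrow> bump_on (-l) l \<eta> \<Longrightarrow>
        (LINT p:plate l|lborel. w' p * tensor (deriv (deriv \<psi>)) \<eta> p)
        = (LINT p:plate l|lborel. ?W 2 0 U p * tensor \<psi> \<eta> p)"
    using rep[of U] U by (auto simp: plate_solution_def)
  let ?d = "\<lambda>p. w p - w' p"
  have dc: "continuous_on ({0..pi} \<times> {-l..l}) ?d" by (intro continuous_intros w w')
  have wL: "w \<in> L2_space (plate l)" "w' \<in> L2_space (plate l)"
    unfolding plate_def by (rule L2_space_continuous, fact)+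
  have tL: "tensor X Y \<in> L2_space (plate l)" if "smooth X" "smooth Y" for X Y
    unfolding plate_def using that by (rule tensor_L2)
  have pl: "0 < pi" "-l < l" using l by auto
  have weak0: "(LINT p:plate l|lborel. ?d p * tensor (deriv (deriv \<psi>)) \<eta> p) = (LINT p:plate l|lborel. 0 * tensor \<psi> \<eta> p)"
    if b: "bump_on 0 pi \<psi>" "bump_on (-l) l \<eta>" for \<psi> \<eta>
  proof -
    have s: "smooth \<psi>" "smooth \<eta>" using b bump_on_smooth by auto
    have "(LINT p:plate l|lborel. ?d p * tensor (deriv (deriv \<psi>)) \<eta> p)
      = (LINT p:plate l|lborel. w p * tensor (deriv (deriv \<psi>)) \<eta> p) - (LINT p:plate l|lborel. w' p * tensor (deriv (deriv \<psi>)) \<eta> p)"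
      unfolding left_diff_distrib by (intro set_integral_diff L2_space_mult wL tL smooth_deriv s)
    also have "\<dots> = (LINT p:plate l|lborel. ?W 2 0 u p * tensor \<psi> \<eta> p) - (LINT p:plate l|lborel. ?W 2 0 U p * tensor \<psi> \<eta> p)"
      using w(5) w'(5) b by simp
    also have "(LINT p:plate l|lborel. ?W 2 0 u p * tensor \<psi> \<eta> p) = (LINT p:plate l|lborel. ?W 2 0 U p * tensor \<psi> \<eta> p)"
      by (rule set_LINT_cong_AE[OF L2_space_mult L2_space_mult])
        (use L tL[OF s] xx in \<open>auto elim!: eventually_mono\<close>)
    finally show ?thesis by simp
  qed
  have mom: "(LINT p:plate l|lborel. ?d p * tensor (\<lambda>x. x ^ k) (\<lambda>y. y ^ m) p) = 0" for k m
  proof -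
    define K where "K = real (Suc (Suc k)) * real (Suc k)"
    have K: "K \<noteq> 0" by (simp add: K_def del: of_nat_Suc)
    \<comment> \<open>A second primitive of x^k; the linear term is chosen so that X vanishes at pi
      as well as at 0.\<close>
    define X where "X = (\<lambda>x::real. (x ^ Suc (Suc k) - pi ^ Suc k * x) / K)"
    have X: "smooth X" unfolding X_def using K
      by (intro smooth_divide smooth_diff smooth_mult smooth_const smooth_power smooth_ident)
    have dp: "((\<lambda>x::real. x ^ Suc n) has_real_derivative real (Suc n) * x ^ n) (at x)" for n x
      using DERIV_pow[of "Suc n" x] by simp
    have dX: "deriv X = (\<lambda>x. (real (Suc (Suc k)) * x ^ Suc k - pi ^ Suc k) / K)"
      unfolding X_def
      by (rule ext, rule DERIV_imp_deriv) (intro DERIV_cdivide DERIV_diff dp DERIV_cmult_Id)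
    have "deriv (deriv X) = (\<lambda>x. (real (Suc (Suc k)) * (real (Suc k) * x ^ k) - 0) / K)"
      unfolding dX
      by (rule ext, rule DERIV_imp_deriv) (intro DERIV_cdivide DERIV_diff DERIV_cmult dp DERIV_const)
    also have "\<dots> = (\<lambda>x. x ^ k)"
      using K by (simp add: K_def mult.assoc[symmetric] del: of_nat_Suc)
    finally have ddX: "deriv (deriv X) = (\<lambda>x. x ^ k)" .
    have z: "(\<lambda>_. 0) \<in> L2_space ({0<..<pi} \<times> {-l<..<l})"
      by (intro L2_space_continuous continuous_intros)
    have "(LINT p:plate l|lborel. 0 * tensor X (\<lambda>y. y ^ m) p)
      = (LINT p:plate l|lborel. ?d p * tensor (deriv (deriv X)) (\<lambda>y. y ^ m) p)"
      unfolding plate_def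
      by (rule weak_green_xx[OF pl dc _ _ z weak0[unfolded plate_def] X])
        (use w(3,4) w'(3,4) in \<open>auto simp: X_def smooth_power smooth_ident\<close>)
    then show ?thesis unfolding ddX by simp
  qed
  obtain x y where xy: "p = (x, y)" "x \<in> {0..pi}" "y \<in> {-l..l}"
    using p unfolding closure_plate[OF l] by auto
  have "?d (x, y) = 0"
    by (rule zero_of_tensor_moments_zero[OF pl dc _ xy(2,3)]) (use mom in \<open>simp add: plate_def\<close>)
  then show ?thesis using w(2)[OF p] w'(2)[OF p] xy(1) by simp
qed

text \<open>General solution of (d^2 - 1)^2 \<phi> = p (1 - \<alpha>^2)^2 exp(\<alpha> y) for
  \<alpha> > 0, \<alpha> \<noteq> 1: the exponential is a particular solution, \<open>b\<close> and
  \<open>c\<close> weigh the odd solutions of the homogeneous equation, \<open>a\<close> and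
  \<open>d\<close> the even ones.\<close>

definition edge_profile :: "real \<Rightarrow> real \<Rightarrow> real \<Rightarrow> real \<Rightarrow> real \<Rightarrow> real \<Rightarrow> real \<Rightarrow> real" where
  "edge_profile \<alpha> p b c a d y
    = p * exp (\<alpha> * y) + b * sinh y + c * (y * cosh y) + a * cosh y + d * (y * sinh y)"

lemma smooth_edge_profile: "smooth (edge_profile \<alpha> p b c a d)"
  unfolding edge_profile_def[abs_def]
  by (intro smooth_add smooth_mult smooth_const smooth_exp smooth_sinh_cosh smooth_ident)

lemma edge_profile_derivs:
  fixes \<alpha> p b c a d y :: real
  defines "\<phi> \<equiv> edge_profile \<alpha> p b c a d"
  shows "deriv \<phi> y = p * \<alpha> * exp (\<alpha> * y) + (b + c) * cosh y + c * (y * sinh y) + (a + d) * sinh y + d * (y * cosh y)"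
    "(deriv ^^ 2) \<phi> y = p * \<alpha>^2 * exp (\<alpha> * y) + (b + 2 * c) * sinh y + c * (y * cosh y) + (a + 2 * d) * cosh y + d * (y * sinh y)"
    "(deriv ^^ 3) \<phi> y = p * \<alpha>^3 * exp (\<alpha> * y) + (b + 3 * c) * cosh y + c * (y * sinh y) + (a + 3 * d) * sinh y + d * (y * cosh y)"
    "(deriv ^^ 4) \<phi> y = p * \<alpha>^4 * exp (\<alpha> * y) + (b + 4 * c) * sinh y + c * (y * cosh y) + (a + 4 * d) * cosh y + d * (y * sinh y)"
proof -
  have 1: "deriv \<phi> = (\<lambda>y. p * \<alpha> * exp (\<alpha> * y) + (b + c) * cosh y + c * (y * sinh y) + (a + d) * sinh y + d * (y * cosh y))"
    unfolding \<phi>_def edge_profile_def[abs_def]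
    by (rule ext, rule DERIV_imp_deriv) (auto intro!: derivative_eq_intros simp: algebra_simps)
  have 2: "(deriv ^^ 2) \<phi> = (\<lambda>y. p * \<alpha>^2 * exp (\<alpha> * y) + (b + 2 * c) * sinh y + c * (y * cosh y) + (a + 2 * d) * cosh y + d * (y * sinh y))"
    unfolding funpow_simps_right numeral_2_eq_2 funpow_0 comp_apply 1 id_apply funpow.simps
    by (rule ext, rule DERIV_imp_deriv) (auto intro!: derivative_eq_intros simp: algebra_simps power2_eq_square)
  have 3: "(deriv ^^ 3) \<phi> = (\<lambda>y. p * \<alpha>^3 * exp (\<alpha> * y) + (b + 3 * c) * cosh y + c * (y * sinh y) + (a + 3 * d) * sinh y + d * (y * cosh y))"
    unfolding numeral_3_eq_3 numeral_2_eq_2[symmetric] funpow.simps comp_apply 2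
    by (rule ext, rule DERIV_imp_deriv) (auto intro!: derivative_eq_intros simp: algebra_simps power2_eq_square power3_eq_cube)
  have 4: "(deriv ^^ 4) \<phi> = (\<lambda>y. p * \<alpha>^4 * exp (\<alpha> * y) + (b + 4 * c) * sinh y + c * (y * cosh y) + (a + 4 * d) * cosh y + d * (y * sinh y))"
  proof -
    have "(deriv ^^ 4) \<phi> = deriv ((deriv ^^ 3) \<phi>)" by (simp add: eval_nat_numeral)
    then show ?thesis unfolding 3
      by (simp, intro ext DERIV_imp_deriv) (auto intro!: derivative_eq_intros simp: algebra_simps power_numeral_reduce)
  qed
  show "deriv \<phi> y = p * \<alpha> * exp (\<alpha> * y) + (b + c) * cosh y + c * (y * sinh y) + (a + d) * sinh y + d * (y * cosh y)"
    "(deriv ^^ 2) \<phi> y = p * \<alpha>^2 * exp (\<alpha> * y) + (b + 2 * c) * sinh y + c * (y * cosh y) + (a + 2 * d) * cosh y + d * (y * sinh y)"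
    "(deriv ^^ 3) \<phi> y = p * \<alpha>^3 * exp (\<alpha> * y) + (b + 3 * c) * cosh y + c * (y * sinh y) + (a + 3 * d) * sinh y + d * (y * cosh y)"
    "(deriv ^^ 4) \<phi> y = p * \<alpha>^4 * exp (\<alpha> * y) + (b + 4 * c) * sinh y + c * (y * cosh y) + (a + 4 * d) * cosh y + d * (y * sinh y)"
    unfolding 1 2 3 4 by simp_all
qed

section \<open>The exponential load\<close>

lemma real_le_sinh:
  fixes x :: real assumes "0 \<le> x" shows "x \<le> sinh x"
proof -
  have "sinh 0 - 0 \<le> sinh x - x"
  proof (rule DERIV_nonneg_imp_nondecreasing[OF assms])
    fix t :: real
    have "((\<lambda>t. sinh t - t) has_real_derivative cosh t - 1) (at t)"
      by (auto intro!: derivative_eq_intros)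
    then show "\<exists>y. ((\<lambda>t. sinh t - t) has_real_derivative y) (at t) \<and> 0 \<le> y"
      using cosh_real_ge_1[of t] by force
  qed
  then show ?thesis by simp
qed

text \<open>With exp(\<alpha> y) split into cosh and sinh, each edge condition at l is the sum of
  its odd and its even equation. At -l one of the two parts changes sign, so both equations together
  give all four conditions.\<close>

lemma edge_profile_bc:
  fixes l \<sigma> \<alpha> p b c a d :: real
  assumes odd1: "(1 - \<sigma>) * sinh l * b + (2 * sinh l + (1 - \<sigma>) * l * cosh l) * c = p * (\<sigma> - \<alpha>\<^sup>2) * sinh (\<alpha> * l)"
    and odd2: "(\<sigma> - 1) * cosh l * b + ((1 + \<sigma>) * cosh l + (\<sigma> - 1) * l * sinh l) * c
       = p * (\<alpha> * ((2 - \<sigma>) - \<alpha>\<^sup>2)) * cosh (\<alpha> * l)"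
    and even1: "(1 - \<sigma>) * cosh l * a + (2 * cosh l + (1 - \<sigma>) * l * sinh l) * d = p * (\<sigma> - \<alpha>\<^sup>2) * cosh (\<alpha> * l)"
    and even2: "(\<sigma> - 1) * sinh l * a + ((1 + \<sigma>) * sinh l + (\<sigma> - 1) * l * cosh l) * d
       = p * (\<alpha> * ((2 - \<sigma>) - \<alpha>\<^sup>2)) * sinh (\<alpha> * l)"
    and y: "y \<in> {-l, l}"
  shows "(deriv ^^ 2) (edge_profile \<alpha> p b c a d) y = \<sigma> * edge_profile \<alpha> p b c a d y"
    "(deriv ^^ 3) (edge_profile \<alpha> p b c a d) y = (2 - \<sigma>) * deriv (edge_profile \<alpha> p b c a d) y"
proof -
  have e: "exp (\<alpha> * l) = cosh (\<alpha> * l) + sinh (\<alpha> * l)" "exp (- (\<alpha> * l)) = cosh (\<alpha> * l) - sinh (\<alpha> * l)"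
    by (simp_all add: cosh_plus_sinh cosh_minus_sinh)
  show "(deriv ^^ 2) (edge_profile \<alpha> p b c a d) y = \<sigma> * edge_profile \<alpha> p b c a d y"
  proof (cases "y = l")
    case True
    show ?thesis using odd1 even1 unfolding True edge_profile_derivs edge_profile_def e
      by (simp add: algebra_simps)
  next
    case False
    then have y: "y = -l" using y by auto
    show ?thesis using odd1 even1 unfolding y edge_profile_derivs edge_profile_def mult_minus_right e sinh_minus cosh_minus
      by (simp add: algebra_simps)
  qed
  show "(deriv ^^ 3) (edge_profile \<alpha> p b c a d) y = (2 - \<sigma>) * deriv (edge_profile \<alpha> p b c a d) y"
  proof (cases "y = l")
    case True
    show ?thesis using odd2 even2 unfolding True edge_profile_derivs edge_profile_def e
      by (simp add: algebra_simps power2_eq_square power3_eq_cube)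
  next
    case False
    then have y: "y = -l" using y by auto
    show ?thesis using odd2 even2 unfolding y edge_profile_derivs edge_profile_def mult_minus_right e sinh_minus cosh_minus
      by (simp add: algebra_simps power2_eq_square power3_eq_cube)
  qed
qed

text \<open>The determinant is (1 - \<sigma>) ((3 + \<sigma>) sinh l cosh l - (1 - \<sigma>) l). In
  contrast to the odd system the last sign is minus, and positivity rests on l \<le> sinh l cosh l.
  Existence of \<open>a\<close> and \<open>d\<close> is enough, because the even part cancels in the
  gap.\<close>

lemma even_edge_system_solvable:
  fixes l \<sigma> P Q :: real
  assumes l: "l > 0" and \<sigma>: "0 < \<sigma>" "\<sigma> < 1"
  obtains a d where "(1 - \<sigma>) * cosh l * a + (2 * cosh l + (1 - \<sigma>) * l * sinh l) * d = P"
    "(\<sigma> - 1) * sinh l * a + ((1 + \<sigma>) * sinh l + (\<sigma> - 1) * l * cosh l) * d = Q"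
proof -
  have "l \<le> sinh l" using l by (intro real_le_sinh) simp
  also have "sinh l \<le> sinh l * cosh l" using l cosh_real_ge_1[of l] by (simp add: mult_le_cancel_left1)
  finally have "l \<le> sinh l * cosh l" .
  then have "(1 - \<sigma>) * l \<le> 1 * (sinh l * cosh l)" using \<sigma> l by (intro mult_mono) auto
  moreover have "sinh l * cosh l > 0" using l by simp
  then have "(3 + \<sigma>) * (sinh l * cosh l) > 1 * (sinh l * cosh l)"
    using \<sigma> by (intro mult_strict_right_mono) auto
  ultimately have pos: "(3 + \<sigma>) * (sinh l * cosh l) - (1 - \<sigma>) * l > 0" by linarith
  have "(1 - \<sigma>) * cosh l * ((1 + \<sigma>) * sinh l + (\<sigma> - 1) * l * cosh l)
      - (2 * cosh l + (1 - \<sigma>) * l * sinh l) * ((\<sigma> - 1) * sinh l)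
    = (1 - \<sigma>) * ((3 + \<sigma>) * (sinh l * cosh l) - (1 - \<sigma>) * l * ((cosh l)\<^sup>2 - (sinh l)\<^sup>2))"
    by (simp add: algebra_simps power2_eq_square)
  also have "\<dots> = (1 - \<sigma>) * ((3 + \<sigma>) * (sinh l * cosh l) - (1 - \<sigma>) * l)"
    by (simp add: cosh_square_eq)
  also have "\<dots> \<noteq> 0" using pos \<sigma> by simp
  finally show ?thesis using linear_2x2_iff that by blast
qed

lemma plate_solution_exp_load:
  fixes l \<sigma> \<alpha> :: real
  assumes l: "l > 0" and \<sigma>: "0 < \<sigma>" "\<sigma> < 1" and \<alpha>: "\<alpha> > 0" "\<alpha> \<noteq> 1"
  obtains a d where "plate_solution l \<sigma> (exp_load l \<alpha>) (tensor sin (edge_profile \<alpha>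
     (\<alpha> / (4 * sinh (\<alpha> * l) * (1 - \<alpha>\<^sup>2)\<^sup>2))
     (\<alpha> * coeff_B l \<sigma> \<alpha> / (4 * sinh (\<alpha> * l))) (\<alpha> * coeff_C l \<sigma> \<alpha> / (4 * sinh (\<alpha> * l))) a d))"
proof -
  define s where "s = sinh (\<alpha> * l)"
  define p b c where "p = \<alpha> / (4 * s * (1 - \<alpha>\<^sup>2)\<^sup>2)" and "b = \<alpha> * coeff_B l \<sigma> \<alpha> / (4 * s)"
    and "c = \<alpha> * coeff_C l \<sigma> \<alpha> / (4 * s)"
  \<comment> \<open>The load is \<open>r\<close> exp(\<alpha> y) sin x, whereas
    \<open>coeff_B\<close> and \<open>coeff_C\<close> belong to the load exp(\<alpha> y) sin x,
    whose particular solution has amplitude 1 / (1 - \<alpha>^2)^2. By linearity everything is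
    scaled by \<open>r\<close>.\<close>
  define r where "r = \<alpha> / (4 * s)"
  have r: "b = r * coeff_B l \<sigma> \<alpha>" "c = r * coeff_C l \<sigma> \<alpha>"
    by (simp_all add: b_def c_def r_def)
  have s: "s > 0" using l \<alpha> by (simp add: s_def)
  have N: "(1 - \<alpha>\<^sup>2)\<^sup>2 \<noteq> 0" using \<alpha> by (auto simp: power2_eq_1_iff)
  have es: "edge_system l \<sigma> \<alpha> (coeff_B l \<sigma> \<alpha>) (coeff_C l \<sigma> \<alpha>)"
    using edge_system_iff[OF l \<sigma> \<alpha>] by blast
  have odd1: "(1 - \<sigma>) * sinh l * b + (2 * sinh l + (1 - \<sigma>) * l * cosh l) * c = p * (\<sigma> - \<alpha>\<^sup>2) * sinh (\<alpha> * l)"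
  proof -
    have "(1 - \<sigma>) * sinh l * b + (2 * sinh l + (1 - \<sigma>) * l * cosh l) * c
      = r * ((1 - \<sigma>) * sinh l * coeff_B l \<sigma> \<alpha> + (2 * sinh l + (1 - \<sigma>) * l * cosh l) * coeff_C l \<sigma> \<alpha>)"
      unfolding r by (simp add: algebra_simps)
    also have "\<dots> = r * ((\<sigma> - \<alpha>\<^sup>2) / (1 - \<alpha>\<^sup>2)\<^sup>2 * sinh (\<alpha> * l))"
      using es by (simp add: edge_system_def)
    finally show ?thesis by (simp add: p_def r_def)
  qed
  have odd2: "(\<sigma> - 1) * cosh l * b + ((1 + \<sigma>) * cosh l + (\<sigma> - 1) * l * sinh l) * c
       = p * (\<alpha> * ((2 - \<sigma>) - \<alpha>\<^sup>2)) * cosh (\<alpha> * l)"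
  proof -
    have "(\<sigma> - 1) * cosh l * b + ((1 + \<sigma>) * cosh l + (\<sigma> - 1) * l * sinh l) * c
      = r * ((\<sigma> - 1) * cosh l * coeff_B l \<sigma> \<alpha> + ((1 + \<sigma>) * cosh l + (\<sigma> - 1) * l * sinh l) * coeff_C l \<sigma> \<alpha>)"
      unfolding r by (simp add: algebra_simps)
    also have "\<dots> = r * (\<alpha> * (((2 - \<sigma>) - \<alpha>\<^sup>2) / (1 - \<alpha>\<^sup>2)\<^sup>2) * cosh (\<alpha> * l))"
      using es by (simp add: edge_system_def)
    finally show ?thesis by (simp add: p_def r_def)
  qed
  obtain a d where even: "(1 - \<sigma>) * cosh l * a + (2 * cosh l + (1 - \<sigma>) * l * sinh l) * d = p * (\<sigma> - \<alpha>\<^sup>2) * cosh (\<alpha> * l)"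
    "(\<sigma> - 1) * sinh l * a + ((1 + \<sigma>) * sinh l + (\<sigma> - 1) * l * cosh l) * d
       = p * (\<alpha> * ((2 - \<sigma>) - \<alpha>\<^sup>2)) * sinh (\<alpha> * l)"
    using even_edge_system_solvable[OF l \<sigma>] by metis
  define \<phi> where "\<phi> = edge_profile \<alpha> p b c a d"
  have sm: "smooth \<phi>" unfolding \<phi>_def by (rule smooth_edge_profile)
  have cont: "continuous_on S (tensor sin \<phi>)" for S
    by (intro continuous_on_tensor smooth_continuous_on smooth_sin_cos sm)
  have H2: "tensor sin \<phi> \<in> H2_star l"
    unfolding H2_star_def
  proof (intro CollectI conjI exI)
    show "tensor sin \<phi> \<in> sobolev_H 2 (plate l)"
      unfolding plate_def using l by (intro tensor_sobolev smooth_sin_cos sm) auto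
    show "continuous_on (closure (plate l)) (tensor sin \<phi>)" by (rule cont)
  qed auto
  let ?f = "\<lambda>y. \<alpha> / (4 * s) * exp (\<alpha> * y)"
  have "plate_inner l \<sigma> (tensor sin \<phi>) v = (LINT p:plate l|lborel. tensor sin ?f p * v p)"
    if v: "v \<in> H2_star l" for v
  proof (rule plate_inner_separated[OF l v sm])
    have p: "p * (1 - \<alpha>\<^sup>2)\<^sup>2 = \<alpha> / (4 * s)" using N by (simp add: p_def)
    show "(deriv ^^ 4) \<phi> y - 2 * (deriv ^^ 2) \<phi> y + \<phi> y = ?f y" for y
      unfolding p[symmetric] \<phi>_def edge_profile_derivs edge_profile_def
      by (simp add: algebra_simps power2_eq_square power4_eq_xxxx)
    show "(deriv ^^ 2) \<phi> y = \<sigma> * \<phi> y" "(deriv ^^ 3) \<phi> y = (2 - \<sigma>) * deriv \<phi> y" if "y \<in> {-l, l}" for y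
      unfolding \<phi>_def using edge_profile_bc[OF odd1 odd2 even that] by blast+
  qed
  moreover have "tensor sin ?f = exp_load l \<alpha>"
    by (auto simp: tensor_def exp_load_def s_def)
  ultimately have "plate_solution l \<sigma> (exp_load l \<alpha>) (tensor sin \<phi>)"
    using H2 cont by (simp add: plate_solution_def)
  then show ?thesis using that unfolding \<phi>_def p_def b_def c_def s_def by blast
qed

lemma gap_exp_load:
  fixes l \<sigma> \<alpha> :: real
  assumes l: "l > 0" and \<sigma>: "0 < \<sigma>" "\<sigma> < 1" and \<alpha>: "\<alpha> > 0" "\<alpha> \<noteq> 1"
    and u: "plate_solution l \<sigma> (exp_load l \<alpha>) u" and x: "x \<in> {0..pi}"
  shows "gap l u x = E_gap l \<sigma> \<alpha> * sin x"
proof -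
  have s: "sinh (\<alpha> * l) > 0" using l \<alpha> by simp
  obtain a d where U: "plate_solution l \<sigma> (exp_load l \<alpha>) (tensor sin (edge_profile \<alpha>
     (\<alpha> / (4 * sinh (\<alpha> * l) * (1 - \<alpha>\<^sup>2)\<^sup>2))
     (\<alpha> * coeff_B l \<sigma> \<alpha> / (4 * sinh (\<alpha> * l))) (\<alpha> * coeff_C l \<sigma> \<alpha> / (4 * sinh (\<alpha> * l))) a d))"
    by (rule plate_solution_exp_load[OF l \<sigma> \<alpha>])
  define \<phi> where "\<phi> = edge_profile \<alpha>
     (\<alpha> / (4 * sinh (\<alpha> * l) * (1 - \<alpha>\<^sup>2)\<^sup>2))
     (\<alpha> * coeff_B l \<sigma> \<alpha> / (4 * sinh (\<alpha> * l))) (\<alpha> * coeff_C l \<sigma> \<alpha> / (4 * sinh (\<alpha> * l))) a d"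
  have "u p = tensor sin \<phi> p" if "p \<in> closure (plate l)" for p
    unfolding \<phi>_def by (rule plate_solution_unique[OF l \<sigma> u U that])
  then have "u (x, l) = sin x * \<phi> l" "u (x, -l) = sin x * \<phi> (-l)"
    using x l by (simp_all add: closure_plate)
  then have "gap l u x = (\<phi> l - \<phi> (-l)) * sin x" by (simp add: gap_def algebra_simps)
  \<comment> \<open>The even terms with \<open>a\<close> and \<open>d\<close> cancel and the odd
    ones double, which turns the 4 of the load into the 2 of \<open>E_gap\<close>.\<close>
  also have "\<phi> l - \<phi> (-l) = \<alpha> / (4 * sinh (\<alpha> * l) * (1 - \<alpha>\<^sup>2)\<^sup>2) * (exp (\<alpha> * l) - exp (- (\<alpha> * l)))
     + 2 * (\<alpha> * coeff_B l \<sigma> \<alpha> / (4 * sinh (\<alpha> * l)) * sinh l)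
     + 2 * (\<alpha> * coeff_C l \<sigma> \<alpha> / (4 * sinh (\<alpha> * l)) * (l * cosh l))"
    unfolding \<phi>_def edge_profile_def by (simp add: algebra_simps diff_divide_distrib)
  also have "exp (\<alpha> * l) - exp (- (\<alpha> * l)) = 2 * sinh (\<alpha> * l)"
    by (simp add: sinh_field_def)
  also have "\<alpha> / (4 * sinh (\<alpha> * l) * (1 - \<alpha>\<^sup>2)\<^sup>2) * (2 * sinh (\<alpha> * l))
     + 2 * (\<alpha> * coeff_B l \<sigma> \<alpha> / (4 * sinh (\<alpha> * l)) * sinh l)
     + 2 * (\<alpha> * coeff_C l \<sigma> \<alpha> / (4 * sinh (\<alpha> * l)) * (l * cosh l)) = E_gap l \<sigma> \<alpha>"
    using s l \<alpha> by (simp add: E_gap_def mult_ac)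
  finally show ?thesis .
qed

text \<open>In the proof, \<open>w0\<close> is the odd response to a load concentrated on the free edges. The bracket \<open>J\<close>
  is the boundary term in Green's formula for \<open>(d\<^sup>2 - 1)\<^sup>2\<close>, so \<open>J' = w0 (d\<^sup>2 - 1)\<^sup>2 \<phi>0 \<ge> 0\<close>, while
  the edge conditions reduce \<open>J l\<close> to a positive multiple of \<open>\<phi>0 l\<close>.\<close>

lemma odd_profile_nonneg:
  fixes l \<sigma> \<alpha> p b c :: real
  assumes l: "l > 0" and \<sigma>: "0 < \<sigma>" "\<sigma> < 1" and \<alpha>: "\<alpha> > 0" and p: "p \<ge> 0"
    and odd1: "(1 - \<sigma>) * sinh l * b + (2 * sinh l + (1 - \<sigma>) * l * cosh l) * c = p * (\<sigma> - \<alpha>\<^sup>2) * sinh (\<alpha> * l)"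
    and odd2: "(\<sigma> - 1) * cosh l * b + ((1 + \<sigma>) * cosh l + (\<sigma> - 1) * l * sinh l) * c
       = p * (\<alpha> * ((2 - \<sigma>) - \<alpha>\<^sup>2)) * cosh (\<alpha> * l)"
  shows "0 \<le> p * sinh (\<alpha> * l) + b * sinh l + c * (l * cosh l)"
proof -
  define S K where "S = sinh l" and "K = cosh l"
  have SK: "S > 0" "K > 0" "S \<le> K" "K\<^sup>2 = S\<^sup>2 + 1"
    using l by (simp_all add: S_def K_def cosh_square_eq sinh_le_cosh_real)
  define \<phi>0 \<phi>1 \<phi>2 \<phi>3 \<phi>4 where
    "\<phi>0 = (\<lambda>y. p * sinh (\<alpha> * y) + b * sinh y + c * (y * cosh y))" and
    "\<phi>1 = (\<lambda>y. p * \<alpha> * cosh (\<alpha> * y) + (b + c) * cosh y + c * (y * sinh y))" and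
    "\<phi>2 = (\<lambda>y. p * \<alpha>^2 * sinh (\<alpha> * y) + (b + 2 * c) * sinh y + c * (y * cosh y))" and
    "\<phi>3 = (\<lambda>y. p * \<alpha>^3 * cosh (\<alpha> * y) + (b + 3 * c) * cosh y + c * (y * sinh y))" and
    "\<phi>4 = (\<lambda>y. p * \<alpha>^4 * sinh (\<alpha> * y) + (b + 4 * c) * sinh y + c * (y * cosh y))"
  \<comment> \<open>The coefficient vector is orthogonal to the first row of the odd edge system, so
    \<open>w0\<close> meets the first edge condition and fails the second. The defect (2 - \<sigma>)
    w1 - w3 at l is then the determinant of that system, which is positive.\<close>
  define B C where "B = 2 * S + (1 - \<sigma>) * l * K" and "C = - ((1 - \<sigma>) * S)"
  define w0 w1 w2 w3 w4 where
    "w0 = (\<lambda>y. B * sinh y + C * (y * cosh y))" and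
    "w1 = (\<lambda>y. (B + C) * cosh y + C * (y * sinh y))" and
    "w2 = (\<lambda>y. (B + 2 * C) * sinh y + C * (y * cosh y))" and
    "w3 = (\<lambda>y. (B + 3 * C) * cosh y + C * (y * sinh y))" and
    "w4 = (\<lambda>y. (B + 4 * C) * sinh y + C * (y * cosh y))"
  have D\<phi>: "(\<phi>0 has_real_derivative \<phi>1 y) (at y)" "(\<phi>1 has_real_derivative \<phi>2 y) (at y)"
    "(\<phi>2 has_real_derivative \<phi>3 y) (at y)" "(\<phi>3 has_real_derivative \<phi>4 y) (at y)" for y
    unfolding \<phi>0_def \<phi>1_def \<phi>2_def \<phi>3_def \<phi>4_def
    by (auto intro!: derivative_eq_intros simp: algebra_simps power2_eq_square power3_eq_cube power4_eq_xxxx)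
  have Dw: "(w0 has_real_derivative w1 y) (at y)" "(w1 has_real_derivative w2 y) (at y)"
    "(w2 has_real_derivative w3 y) (at y)" "(w3 has_real_derivative w4 y) (at y)" for y
    unfolding w0_def w1_def w2_def w3_def w4_def
    by (auto intro!: derivative_eq_intros simp: algebra_simps)
  define J where "J = (\<lambda>y. \<phi>3 y * w0 y - \<phi>2 y * w1 y + \<phi>1 y * w2 y - \<phi>0 y * w3 y
     - 2 * (\<phi>1 y * w0 y) + 2 * (\<phi>0 y * w1 y))"
  have DJ: "(J has_real_derivative w0 y * (p * (1 - \<alpha>\<^sup>2)\<^sup>2 * sinh (\<alpha> * y))) (at y)" for y
  proof -
    have "(J has_real_derivative w0 y * (\<phi>4 y - 2 * \<phi>2 y + \<phi>0 y) - \<phi>0 y * (w4 y - 2 * w2 y + w0 y)) (at y)"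
      unfolding J_def by (auto intro!: derivative_eq_intros D\<phi> Dw simp: algebra_simps)
    moreover have "\<phi>4 y - 2 * \<phi>2 y + \<phi>0 y = p * (1 - \<alpha>\<^sup>2)\<^sup>2 * sinh (\<alpha> * y)"
      unfolding \<phi>0_def \<phi>2_def \<phi>4_def by (simp add: algebra_simps power2_eq_square power4_eq_xxxx)
    moreover have "w4 y - 2 * w2 y + w0 y = 0"
      unfolding w0_def w2_def w4_def by (simp add: algebra_simps)
    ultimately show ?thesis by simp
  qed
  \<comment> \<open>Nonnegativity of \<open>w0\<close> is reached through its derivative, as
    \<open>w0\<close> is 0 at 0. In \<open>w1\<close> the only negative term, y sinh y sinh l, is
    dominated by l cosh y cosh l for 0 \<le> y \<le> l.\<close>
  have w1: "w1 y \<ge> 0" if "0 \<le> y" "y \<le> l" for y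
  proof -
    have "(y * sinh y) * S \<le> (l * cosh y) * K"
      using that l SK by (intro mult_mono sinh_le_cosh_real) auto
    then have "0 \<le> (1 - \<sigma>) * (l * cosh y * K - y * sinh y * S)" using \<sigma> by simp
    moreover have "0 \<le> (1 + \<sigma>) * S * cosh y" using \<sigma> SK by simp
    moreover have "w1 y = (1 + \<sigma>) * S * cosh y + (1 - \<sigma>) * (l * cosh y * K - y * sinh y * S)"
      unfolding w1_def B_def C_def by (simp add: algebra_simps)
    ultimately show ?thesis by simp
  qed
  have w0: "w0 y \<ge> 0" if "0 \<le> y" "y \<le> l" for y
  proof -
    have "w0 0 \<le> w0 y"
      by (rule DERIV_nonneg_imp_nondecreasing[OF that(1)]) (use Dw(1) w1 that in \<open>force intro!: exI\<close>)
    then show ?thesis by (simp add: w0_def)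
  qed
  have "J 0 \<le> J l"
  proof (rule DERIV_nonneg_imp_nondecreasing[OF less_imp_le[OF l]])
    fix y assume y: "0 \<le> y" "y \<le> l"
    have "0 \<le> w0 y * (p * (1 - \<alpha>\<^sup>2)\<^sup>2 * sinh (\<alpha> * y))"
      using w0[OF y] p \<alpha> y by (intro mult_nonneg_nonneg) auto
    then show "\<exists>z. (J has_real_derivative z) (at y) \<and> 0 \<le> z" using DJ by blast
  qed
  \<comment> \<open>Each product in \<open>J\<close> contains one of the odd functions \<phi>0,
    \<phi>2, \<open>w0\<close>, \<open>w2\<close>.\<close>
  moreover have "J 0 = 0"
    unfolding J_def \<phi>0_def \<phi>2_def w0_def w2_def by simp
  moreover have "J l = \<phi>0 l * ((1 - \<sigma>) * ((3 + \<sigma>) * K * S + (1 - \<sigma>) * l))"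
  proof -
    have "\<phi>2 l = \<sigma> * \<phi>0 l"
      using odd1 unfolding \<phi>2_def \<phi>0_def by (simp add: algebra_simps)
    moreover have "\<phi>3 l = (2 - \<sigma>) * \<phi>1 l"
      using odd2 unfolding \<phi>3_def \<phi>1_def by (simp add: algebra_simps power2_eq_square power3_eq_cube)
    moreover have "w2 l = \<sigma> * w0 l"
      unfolding w2_def w0_def B_def C_def S_def[symmetric] K_def[symmetric] by (simp add: algebra_simps)
    ultimately have "J l = \<phi>0 l * ((2 - \<sigma>) * w1 l - w3 l)"
      unfolding J_def by (simp only:) (simp add: algebra_simps)
    also have "(2 - \<sigma>) * w1 l - w3 l = (1 - \<sigma>) * ((3 + \<sigma>) * K * S + (1 - \<sigma>) * l * (K\<^sup>2 - S\<^sup>2))"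
      unfolding w1_def w3_def B_def C_def S_def[symmetric] K_def[symmetric]
      by (simp add: algebra_simps power2_eq_square)
    finally show ?thesis by (simp add: SK)
  qed
  ultimately have "0 \<le> \<phi>0 l * ((1 - \<sigma>) * ((3 + \<sigma>) * K * S + (1 - \<sigma>) * l))" by simp
  moreover have "(1 - \<sigma>) * ((3 + \<sigma>) * K * S + (1 - \<sigma>) * l) > 0"
    using SK \<sigma> l by (intro mult_pos_pos add_pos_pos) auto
  ultimately have "0 \<le> \<phi>0 l" by (simp add: zero_le_mult_iff)
  then show ?thesis by (simp add: \<phi>0_def)
qed

text \<open>Wanted for every admissible \<alpha>, not just for large ones, since it turns the
  maximum |E| of the gap into E. The edge system is the case p = 1 / (1 - \<alpha>^2)^2 of
  \<open>odd_profile_nonneg\<close>, and \<open>E_gap\<close> is \<alpha> / (2 sinh(\<alpha> l))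
  times the edge value.\<close>

lemma E_gap_nonneg:
  fixes l \<sigma> \<alpha> :: real
  assumes l: "l > 0" and \<sigma>: "0 < \<sigma>" "\<sigma> < 1" and \<alpha>: "\<alpha> > 0" "\<alpha> \<noteq> 1"
  shows "0 \<le> E_gap l \<sigma> \<alpha>"
proof -
  define s where "s = sinh (\<alpha> * l)"
  have s: "s > 0" using l \<alpha> by (simp add: s_def)
  have es: "edge_system l \<sigma> \<alpha> (coeff_B l \<sigma> \<alpha>) (coeff_C l \<sigma> \<alpha>)"
    using edge_system_iff[OF l \<sigma> \<alpha>] by blast
  have "0 \<le> 1 / (1 - \<alpha>\<^sup>2)\<^sup>2 * sinh (\<alpha> * l) + coeff_B l \<sigma> \<alpha> * sinh l + coeff_C l \<sigma> \<alpha> * (l * cosh l)"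
    by (rule odd_profile_nonneg[OF l \<sigma> \<alpha>(1)]) (use es in \<open>simp_all add: edge_system_def\<close>)
  then have "0 \<le> \<alpha> / (2 * s) * (1 / (1 - \<alpha>\<^sup>2)\<^sup>2 * s + coeff_B l \<sigma> \<alpha> * sinh l + coeff_C l \<sigma> \<alpha> * (l * cosh l))"
    using s \<alpha> by (simp add: s_def)
  also have "\<dots> = E_gap l \<sigma> \<alpha>"
    unfolding E_gap_def s_def[symmetric] using s by (simp add: distrib_left mult_ac)
  finally show ?thesis .
qed

lemma max_gap_exp_load:
  fixes l \<sigma> \<alpha> :: real
  assumes "l > 0" "0 < \<sigma>" "\<sigma> < 1" "\<alpha> > 0" "\<alpha> \<noteq> 1" "plate_solution l \<sigma> (exp_load l \<alpha>) u"
  shows "max_gap l u = E_gap l \<sigma> \<alpha>"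
  unfolding max_gap_def
proof (rule Greatest_equality)
  have g: "\<bar>gap l u x\<bar> = E_gap l \<sigma> \<alpha> * sin x" if "x \<in> {0..pi}" for x
    using gap_exp_load[OF assms that] E_gap_nonneg[OF assms(1-5)] sin_ge_zero[of x] that
    by (simp add: abs_mult)
  show "E_gap l \<sigma> \<alpha> \<in> (\<lambda>x. \<bar>gap l u x\<bar>) ` {0..pi}"
    using g[of "pi / 2"] by (intro image_eqI[of _ _ "pi / 2"]) auto
  show "y \<le> E_gap l \<sigma> \<alpha>" if "y \<in> (\<lambda>x. \<bar>gap l u x\<bar>) ` {0..pi}" for y
    using that g E_gap_nonneg[OF assms(1-5)] by (auto simp: mult_left_le)
qed

text \<open>Exact form behind the expansion, with N = (\<alpha>^2 - 1)^2: E is \<alpha> / (2 N) -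
  \<alpha> (\<alpha>^2 - \<sigma>) / N times \<open>M\<close> plus q coth(\<alpha> l) times
  \<open>L\<close>. Here q - 1 is O(1 / \<alpha>^2) and coth(\<alpha> l) - 1 decays exponentially,
  so \<open>L\<close> is the limit and - M / \<alpha> the first correction.\<close>

lemma E_gap_expansion:
  fixes l \<sigma> :: real
  assumes l: "l > 0" and \<sigma>: "0 < \<sigma>" "\<sigma> < 1"
  shows "((\<lambda>\<alpha>. \<alpha> * (E_gap l \<sigma> \<alpha> - (E_limit l \<sigma> - 1 / \<alpha> *
          (((1 + \<sigma>) * cosh l * sinh l + (1 - \<sigma>) * l) /
           (2 * (1 - \<sigma>) * ((3 + \<sigma>) * cosh l * sinh l + (1 - \<sigma>) * l)))))) \<longlongrightarrow> 0) at_top"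
proof -
  define S K where "S = sinh l" and "K = cosh l"
  define D where "D = (3 + \<sigma>) * K * S + (1 - \<sigma>) * l"
  define M where "M = ((1 + \<sigma>) * K * S + (1 - \<sigma>) * l) / (2 * (1 - \<sigma>) * D)"
  define L where "L = S\<^sup>2 / ((1 - \<sigma>) * D)"
  have SK: "S > 0" "K > 0" "K\<^sup>2 = S\<^sup>2 + 1"
    using l by (simp_all add: S_def K_def cosh_square_eq)
  have D: "D > 0" unfolding D_def using SK l \<sigma> by (intro add_pos_pos mult_pos_pos) auto
  define q where "q = (\<lambda>\<alpha>::real. \<alpha>\<^sup>2 * (\<alpha>\<^sup>2 + \<sigma> - 2) / (\<alpha>\<^sup>2 - 1)\<^sup>2)"
  define ct where "ct = (\<lambda>\<alpha>. cosh (\<alpha> * l) / sinh (\<alpha> * l))"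
  \<comment> \<open>The error is arranged so that the constants \<open>M\<close> and
    \<open>L\<close> multiply scalar functions of \<alpha>, each of which has an elementary
    limit.\<close>
  have lim: "((\<lambda>\<alpha>. \<alpha>\<^sup>2 / (2 * (\<alpha>\<^sup>2 - 1)\<^sup>2) - M * (\<alpha> * (\<alpha> * (\<alpha>\<^sup>2 - \<sigma>) / (\<alpha>\<^sup>2 - 1)\<^sup>2) - 1)
      + L * (q \<alpha> * (\<alpha> * (ct \<alpha> - 1)) + \<alpha> * (q \<alpha> - 1))) \<longlongrightarrow> 0 - M * 0 + L * (1 * 0 + 0)) at_top"
  proof (intro tendsto_intros)
    show "((\<lambda>\<alpha>::real. \<alpha>\<^sup>2 / (2 * (\<alpha>\<^sup>2 - 1)\<^sup>2)) \<longlongrightarrow> 0) at_top" by real_asymp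
    show "((\<lambda>\<alpha>::real. \<alpha> * (\<alpha> * (\<alpha>\<^sup>2 - \<sigma>) / (\<alpha>\<^sup>2 - 1)\<^sup>2) - 1) \<longlongrightarrow> 0) at_top" using \<sigma> by real_asymp
    show "(q \<longlongrightarrow> 1) at_top" unfolding q_def using \<sigma> by real_asymp
    show "((\<lambda>\<alpha>. \<alpha> * (q \<alpha> - 1)) \<longlongrightarrow> 0) at_top" unfolding q_def using \<sigma> by real_asymp
    show "((\<lambda>\<alpha>. \<alpha> * (ct \<alpha> - 1)) \<longlongrightarrow> 0) at_top" unfolding ct_def using l by real_asymp
  qed
  show ?thesis
  proof (rule Lim_transform_eventually)
    show "((\<lambda>\<alpha>. \<alpha>\<^sup>2 / (2 * (\<alpha>\<^sup>2 - 1)\<^sup>2) - M * (\<alpha> * (\<alpha> * (\<alpha>\<^sup>2 - \<sigma>) / (\<alpha>\<^sup>2 - 1)\<^sup>2) - 1)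
      + L * (q \<alpha> * (\<alpha> * (ct \<alpha> - 1)) + \<alpha> * (q \<alpha> - 1))) \<longlongrightarrow> 0) at_top" using lim by simp
    show "\<forall>\<^sub>F \<alpha> in at_top. \<alpha>\<^sup>2 / (2 * (\<alpha>\<^sup>2 - 1)\<^sup>2) - M * (\<alpha> * (\<alpha> * (\<alpha>\<^sup>2 - \<sigma>) / (\<alpha>\<^sup>2 - 1)\<^sup>2) - 1)
      + L * (q \<alpha> * (\<alpha> * (ct \<alpha> - 1)) + \<alpha> * (q \<alpha> - 1))
      = \<alpha> * (E_gap l \<sigma> \<alpha> - (E_limit l \<sigma> - 1 / \<alpha> *
          (((1 + \<sigma>) * cosh l * sinh l + (1 - \<sigma>) * l) /
           (2 * (1 - \<sigma>) * ((3 + \<sigma>) * cosh l * sinh l + (1 - \<sigma>) * l)))))"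
      using eventually_gt_at_top[of 1]
    proof eventually_elim
      case (elim \<alpha>)
      define s where "s = sinh (\<alpha> * l)"
      define N where "N = (\<alpha>\<^sup>2 - 1)\<^sup>2"
      have s: "s > 0" using l elim by (simp add: s_def)
      have N: "N \<noteq> 0" "(1 - \<alpha>\<^sup>2)\<^sup>2 = N"
        using elim by (auto simp: N_def power2_eq_1_iff power2_commute)
      \<comment> \<open>Every hyperbolic function of \<alpha> l now cancels except through the
        quotient \<open>ct\<close>.\<close>
      have k: "cosh (\<alpha> * l) = ct \<alpha> * s" using s by (simp add: ct_def flip: s_def)
      have EL: "E_limit l \<sigma> = L"
        unfolding E_limit_def L_def D_def S_def K_def by (simp add: mult_ac add_ac)
      have B: "coeff_B l \<sigma> \<alpha> * S / s = - ((\<alpha>\<^sup>2 - \<sigma>) / N) * (((1 + \<sigma>) * K * S - (1 - \<sigma>) * l * S\<^sup>2) / ((1 - \<sigma>) * D))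
          + (\<alpha> * (\<alpha>\<^sup>2 + \<sigma> - 2) / N * ct \<alpha>) * ((2 * S\<^sup>2 + (1 - \<sigma>) * l * K * S) / ((1 - \<sigma>) * D))"
        unfolding coeff_B_def S_def[symmetric] K_def[symmetric] D_def[symmetric] N_def[symmetric] s_def[symmetric] k
        using s N D \<sigma> by (simp add: divide_simps) (simp add: algebra_simps power2_eq_square)
      have C: "coeff_C l \<sigma> \<alpha> * l * K / s = - ((\<alpha>\<^sup>2 - \<sigma>) / N) * (l * K\<^sup>2 / D)
          - (\<alpha> * (\<alpha>\<^sup>2 + \<sigma> - 2) / N * ct \<alpha>) * (l * K * S / D)"
        unfolding coeff_C_def S_def[symmetric] K_def[symmetric] D_def[symmetric] N_def[symmetric] s_def[symmetric] k
        using s N D \<sigma> by (simp add: divide_simps) (simp add: algebra_simps power2_eq_square)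
      \<comment> \<open>Adding the contributions of \<open>coeff_B\<close> and
        \<open>coeff_C\<close>: the terms in l combine through cosh^2 - sinh^2 = 1 in
        \<open>M\<close>, and those in l sinh l cosh l cancel in \<open>L\<close>.\<close>
      have M': "2 * M = ((1 + \<sigma>) * K * S - (1 - \<sigma>) * l * S\<^sup>2) / ((1 - \<sigma>) * D) + l * K\<^sup>2 / D"
        unfolding M_def SK(3) using D \<sigma> by (simp add: divide_simps) (simp add: algebra_simps)
      have L': "2 * L = (2 * S\<^sup>2 + (1 - \<sigma>) * l * K * S) / ((1 - \<sigma>) * D) - l * K * S / D"
        unfolding L_def using D \<sigma> by (simp add: divide_simps)
      have "E_gap l \<sigma> \<alpha> = \<alpha> / (2 * N) + \<alpha> / 2 * (coeff_B l \<sigma> \<alpha> * S / s + coeff_C l \<sigma> \<alpha> * l * K / s)"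
        unfolding E_gap_def N(2) S_def[symmetric] K_def[symmetric] s_def[symmetric]
        by (simp add: distrib_left mult_ac)
      also have "coeff_B l \<sigma> \<alpha> * S / s + coeff_C l \<sigma> \<alpha> * l * K / s
          = - ((\<alpha>\<^sup>2 - \<sigma>) / N) * (2 * M) + (\<alpha> * (\<alpha>\<^sup>2 + \<sigma> - 2) / N * ct \<alpha>) * (2 * L)"
        unfolding B C M' L' by (simp only: ring_distribs)
      also have "\<alpha> / (2 * N) + \<alpha> / 2 * \<dots> = \<alpha> / (2 * N) - \<alpha> * (\<alpha>\<^sup>2 - \<sigma>) / N * M + q \<alpha> * ct \<alpha> * L"
        unfolding q_def N_def[symmetric] using N by (simp add: field_simps power2_eq_square)
      finally have E: "E_gap l \<sigma> \<alpha> = \<alpha> / (2 * N) - \<alpha> * (\<alpha>\<^sup>2 - \<sigma>) / N * M + q \<alpha> * ct \<alpha> * L" .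
      have "\<alpha> * (E_gap l \<sigma> \<alpha> - (L - 1 / \<alpha> * M)) = \<alpha>\<^sup>2 / (2 * N) - M * (\<alpha> * (\<alpha> * (\<alpha>\<^sup>2 - \<sigma>) / N) - 1)
        + L * (q \<alpha> * (\<alpha> * (ct \<alpha> - 1)) + \<alpha> * (q \<alpha> - 1))"
        unfolding E using elim by (simp add: algebra_simps power2_eq_square)
      then show ?case
        unfolding EL unfolding M_def D_def S_def K_def N_def by simp
    qed
  qed
qed

theorem theorem2:
  fixes l \<sigma> :: real and u :: "real \<Rightarrow> real \<times> real \<Rightarrow> real"
  assumes "l > 0" and "0 < \<sigma>" and "\<sigma> < 1"
    and "\<And>\<alpha>. \<alpha> > 0 \<Longrightarrow> \<alpha> \<noteq> 1 \<Longrightarrow> plate_solution l \<sigma> (exp_load l \<alpha>) (u \<alpha>)"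
  shows "(\<forall>\<alpha>>0. \<alpha> \<noteq> 1 \<longrightarrow> (\<forall>x\<in>{0..pi}. gap l (u \<alpha>) x = E_gap l \<sigma> \<alpha> * sin x)) \<and>
    uniform_limit {0..pi} (\<lambda>\<alpha>. gap l (u \<alpha>)) (\<lambda>x. E_limit l \<sigma> * sin x) at_top \<and>
    (\<forall>\<alpha>>0. \<alpha> \<noteq> 1 \<longrightarrow> max_gap l (u \<alpha>) = E_gap l \<sigma> \<alpha>) \<and>
    (\<lambda>\<alpha>. E_gap l \<sigma> \<alpha> -
        (E_limit l \<sigma> - 1 / \<alpha> *
          (((1 + \<sigma>) * cosh l * sinh l + (1 - \<sigma>) * l) /
           (2 * (1 - \<sigma>) * ((3 + \<sigma>) * cosh l * sinh l + (1 - \<sigma>) * l)))))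
      \<in> o[at_top](\<lambda>\<alpha>. 1 / \<alpha>)"
proof -
  define M where "M = ((1 + \<sigma>) * cosh l * sinh l + (1 - \<sigma>) * l) /
           (2 * (1 - \<sigma>) * ((3 + \<sigma>) * cosh l * sinh l + (1 - \<sigma>) * l))"
  note exp = E_gap_expansion[OF assms(1-3), folded M_def]
  have gap: "gap l (u \<alpha>) x = E_gap l \<sigma> \<alpha> * sin x" if "\<alpha> > 0" "\<alpha> \<noteq> 1" "x \<in> {0..pi}" for \<alpha> x
    using gap_exp_load[OF assms(1-3) that(1,2) assms(4)[OF that(1,2)] that(3)] .
  have ev: "\<forall>\<^sub>F \<alpha> in at_top. \<alpha> > (1::real)" by (rule eventually_gt_at_top)
  \<comment> \<open>Convergence of \<open>E_gap\<close> is read off the expansion: the scaled error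
    is divided by \<alpha> again and added to the two leading terms.\<close>
  have "((\<lambda>\<alpha>. 1 / \<alpha> * (\<alpha> * (E_gap l \<sigma> \<alpha> - (E_limit l \<sigma> - 1 / \<alpha> * M))) + (E_limit l \<sigma> - 1 / \<alpha> * M))
     \<longlongrightarrow> 0 * 0 + (E_limit l \<sigma> - 0 * M)) at_top"
    by (intro tendsto_intros exp; real_asymp)
  then have "((\<lambda>\<alpha>. 1 / \<alpha> * (\<alpha> * (E_gap l \<sigma> \<alpha> - (E_limit l \<sigma> - 1 / \<alpha> * M))) + (E_limit l \<sigma> - 1 / \<alpha> * M))
     \<longlongrightarrow> E_limit l \<sigma>) at_top" by simp
  then have Elim: "((\<lambda>\<alpha>. E_gap l \<sigma> \<alpha>) \<longlongrightarrow> E_limit l \<sigma>) at_top"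
    by (rule Lim_transform_eventually) (use ev in eventually_elim, simp)
  have "uniform_limit {0..pi} (\<lambda>\<alpha>. gap l (u \<alpha>)) (\<lambda>x. E_limit l \<sigma> * sin x) at_top"
  proof (rule uniform_limitI)
    fix e :: real assume "e > 0"
    with Elim have "\<forall>\<^sub>F \<alpha> in at_top. dist (E_gap l \<sigma> \<alpha>) (E_limit l \<sigma>) < e"
      by (simp add: tendsto_iff)
    with ev show "\<forall>\<^sub>F \<alpha> in at_top. \<forall>x\<in>{0..pi}. dist (gap l (u \<alpha>) x) (E_limit l \<sigma> * sin x) < e"
    proof eventually_elim
      case (elim \<alpha>)
      show ?case
      proof
        fix x assume x: "x \<in> {0..pi}"
        have "dist (gap l (u \<alpha>) x) (E_limit l \<sigma> * sin x) = \<bar>E_gap l \<sigma> \<alpha> - E_limit l \<sigma>\<bar> * \<bar>sin x\<bar>"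
          using gap[of \<alpha> x] elim x by (simp add: dist_real_def left_diff_distrib[symmetric] abs_mult)
        also have "\<dots> \<le> \<bar>E_gap l \<sigma> \<alpha> - E_limit l \<sigma>\<bar>" by (simp add: mult_left_le)
        finally show "dist (gap l (u \<alpha>) x) (E_limit l \<sigma> * sin x) < e" using elim by (simp add: dist_real_def)
      qed
    qed
  qed
  moreover have "(\<lambda>\<alpha>. E_gap l \<sigma> \<alpha> - (E_limit l \<sigma> - 1 / \<alpha> * M)) \<in> o[at_top](\<lambda>\<alpha>. 1 / \<alpha>)"
  proof (rule smalloI_tendsto)
    show "((\<lambda>\<alpha>. (E_gap l \<sigma> \<alpha> - (E_limit l \<sigma> - 1 / \<alpha> * M)) / (1 / \<alpha>)) \<longlongrightarrow> 0) at_top"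
      using exp by (simp add: mult.commute)
    show "\<forall>\<^sub>F \<alpha> in at_top. 1 / \<alpha> \<noteq> (0::real)" using ev by eventually_elim simp
  qed
  moreover have "max_gap l (u \<alpha>) = E_gap l \<sigma> \<alpha>" if "\<alpha> > 0" "\<alpha> \<noteq> 1" for \<alpha>
    using max_gap_exp_load[OF assms(1-3) that assms(4)[OF that]] .
  ultimately show ?thesis using gap unfolding M_def by blast
qed

end
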